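(* Let $n\ge 2$ and $k\in\mathbb Z$. (i) Let $a\in\bigl(\tfrac{2k+1}{2n},\tfrac{k+1}{n}\bigr)$. Then the basis $Q_k'$ of $\mathcal S_n$ is a Stokes basis on the interval $(a-\tfrac12-\varepsilon,\,a+\varepsilon)$ for every sufficiently small $\varepsilon>0$. (ii) Let $a\in\bigl(\tfrac{k}{n},\tfrac{2k+1}{2n}\bigr)$. Then the basis $Q_k''$ of $\mathcal S_n$ is a Stokes basis on the interval $(a-\tfrac12-\varepsilon,\,a+\varepsilon)$ for every sufficiently small $\varepsilon>0$. Here "sufficiently small" means that the intervals $(a,a+\varepsilon)$ and $(a-\tfrac12-\varepsilon,a-\tfrac12)$ contain no points of the form $r/(2n)$, $r\in\mathbb Z$.
   Context: Cohomology. $T^n=(\mathbb C^\times)^n$ acts diagonally on $P^{n-1}$, with fixed points $pt_1,\dots,pt_n$ (the coordinate lines), and, with $\boldsymbol z=(z_1,\dots,z_n)$, $\boldsymbol y=(y_1,\dots,y_{n-1})$, $$H=H_{T^n}(P^{n-1};\mathbb C)=\mathbb C[x,\boldsymbol z]\Big/\Bigl\langle\prod_{a=1}^n(x-z_a)\Bigr\rangle=\mathbb C[x,\boldsymbol y,\boldsymbol z]^{S_{n-1}}\Big/\Bigl\langle (u-x)\prod_{j=1}^{n-1}(u-y_j)-\prod_{a=1}^n(u-z_a)\Bigr\rangle$$ (relation imposed identically in $u$). Restriction to $pt_I$ sends $x\mapsto z_I$ and $\{y_1,\dots,y_{n-1}\}\mapsto\{z_a: a\ne I\}$. For $\boldsymbol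 z$ with distinct coordinates the restrictions to the $n$ fixed points identify the fiber of $H$ at $\boldsymbol z$ with $\mathbb C^n$; $O(\cdot)$ for $H$-valued functions is understood componentwise under this identification. Solutions. Let $L''\subset\mathbb C^n$ be the set of $\boldsymbol z$ with $z_a-z_b\notin\mathbb Z$ for all $a\neq b$. Put $$\Phi(t,p,\boldsymbol z)=(e^{\pi\sqrt{-1}(2-n)}p)^t\prod_{a=1}^n\Gamma(z_a-t),\qquad W(t,\boldsymbol y)=\prod_{j=1}^{n-1}(y_j-t),$$ $$\Psi_J(p,\boldsymbol y,\boldsymbol z)=-\sum_{r\ge 0}\operatorname{Res}_{t=z_J+r}\Phi(t,p,\boldsymbol z)W(t,\boldsymbol y),\quad J=1,\dots,n,$$ $$\Psi^m(p,\boldsymbol y,\boldsymbol z)=\sum_{J=1}^n e^{2\pi\sqrt{-1}(m-1)z_J}\,\Psi_J(p,\boldsymbol y,\boldsymbol z),\qquad m\in\mathbb Z.$$ These are $H$-valued functions, holomorphic in $\boldsymbol z\in L''$ and in $p$ on the universal cover of $\mathbb C^\times$ (powers of $p$ use the chosen $\arg p$). They solve the equivariant quantum differential equation $p\,\frac{dI}{dp}=x*_{p,\boldsymbol z}I$, where $x*_{p,\boldsymbol z}$ is the linear operator with $x*x^j=x^{j+1}$ for $0\le j\le n-2$ and $x*x^{n-1}=p+x^n$ ($x^n$ reduced in $H$). Module. Put $\acute Z_j=e^{2\pi\sqrt{-1}z_j}$. $\mathcal S_n$ is the space of functions $\sum_{m=1}^nQ_m(\acute Z_1,\dots,\acute Z_n)\Psi^m$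 with $Q_m\in\mathbb C[\boldsymbol Z^{\pm1}]=\mathbb C[Z_1^{\pm1},\dots,Z_n^{\pm1}]$; it is a $\mathbb C[\boldsymbol Z^{\pm1}]$-module on which $Q(\boldsymbol Z)$ acts as multiplication by $Q(\acute Z_1,\dots,\acute Z_n)$, it contains all $\Psi^m$, $m\in\mathbb Z$, and any $n$ consecutive $\Psi^m$ form a basis of it. Let $s_i(\boldsymbol Z)$ be the $i$-th elementary symmetric function. Bases $Q_k',Q_k''$. Fix $k\in\mathbb Z$, put $v_m=\Psi^{k+m}$ for $1\le m\le n$, and for $1\le l\le m\le n$ put $v_m(l)=v_m-s_1(\boldsymbol Z)v_{m-1}+\dots+(-1)^{m-l}s_{m-l}(\boldsymbol Z)v_l$. If $n=2h+1$: $Q_k'$ has $v_1,\dots,v_{h+1}$ at positions $1,3,\dots,2h+1$ and $v_{2h+2-i}(i+1)$ at position $2i$, $i=1,\dots,h$; $Q_k''$ has $v_1,\dots,v_h,v_{h+1}$ at positions $2,4,\dots,2h,2h+1$ and $v_{2h+2-i}(i)$ at position $2i-1$, $i=1,\dots,h$. If $n=2h$: $Q_k'$ has $v_1,\dots,v_h,v_{h+1}$ at positions $1,3,\dots,2h-1,2h$ and $v_{2h+1-i}(i+1)$ at position $2i$, $i=1,\dots,h-1$; $Q_k''$ has $v_1,\dots,v_h$ at positions $2,4,\dots,2h$ and $v_{2h+1-i}(i)$ at position $2i-1$, $i=1,\dots,h$. Stokes bases. Put $p=s^n$, $s=re^{-2\pi\sqrt{-1}\phi}$, $r>0$, $\phi\in\mathbb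 R$, with $\log p=n(\log r-2\pi\sqrt{-1}\phi)$; put $\omega=e^{2\pi\sqrt{-1}/n}$. A number $\phi$ is resonant if $\phi=j/n$ for some $j\in\mathbb Z$. A basis of $\mathcal S_n$ is a Stokes basis on an interval $(b,c)$ if it can be reordered as $I_1,\dots,I_n$ so that for every $m=1,\dots,n$ and every non-resonant $\phi\in(b,c)$ (and every fixed $\boldsymbol z\in L''$), as $r\to\infty$, $$I_m(s^n,\boldsymbol y,\boldsymbol z)=\frac{(2\pi)^{(n-1)/2}}{\sqrt n}\,e^{n\omega^ms}\,(-\omega^ms)^{\sum_{a=1}^nz_a+(1-n)/2}\prod_{j=1}^{n-1}(y_j-\omega^ms)\,\bigl(1+O(1/s)\bigr),$$ where the power is defined by $\arg(-\omega^ms)=2\pi m/n-\pi-2\pi\phi+2\pi l_m$ for some integer $l_m$ not depending on $\phi\in(b,c)$. *)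

theory Defs
  imports
    "HOL-Complex_Analysis.Complex_Analysis"
    "HOL-Library.Poly_Mapping"
    "HOL-Library.Function_Algebras"
    "HOL-Library.Multiset"
    "HOL-Library.Landau_Symbols"
begin

text \<open>
  The index set \<open>{1, \<dots>, n}\<close> of the coordinates \<open>z\<^sub>1, \<dots>, z\<^sub>n\<close> and of the fixed points is the finite
  type \<open>'n\<close>, so \<open>n = CARD('n)\<close>.  The label \<open>m\<close> of a solution and the position in an ordered basis
  are natural numbers in \<open>{1..CARD('n)}\<close>.
\<close>

text \<open>
  A point of the universal cover of the punctured \<open>p\<close>-plane is given by its logarithm \<open>lp = log p\<close>.
  The fibre of \<open>H\<close> at a \<open>z\<close> with distinct coordinates is \<open>complex ^ 'n\<close>, the component \<open>I\<close> being
  the restriction to the fixed point \<open>pt\<^sub>I\<close>.  A function on \<open>L''\<close> is extended by zero to the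
  whole space, so that equality of the functions below is equality on \<open>L''\<close>.
\<close>

type_synonym 'n hfun = "complex \<Rightarrow> complex ^ 'n \<Rightarrow> complex ^ 'n"

definition Ldom :: "(complex ^ 'n::finite) set" where
  "Ldom = {z. \<forall>a b. a \<noteq> b \<longrightarrow> z $ a - z $ b \<notin> \<int>}"

text \<open>
  A symmetric function of \<open>y\<^sub>1, \<dots>, y\<^bsub>n-1\<^esub>\<close> is a function of the multiset \<open>Y\<close> of the \<open>y\<^sub>j\<close>.
\<close>

definition restr_roots :: "complex ^ 'n::finite \<Rightarrow> 'n \<Rightarrow> complex multiset" where
  "restr_roots z I = image_mset (\<lambda>a. z $ a) (mset_set (UNIV - {I}))"

definition hfun_of ::
  "(complex \<Rightarrow> complex multiset \<Rightarrow> complex ^ 'n \<Rightarrow> complex) \<Rightarrow> 'n::finite hfun" where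
  "hfun_of F = (\<lambda>lp z. if z \<in> Ldom then (\<chi> I. F lp (restr_roots z I) z) else 0)"

definition Phi :: "complex \<Rightarrow> complex \<Rightarrow> complex ^ 'n::finite \<Rightarrow> complex" where
  "Phi t lp z = exp (t * (of_real pi * \<i> * (2 - of_nat CARD('n)) + lp)) * (\<Prod>a\<in>UNIV. Gamma (z $ a - t))"

definition W :: "complex \<Rightarrow> complex multiset \<Rightarrow> complex" where
  "W t Y = (\<Prod>y\<in>#Y. y - t)"

definition Psi_comp :: "'n::finite \<Rightarrow> complex \<Rightarrow> complex multiset \<Rightarrow> complex ^ 'n \<Rightarrow> complex" where
  "Psi_comp J lp Y z = - suminf (\<lambda>r. residue (\<lambda>t. Phi t lp z * W t Y) (z $ J + of_nat r))"

definition Psi :: "int \<Rightarrow> 'n::finite hfun" where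
  "Psi m = hfun_of (\<lambda>lp Y z.
     \<Sum>J\<in>UNIV. exp (2 * of_real pi * \<i> * of_int (m - 1) * z $ J) * Psi_comp J lp Y z)"

text \<open>A Laurent polynomial maps a finitely supported exponent vector to its coefficient.\<close>

type_synonym 'n laurent = "('n \<Rightarrow>\<^sub>0 int) \<Rightarrow>\<^sub>0 complex"

definition laurent_monom :: "('n::finite \<Rightarrow> complex) \<Rightarrow> ('n \<Rightarrow>\<^sub>0 int) \<Rightarrow> complex" where
  "laurent_monom Z \<alpha> = (\<Prod>a\<in>UNIV. Z a powi Poly_Mapping.lookup \<alpha> a)"

definition laurent_eval :: "'n::finite laurent \<Rightarrow> ('n \<Rightarrow> complex) \<Rightarrow> complex" where
  "laurent_eval Q Z = (\<Sum>\<alpha>\<in>Poly_Mapping.keys Q. Poly_Mapping.lookup Q \<alpha> * laurent_monom Z \<alpha>)"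

definition Zacute :: "complex ^ 'n::finite \<Rightarrow> 'n \<Rightarrow> complex" where
  "Zacute z a = exp (2 * of_real pi * \<i> * z $ a)"

definition lscale :: "'n::finite laurent \<Rightarrow> 'n hfun \<Rightarrow> 'n hfun" where
  "lscale Q f = (\<lambda>lp z. laurent_eval Q (Zacute z) *s f lp z)"

definition esym :: "nat \<Rightarrow> 'n::finite laurent" where
  "esym i = (\<Sum>A | card A = i. Poly_Mapping.single (\<Sum>a\<in>A. Poly_Mapping.single a 1) 1)"

lemma laurent_monom_0: "laurent_monom Z 0 = 1"
  by (simp add: laurent_monom_def)

lemma laurent_monom_add:
  assumes "\<And>a. Z a \<noteq> 0"
  shows "laurent_monom Z (\<alpha> + \<beta>) = laurent_monom Z \<alpha> * laurent_monom Z \<beta>"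
  using assms by (simp add: laurent_monom_def lookup_add power_int_add prod.distrib)

lemma laurent_eval_superset:
  assumes "finite K" "Poly_Mapping.keys Q \<subseteq> K"
  shows "laurent_eval Q Z = (\<Sum>\<alpha>\<in>K. Poly_Mapping.lookup Q \<alpha> * laurent_monom Z \<alpha>)"
  unfolding laurent_eval_def
  by (rule sum.mono_neutral_left) (use assms in \<open>auto simp: in_keys_iff\<close>)

lemma laurent_eval_zero: "laurent_eval 0 Z = 0"
  by (simp add: laurent_eval_def)

lemma laurent_eval_single: "laurent_eval (Poly_Mapping.single \<alpha> c) Z = c * laurent_monom Z \<alpha>"
  by (simp add: laurent_eval_def)

lemma laurent_eval_one: "laurent_eval 1 Z = 1"
  using laurent_eval_single[of 0 1 Z] by (simp add: laurent_monom_0)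

lemma laurent_eval_add: "laurent_eval (P + Q) Z = laurent_eval P Z + laurent_eval Q Z"
proof -
  let ?K = "Poly_Mapping.keys P \<union> Poly_Mapping.keys Q"
  have "laurent_eval (P + Q) Z = (\<Sum>\<alpha>\<in>?K. Poly_Mapping.lookup (P + Q) \<alpha> * laurent_monom Z \<alpha>)"
    by (rule laurent_eval_superset) (simp_all add: keys_add)
  also have "\<dots> = (\<Sum>\<alpha>\<in>?K. Poly_Mapping.lookup P \<alpha> * laurent_monom Z \<alpha>) +
      (\<Sum>\<alpha>\<in>?K. Poly_Mapping.lookup Q \<alpha> * laurent_monom Z \<alpha>)"
    by (simp add: lookup_add distrib_right sum.distrib)
  also have "\<dots> = laurent_eval P Z + laurent_eval Q Z"
    by (simp add: laurent_eval_superset[of ?K P] laurent_eval_superset[of ?K Q])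
  finally show ?thesis .
qed

lemma laurent_eval_sum: "laurent_eval (\<Sum>i\<in>S. f i) Z = (\<Sum>i\<in>S. laurent_eval (f i) Z)"
  by (induction S rule: infinite_finite_induct) (simp_all add: laurent_eval_zero laurent_eval_add)

lemma laurent_sum_monomials:
  "(\<Sum>\<alpha>\<in>Poly_Mapping.keys Q. Poly_Mapping.single \<alpha> (Poly_Mapping.lookup Q \<alpha>)) = (Q :: 'n::finite laurent)"
  by (rule poly_mapping_eqI)
    (auto simp: lookup_sum lookup_single when_def in_keys_iff sum.delta)

lemma laurent_eval_mult:
  assumes "\<And>a. Z a \<noteq> 0"
  shows "laurent_eval (P * Q) Z = laurent_eval P Z * laurent_eval Q Z"
proof -
  let ?m = "\<lambda>R \<alpha>. Poly_Mapping.single \<alpha> (Poly_Mapping.lookup R \<alpha>)"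
  have "P * Q = (\<Sum>\<alpha>\<in>Poly_Mapping.keys P. ?m P \<alpha>) * (\<Sum>\<beta>\<in>Poly_Mapping.keys Q. ?m Q \<beta>)"
    by (simp only: laurent_sum_monomials)
  also have "\<dots> = (\<Sum>\<alpha>\<in>Poly_Mapping.keys P. \<Sum>\<beta>\<in>Poly_Mapping.keys Q. ?m P \<alpha> * ?m Q \<beta>)"
    by (rule sum_product)
  finally have "laurent_eval (P * Q) Z =
      (\<Sum>\<alpha>\<in>Poly_Mapping.keys P. \<Sum>\<beta>\<in>Poly_Mapping.keys Q.
        (Poly_Mapping.lookup P \<alpha> * laurent_monom Z \<alpha>) * (Poly_Mapping.lookup Q \<beta> * laurent_monom Z \<beta>))"
    by (simp add: laurent_eval_sum mult_single laurent_eval_single laurent_monom_add[OF assms] mult_ac)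
  also have "\<dots> = laurent_eval P Z * laurent_eval Q Z"
    by (simp add: laurent_eval_def sum_product)
  finally show ?thesis .
qed

interpretation laurent: module lscale
proof
  show "lscale Q (f + g) = lscale Q f + lscale Q g" for Q :: "'n::finite laurent" and f g
    by (intro ext) (simp add: lscale_def vec_eq_iff distrib_left)
  show "lscale (P + Q) f = lscale P f + lscale Q f" for P Q :: "'n::finite laurent" and f
    by (intro ext) (simp add: lscale_def vec_eq_iff laurent_eval_add distrib_right)
  show "lscale P (lscale Q f) = lscale (P * Q) f" for P Q :: "'n::finite laurent" and f
    by (intro ext) (simp add: lscale_def vec_eq_iff laurent_eval_mult Zacute_def)
  show "lscale 1 f = f" for f :: "'n::finite hfun"
    by (intro ext) (simp add: lscale_def vec_eq_iff laurent_eval_one)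
qed

definition Smod :: "'n::finite hfun set" where
  "Smod = {(\<Sum>m=1..CARD('n). lscale (Q m) (Psi (int m))) | Q. True}"

definition ordered_basis :: "(nat \<Rightarrow> 'n::finite hfun) \<Rightarrow> bool" where
  "ordered_basis B \<longleftrightarrow>
     inj_on B {1..CARD('n)} \<and>
     laurent.independent (B ` {1..CARD('n)}) \<and>
     laurent.span (B ` {1..CARD('n)}) = Smod"

definition vv :: "int \<Rightarrow> nat \<Rightarrow> 'n::finite hfun" where
  "vv k m = Psi (k + int m)"

definition vsum :: "int \<Rightarrow> nat \<Rightarrow> nat \<Rightarrow> 'n::finite hfun" where
  "vsum k m l = (\<Sum>i=0..m - l. lscale ((- 1) ^ i * esym i) (vv k (m - i)))"

text \<open>The argument \<open>j \<in> {1..CARD('n)}\<close> is the position in the basis.\<close>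

definition Q1 :: "int \<Rightarrow> nat \<Rightarrow> 'n::finite hfun" where
  "Q1 k j =
     (let h = CARD('n) div 2 in
      if odd CARD('n) then
        (if odd j then vv k ((j + 1) div 2)
         else let i = j div 2 in vsum k (2 * h + 2 - i) (i + 1))
      else
        (if odd j then vv k ((j + 1) div 2)
         else if j = 2 * h then vv k (h + 1)
         else let i = j div 2 in vsum k (2 * h + 1 - i) (i + 1)))"

definition Q2 :: "int \<Rightarrow> nat \<Rightarrow> 'n::finite hfun" where
  "Q2 k j =
     (let h = CARD('n) div 2 in
      if odd CARD('n) then
        (if even j then vv k (j div 2)
         else if j = 2 * h + 1 then vv k (h + 1)
         else let i = (j + 1) div 2 in vsum k (2 * h + 2 - i) i)
      else
        (if even j then vv k (j div 2)
         else let i = (j + 1) div 2 in vsum k (2 * h + 1 - i) i))"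

definition s_of :: "real \<Rightarrow> real \<Rightarrow> complex" where
  "s_of r \<phi> = of_real r * exp (- 2 * of_real pi * \<i> * of_real \<phi>)"

definition omega :: "nat \<Rightarrow> complex" where
  "omega n = exp (2 * of_real pi * \<i> / of_nat n)"

text \<open>The logarithm of \<open>p = s\<^sup>n\<close>.\<close>

definition log_p :: "nat \<Rightarrow> real \<Rightarrow> real \<Rightarrow> complex" where
  "log_p n r \<phi> = of_nat n * (of_real (ln r) - 2 * of_real pi * \<i> * of_real \<phi>)"

definition resonant :: "nat \<Rightarrow> real \<Rightarrow> bool" where
  "resonant n \<phi> \<longleftrightarrow> (\<exists>j::int. \<phi> = of_int j / of_nat n)"

text \<open>
  The power \<open>(- \<omega>\<^sup>m s) ^ e\<close>, for the branch of the logarithm with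
  \<open>arg (- \<omega>\<^sup>m s) = 2 \<pi> m / n - \<pi> - 2 \<pi> \<phi> + 2 \<pi> l\<close>; note \<open>\<bar>\<omega>\<^sup>m s\<bar> = r\<close>.
\<close>

definition branch_power :: "nat \<Rightarrow> nat \<Rightarrow> int \<Rightarrow> real \<Rightarrow> real \<Rightarrow> complex \<Rightarrow> complex" where
  "branch_power n m l r \<phi> e =
     exp (e * (of_real (ln r) +
       \<i> * of_real (2 * pi * real m / real n - pi - 2 * pi * \<phi> + 2 * pi * of_int l)))"

definition leading_term ::
  "nat \<Rightarrow> int \<Rightarrow> real \<Rightarrow> real \<Rightarrow> complex multiset \<Rightarrow> complex ^ 'n::finite \<Rightarrow> complex" where
  "leading_term m l r \<phi> Y z =
     (let n = CARD('n); ws = omega n ^ m * s_of r \<phi> in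
      of_real ((2 * pi) powr ((real n - 1) / 2) / sqrt (real n)) *
      exp (of_nat n * ws) *
      branch_power n m l r \<phi> ((\<Sum>a\<in>UNIV. z $ a) + (1 - of_nat n) / 2) *
      (\<Prod>y\<in>#Y. y - ws))"

definition stokes_asymptotics :: "'n::finite hfun \<Rightarrow> nat \<Rightarrow> int \<Rightarrow> real \<Rightarrow> complex ^ 'n \<Rightarrow> bool" where
  "stokes_asymptotics f m l \<phi> z \<longleftrightarrow>
     (\<exists>E :: real \<Rightarrow> complex ^ 'n.
        (\<forall>I. (\<lambda>r. E r $ I) \<in> O[at_top](\<lambda>r. 1 / s_of r \<phi>)) \<and>
        (\<forall>\<^sub>F r in at_top. \<forall>I.
           f (log_p CARD('n) r \<phi>) z $ I =
             leading_term m l r \<phi> (restr_roots z I) z * (1 + E r $ I)))"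

definition stokes_basis :: "real \<Rightarrow> real \<Rightarrow> (nat \<Rightarrow> 'n::finite hfun) \<Rightarrow> bool" where
  "stokes_basis b c B \<longleftrightarrow>
     ordered_basis B \<and>
     (\<exists>\<sigma> :: nat \<Rightarrow> nat. \<exists>l :: nat \<Rightarrow> int.
        bij_betw \<sigma> {1..CARD('n)} {1..CARD('n)} \<and>
        (\<forall>m\<in>{1..CARD('n)}. \<forall>\<phi>\<in>{b<..<c}. \<not> resonant CARD('n) \<phi> \<longrightarrow>
           (\<forall>z\<in>Ldom. stokes_asymptotics (B (\<sigma> m)) m (l m) \<phi> z)))"

definition sufficiently_small :: "nat \<Rightarrow> real \<Rightarrow> real \<Rightarrow> bool" where
  "sufficiently_small n a \<epsilon> \<longleftrightarrow>
     (\<forall>r::int. of_int r / (2 * real n) \<notin> {a<..<a + \<epsilon>} \<and>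
               of_int r / (2 * real n) \<notin> {a - 1/2 - \<epsilon><..<a - 1/2})"

end

theory Submission
  imports Defs "HOL-Real_Asymp.Real_Asymp"
begin

text \<open>
  Fix a component \<open>I\<close> and a label \<open>m\<close>.  Absorbing the factors \<open>y\<^sub>j - t\<close> into the Gamma functions, by
  \<open>w \<Gamma>(w) = \<Gamma>(w + 1)\<close>, turns \<open>\<Psi>\<^sup>m\<close> into the sum of all residues of the Mellin--Barnes integrand
  \<open>e\<^bsup>-L u\<^esup> \<Prod>\<^sub>a \<Gamma>(u + b\<^sub>a)\<close> with \<open>u = -t\<close> and \<open>L = log p + \<pi> \<i> (2 m - n)\<close> (\<open>Psi_eq_barnes_sum\<close>).
  By Stirling's formula the product of \<open>n\<close> Gamma functions agrees, up to a relative error of order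
  \<open>u\<^bsup>-2\<^esup>\<close>, with a constant times \<open>n\<^bsup>-n u\<^esup> (\<Gamma>(n u + B) + \<gamma> \<Gamma>(n u + B - 1))\<close>
  (\<open>Gamma_product_asymptotics\<close>).  The residues of this model add up to an exponential series, which
  is the leading term \<open>exp (- n e\<^bsup>L / n\<^esup>)\<close> times a power.  The difference of the two integrands is
  integrated along two rays that start at \<open>r\<close>, one of them through the saddle point \<open>e\<^bsup>L / n\<^esup>\<close>, and on
  which its exponential part is nowhere larger than at the saddle point; this yields the relative error
  \<open>O(1/r)\<close> (\<open>barnes_sum_asymptotics\<close>).  Such rays exist in the sector \<open>|x| < n\<close>, where
  \<open>x = Im L / \<pi> = 2 m - n - 2 n \<phi>\<close>.

  Outside that sector \<open>\<Psi>\<^sup>m\<close> has to be corrected.  The numbers \<open>Z\<^sub>a\<close> being the roots of a polynomial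
  with coefficients \<open>(-1)\<^sup>i s\<^sub>i\<close>, one has \<open>\<Sum>\<^sub>i (-1)\<^sup>i s\<^sub>i \<Psi>\<^bsup>m - i\<^esup> = 0\<close>, the sum running over \<open>0 \<le> i \<le> n\<close>
  (\<open>Psi_relation\<close>).  Hence the partial sum over \<open>i \<le> d\<close> is minus the sum over \<open>i > d\<close>.  Its \<open>i\<close>-th term has
  position \<open>x - 2 i\<close>, and among positions in \<open>[-n, n]\<close> the term with the largest absolute value grows
  fastest.  For \<open>d < x < n\<close> this is the term \<open>i = 0\<close> of the first sum, and for \<open>n < x < n + d + 1\<close> it
  is the term \<open>i = n\<close> of the second one, which is the same leading exponential carried once around
  the puncture (\<open>lead_monodromy\<close>).  So the partial sum has one and the same leading term on the whole
  interval \<open>d < x < n + d + 1\<close>, except at the resonant position \<open>x = n\<close> (\<open>partial_sum_asymptotics\<close>).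
  The elements of \<open>Q'\<^sub>k\<close> and \<open>Q''\<^sub>k\<close> are such partial sums, and their lengths are those for
  which the positions met on \<open>(a - 1/2 - \<epsilon>, a + \<epsilon>)\<close> lie in this interval.

  That these families are bases follows from the same asymptotics: at \<open>\<phi> = a\<close> the \<open>n\<close> leading
  terms grow at pairwise different rates, so the coefficients of a linear relation vanish at every
  point of \<open>L''\<close>, and a Laurent polynomial in the \<open>exp (2 \<pi> \<i> z\<^sub>a)\<close> that vanishes there is zero
  (\<open>vsum_family_independent\<close>).  They span because they are unitriangular in terms of \<open>n\<close>
  consecutive \<open>\<Psi>\<^sup>m\<close>, and the relation, whose extreme coefficients \<open>1\<close> and \<open>\<plusminus> s\<^sub>n\<close> are units, moves any
  window of \<open>n\<close> consecutive solutions to any other (\<open>window_eq_Smod\<close>, \<open>triangular_span\<close>).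
\<close>

section \<open>Stirling's formula with a second-order remainder in sectors\<close>

text \<open>The sector excludes a neighbourhood of the negative axis, so translates to the right stay in it
  and move away from the origin at a linear rate: \<open>|u + m|\<^sup>2 \<ge> |u|\<^sup>2 - 2 c m |u| + m\<^sup>2\<close>, and for \<open>c < 1\<close>
  this quadratic form is definite.\<close>

lemma sector_shift:
  fixes u :: complex and c m :: real
  assumes c: "0 \<le> c" "c < 1" and u: "Re u \<ge> - c * norm u" and m: "0 \<le> m"
  shows "norm (u + of_real m) \<ge> sqrt ((1 - c) / 2) * (norm u + m)"
    and "Re (u + of_real m) \<ge> - c * norm (u + of_real m)"
proof -
  let ?N = "norm u"
  have N2: "?N\<^sup>2 = (Re u)\<^sup>2 + (Im u)\<^sup>2"
    by (simp add: cmod_power2)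
  have S2: "(norm (u + of_real m))\<^sup>2 = ?N\<^sup>2 + 2 * m * Re u + m\<^sup>2"
    by (simp add: cmod_power2 power2_sum algebra_simps)
  have "m * (- c * ?N) \<le> m * Re u"
    using m u by (intro mult_left_mono) auto
  then have "(norm (u + of_real m))\<^sup>2 \<ge> ?N\<^sup>2 - 2 * c * m * ?N + m\<^sup>2"
    unfolding S2 by (simp add: algebra_simps)
  moreover have "?N\<^sup>2 - 2 * c * m * ?N + m\<^sup>2 - ((1 - c) / 2) * (?N + m)\<^sup>2 = ((1 + c) / 2) * (?N - m)\<^sup>2"
    by (simp add: power2_eq_square field_simps)
  moreover have "((1 + c) / 2) * (?N - m)\<^sup>2 \<ge> 0"
    using c by simp
  ultimately have "((1 - c) / 2) * (?N + m)\<^sup>2 \<le> (norm (u + of_real m))\<^sup>2"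
    by linarith
  moreover have "(sqrt ((1 - c) / 2) * (?N + m))\<^sup>2 = ((1 - c) / 2) * (?N + m)\<^sup>2"
    using c by (simp add: power_mult_distrib)
  ultimately show "norm (u + of_real m) \<ge> sqrt ((1 - c) / 2) * (?N + m)"
    by (metis norm_ge_zero power2_le_imp_le)
  show "Re (u + of_real m) \<ge> - c * norm (u + of_real m)"
  proof (cases "Re u + m \<ge> 0")
    case True
    moreover have "0 \<le> c * norm (u + of_real m)" using c by simp
    ultimately show ?thesis by simp
  next
    case False
    then have neg: "Re u + m < 0" "Re u < 0" using m by auto
    have "(- Re u)\<^sup>2 \<le> (c * ?N)\<^sup>2"
      using u neg by (intro power_mono) auto
    then have "(1 - c\<^sup>2) * (Re u)\<^sup>2 \<le> c\<^sup>2 * (Im u)\<^sup>2"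
      by (simp add: power_mult_distrib N2 algebra_simps)
    moreover have "(Re u + m)\<^sup>2 \<le> (Re u)\<^sup>2"
    proof -
      have "(- (Re u + m))\<^sup>2 \<le> (- Re u)\<^sup>2"
        using neg m by (intro power_mono) auto
      then show ?thesis by (simp only: power2_minus)
    qed
    moreover have "c\<^sup>2 \<le> 1" using c by (simp add: power_le_one)
    ultimately have "(1 - c\<^sup>2) * (Re u + m)\<^sup>2 \<le> c\<^sup>2 * (Im u)\<^sup>2"
      using mult_left_mono[of "(Re u + m)\<^sup>2" "(Re u)\<^sup>2" "1 - c\<^sup>2"] by linarith
    then have "(Re u + m)\<^sup>2 \<le> (c * norm (u + of_real m))\<^sup>2"
      by (simp add: power_mult_distrib cmod_power2 algebra_simps)
    then have "(- (Re u + m))\<^sup>2 \<le> (c * norm (u + of_real m))\<^sup>2"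
      by (simp only: power2_minus)
    then have "- (Re u + m) \<le> c * norm (u + of_real m)"
      by (rule power2_le_imp_le) (use c in auto)
    then show ?thesis by simp
  qed
qed

lemma sector_not_nonpos:
  fixes u :: complex
  assumes "c < 1" "Re u \<ge> - c * norm u" "u \<noteq> 0"
  shows "u \<notin> \<real>\<^sub>\<le>\<^sub>0"
proof
  assume "u \<in> \<real>\<^sub>\<le>\<^sub>0"
  then have "Im u = 0" "Re u \<le> 0" by (auto simp: complex_nonpos_Reals_iff)
  then have "norm u = - Re u" by (simp add: cmod_eq_Re)
  with assms have "(1 - c) * norm u \<le> 0" by (simp add: algebra_simps)
  with assms show False by (simp add: mult_le_0_iff)
qed

lemma Ln_one_plus_cubic:
  fixes z :: complex
  assumes "norm z \<le> 1/2"
  shows "norm (Ln (1 + z) - (z - z\<^sup>2 / 2 + z ^ 3 / 3)) \<le> 2 * norm z ^ 4"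
proof -
  let ?R = "\<lambda>z::complex. Ln (1 + z) - (z - z\<^sup>2 / 2 + z ^ 3 / 3)"
  have nz: "1 + x \<notin> \<real>\<^sub>\<le>\<^sub>0" if "norm x \<le> 1/2" for x :: complex
    using that abs_Re_le_cmod[of x] by (auto simp: complex_nonpos_Reals_iff)
  have D: "(?R has_field_derivative (- (x ^ 3) / (1 + x))) (at x within cball 0 (norm z))"
    if "x \<in> cball 0 (norm z)" for x
  proof -
    have x: "norm x \<le> 1/2" using that assms by simp
    have ne: "1 + x \<noteq> 0" using nz[OF x] by auto
    have "(?R has_field_derivative (1 / (1 + x) - (1 - x + x\<^sup>2))) (at x within cball 0 (norm z))"
      using nz[OF x] by (auto intro!: derivative_eq_intros simp: field_simps power2_eq_square)
    moreover have "1 / (1 + x) - (1 - x + x\<^sup>2) = - (x ^ 3) / (1 + x)"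
      using ne by (simp add: field_simps power2_eq_square power3_eq_cube)
    ultimately show ?thesis by simp
  qed
  have B: "norm (- (x ^ 3) / (1 + x)) \<le> 2 * norm z ^ 3" if "x \<in> cball 0 (norm z)"  for x :: complex
  proof -
    have x: "norm x \<le> 1/2" "norm x \<le> norm z" using that assms by simp_all
    have "norm (1 + x) \<ge> 1/2" using x(1) norm_diff_ineq[of 1 x] by (simp add: field_simps)
    then have "norm x ^ 3 / norm (1 + x) \<le> norm z ^ 3 / (1/2)"
      using x by (intro frac_le power_mono) auto
    then show ?thesis by (simp add: norm_divide norm_power)
  qed
  have "norm (?R z - ?R 0) \<le> 2 * norm z ^ 3 * norm (z - 0)"
    by (rule field_differentiable_bound[OF convex_cball D B]) auto
  then show ?thesis by (simp add: power3_eq_cube power4_eq_xxxx mult_ac)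
qed

text \<open>The second-order Stirling coefficient is half the second Bernoulli polynomial.\<close>

definition stirling_coeff :: "complex \<Rightarrow> complex" where
  "stirling_coeff b = (b\<^sup>2 - b) / 2 + 1 / 12"

text \<open>The logarithm of the quotient of the values at \<open>u + 1\<close> and at \<open>u\<close> of \<open>stirling_ratio b\<close>
  (\<open>stirling_ratio_plus_one\<close>).\<close>

definition stirling_step :: "complex \<Rightarrow> complex \<Rightarrow> complex" where
  "stirling_step b u = Ln (1 + b / u) - (u + b + 1/2) * Ln (1 + 1 / u) + 1
     - stirling_coeff b / (u + 1) + stirling_coeff b / u"

text \<open>In powers of \<open>1 / u\<close> the terms up to order one cancel by the choice of Stirling's main term, and
  those of order two by the choice of \<open>stirling_coeff b\<close>.  The remaining order three is
  what makes the sum along \<open>u, u + 1, u + 2, \<dots>\<close> of size \<open>O(1 / u\<^sup>2)\<close>.\<close>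

lemma stirling_step_bound:
  obtains C :: real where "0 < C"
    "\<And>u::complex. norm u \<ge> 2 * (1 + norm b) \<Longrightarrow> norm (stirling_step b u) \<le> C / norm u ^ 3"
proof -
  define e where "e = stirling_coeff b"
  define R where "R = (\<lambda>z::complex. Ln (1 + z) - (z - z\<^sup>2 / 2 + z ^ 3 / 3))"
  define B where "B = norm b"
  define C where "C = B ^ 3 / 3 + (B + 1/2) / 3 + 2 * norm e + 2 * B ^ 4 + 2 * (1 + (B + 1/2)) + 1"
  have B0: "B \<ge> 0" by (simp add: B_def)
  have Cpos: "C > 0" unfolding C_def using B0 by (intro add_nonneg_pos add_nonneg_nonneg) auto
  show thesis
  proof (rule that[OF Cpos])
    fix u :: complex assume u: "norm u \<ge> 2 * (1 + norm b)"
    define z where "z = 1 / u"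
    have u2: "norm u \<ge> 2"
    proof -
      have "2 * 1 \<le> 2 * (1 + norm b)" by (intro mult_left_mono) auto
      then show ?thesis using u by (metis mult_2_right one_add_one order_trans mult.right_neutral)
    qed
    then have u0: "u \<noteq> 0" by auto
    have z0: "z \<noteq> 0" and uz: "u = 1 / z" using u0 by (auto simp: z_def)
    have z1: "norm z \<le> 1/2" using u2 u0 by (simp add: z_def norm_divide divide_simps)
    have z2: "norm (b * z) \<le> 1/2" using u u0 by (simp add: z_def norm_divide norm_mult field_simps)
    have z3: "norm (1 + z) \<ge> 1/2" using z1 norm_diff_ineq[of 1 z] by simp
    have z4: "1 + z \<noteq> 0" using z3 by auto
    have Rz: "norm (R z) \<le> 2 * norm z ^ 4" unfolding R_def by (rule Ln_one_plus_cubic[OF z1])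
    have Rbz: "norm (R (b * z)) \<le> 2 * (B * norm z) ^ 4"
      unfolding R_def B_def using Ln_one_plus_cubic[OF z2] by (simp add: norm_mult)
    have L1: "Ln (1 + b / u) = (b * z - (b * z)\<^sup>2 / 2 + (b * z) ^ 3 / 3) + R (b * z)"
      by (simp add: R_def uz)
    have L2: "Ln (1 + 1 / u) = (z - z\<^sup>2 / 2 + z ^ 3 / 3) + R z"
      by (simp add: R_def z_def)
    have F: "e / (u + 1) = e * z / (1 + z)" using z0 z4 by (simp add: uz field_simps)
    have step: "stirling_step b u = (b * z - (b * z)\<^sup>2 / 2 + (b * z) ^ 3 / 3) + R (b * z)
        - (1 / z + b + 1/2) * ((z - z\<^sup>2 / 2 + z ^ 3 / 3) + R z) + 1 - e * z / (1 + z) + e * z"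
      unfolding stirling_step_def L1 L2 e_def[symmetric] F by (simp add: uz)
    have frac: "e * z / (1 + z) = e * z - e * z\<^sup>2 + e * z ^ 3 / (1 + z)"
      using z4 by (simp add: divide_simps) (simp add: algebra_simps power2_eq_square power3_eq_cube)
    have e_eq: "e = (b\<^sup>2 - b) / 2 + 1 / 12" by (simp add: e_def stirling_coeff_def)
    define q r where "q = e / (1 + z)" and "r = (1 / z + b + 1/2) * R z"
    have prod: "(1 / z + b + 1/2) * ((z - z\<^sup>2 / 2 + z ^ 3 / 3) + R z)
        = (1 - z / 2 + z\<^sup>2 / 3) + (b + 1/2) * (z - z\<^sup>2 / 2 + z ^ 3 / 3) + r"
    proof -
      have "1 / z * (z - z\<^sup>2 / 2 + z ^ 3 / 3) = 1 - z / 2 + z\<^sup>2 / 3"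
        using z0 by (simp add: ring_distribs power2_eq_square power3_eq_cube)
      moreover have "(x + y) * (P + S) = x * P + y * P + (x + y) * S" for x y P S :: complex
        by (simp add: algebra_simps)
      ultimately have "(1 / z + (b + 1/2)) * ((z - z\<^sup>2 / 2 + z ^ 3 / 3) + R z)
        = (1 - z / 2 + z\<^sup>2 / 3) + (b + 1/2) * (z - z\<^sup>2 / 2 + z ^ 3 / 3) + (1 / z + (b + 1/2)) * R z"
        by metis
      then show ?thesis unfolding r_def by (simp only: add.assoc)
    qed
    have frac': "e * z / (1 + z) = e * z - e * z\<^sup>2 + q * z ^ 3"
      unfolding frac q_def by simp
    have "stirling_step b u = z ^ 3 * (b ^ 3 / 3 - (b + 1/2) / 3 - q) + R (b * z) - r"
      unfolding step frac' prod
      unfolding e_eq by (simp add: ring_distribs power2_eq_square power3_eq_cube diff_divide_distrib add_divide_distrib mult_ac)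
    then have "stirling_step b u = z ^ 3 * (b ^ 3 / 3 - (b + 1/2) / 3 - e / (1 + z)) + R (b * z)
        - (1 / z + b + 1/2) * R z"
      unfolding q_def r_def .
    also have "norm \<dots> \<le> C * norm z ^ 3"
    proof -
      have Rz': "norm ((1 / z + b + 1/2) * R z) \<le> 2 * (1 + (B + 1/2)) * norm z ^ 3"
      proof -
        have "norm ((1 / z + b + 1/2) * R z) \<le> (1 / norm z + B + 1/2) * (2 * norm z ^ 4)"
          unfolding norm_mult B_def
          by (intro mult_mono Rz) (auto intro!: norm_triangle_le simp: norm_divide)
        also have "\<dots> = 2 * (1 + (B + 1/2) * norm z) * norm z ^ 3"
          using z0 by (simp add: field_simps power4_eq_xxxx power3_eq_cube)
        also have "\<dots> \<le> 2 * (1 + (B + 1/2)) * norm z ^ 3"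
          using z1 B0 by (intro mult_right_mono mult_left_mono add_left_mono mult_left_le) auto
        finally show ?thesis .
      qed
      have Rbz': "norm (R (b * z)) \<le> 2 * B ^ 4 * norm z ^ 3"
      proof -
        have "norm z ^ 4 \<le> norm z ^ 3" using z1 by (intro power_decreasing) auto
        then have "2 * B ^ 4 * norm z ^ 4 \<le> 2 * B ^ 4 * norm z ^ 3"
          using B0 by (intro mult_left_mono) auto
        then show ?thesis using Rbz by (simp add: power_mult_distrib)
      qed
      have e': "norm (e / (1 + z)) \<le> 2 * norm e"
        using frac_le[of "norm e" "norm e" "1/2" "norm (1 + z)"] z3 by (simp add: norm_divide)
      have "norm (z ^ 3 * (b ^ 3 / 3 - (b + 1/2) / 3 - e / (1 + z)))
          \<le> norm z ^ 3 * (B ^ 3 / 3 + (B + 1/2) / 3 + 2 * norm e)"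
      proof -
        have "norm (b ^ 3 / 3 - (b + 1/2) / 3 - e / (1 + z)) \<le> norm (b ^ 3 / 3) + norm ((b + 1/2) / 3) + norm (e / (1 + z))"
          using norm_triangle_ineq4[of "b ^ 3 / 3 - (b + 1/2) / 3" "e / (1 + z)"] norm_triangle_ineq4[of "b ^ 3 / 3" "(b + 1/2) / 3"]
          by linarith
        moreover have "norm ((b + 1/2) / 3) \<le> (B + 1/2) / 3"
          using norm_triangle_ineq[of b "1/2"] by (simp add: norm_divide B_def)
        moreover have "norm (b ^ 3 / 3) = B ^ 3 / 3" by (simp add: norm_divide norm_power B_def)
        ultimately have "norm (b ^ 3 / 3 - (b + 1/2) / 3 - e / (1 + z)) \<le> B ^ 3 / 3 + (B + 1/2) / 3 + 2 * norm e"
          using e' by linarith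
        then show ?thesis by (simp add: norm_mult norm_power mult_left_mono)
      qed
      then have "norm (z ^ 3 * (b ^ 3 / 3 - (b + 1/2) / 3 - e / (1 + z)) + R (b * z)
        - (1 / z + b + 1/2) * R z) \<le> norm z ^ 3 * (B ^ 3 / 3 + (B + 1/2) / 3 + 2 * norm e)
         + 2 * B ^ 4 * norm z ^ 3 + 2 * (1 + (B + 1/2)) * norm z ^ 3"
        using Rz' Rbz' norm_triangle_ineq4[of "z ^ 3 * (b ^ 3 / 3 - (b + 1/2) / 3 - e / (1 + z)) + R (b * z)" "(1 / z + b + 1/2) * R z"]
          norm_triangle_ineq[of "z ^ 3 * (b ^ 3 / 3 - (b + 1/2) / 3 - e / (1 + z))" "R (b * z)"]
        by linarith
      also have "\<dots> \<le> C * norm z ^ 3" unfolding C_def by (simp add: algebra_simps)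
      finally show ?thesis .
    qed
    also have "C * norm z ^ 3 = C / norm u ^ 3" by (simp add: z_def norm_divide field_simps)
    finally show "norm (stirling_step b u) \<le> C / norm u ^ 3" .
  qed
qed

text \<open>Keeping the correction \<open>stirling_coeff b / u\<close> in the exponent, rather than in an expansion of the
  quotient, makes the quotient of consecutive values an exponential.\<close>

definition stirling_ratio :: "complex \<Rightarrow> complex \<Rightarrow> complex" where
  "stirling_ratio b u = Gamma (u + b) * exp (- (u + b - 1/2) * Ln u + u - stirling_coeff b / u)"

text \<open>The imaginary parts of \<open>u\<close> and \<open>1 + 1 / u\<close> have opposite signs, so the principal arguments add up
  without a jump.\<close>

lemma Ln_plus_one:
  fixes u :: complex
  assumes "u \<notin> \<real>\<^sub>\<le>\<^sub>0"
  shows "Ln (u + 1) = Ln u + Ln (1 + 1 / u)"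
proof -
  have u0: "u \<noteq> 0" using assms by auto
  have m: "u + 1 \<notin> \<real>\<^sub>\<le>\<^sub>0" using assms by (auto simp: complex_nonpos_Reals_iff)
  then have m0: "u + 1 \<noteq> 0" by auto
  then have v0: "1 + 1 / u \<noteq> 0" using u0 by (simp add: field_simps)
  have eq: "u * (1 + 1 / u) = u + 1" using u0 by (simp add: field_simps)
  have im: "Im (1 + 1 / u) = - Im u / (norm u)\<^sup>2"
    by (simp add: Im_divide cmod_power2)
  have np: "(norm u)\<^sup>2 > 0" using u0 by simp
  have "- pi < Im (Ln u) + Im (Ln (1 + 1 / u)) \<and> Im (Ln u) + Im (Ln (1 + 1 / u)) \<le> pi"
  proof (cases "Im u" "0::real" rule: linorder_cases)
    case greater
    then have "Im (1 + 1 / u) < 0" unfolding im by (intro divide_neg_pos np) auto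
    then have "- pi < Im (Ln (1 + 1 / u))" "Im (Ln (1 + 1 / u)) < 0"
      using Im_Ln_pos_le[OF v0] mpi_less_Im_Ln[OF v0] Im_Ln_le_pi[OF v0] by linarith+
    then show ?thesis using Im_Ln_pos_lt_imp[OF greater] by auto
  next
    case less
    then have p: "Im (1 + 1 / u) > 0" unfolding im by (intro divide_pos_pos np) auto
    have "- pi < Im (Ln u)" "Im (Ln u) < 0"
      using less Im_Ln_pos_le[OF u0] mpi_less_Im_Ln[OF u0] Im_Ln_le_pi[OF u0] by linarith+
    then show ?thesis using Im_Ln_pos_lt_imp[OF p] by auto
  next
    case equal
    then have "Re u > 0" using assms by (auto simp: complex_nonpos_Reals_iff)
    then have "u = of_real (Re u)" "1 + 1 / u = of_real (1 + 1 / Re u)"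
      using equal by (auto simp: complex_eq_iff Re_divide Im_divide power2_eq_square)
    then have "Im (Ln u) = 0" "Im (Ln (1 + 1 / u)) = 0"
      using \<open>Re u > 0\<close> Ln_of_real[of "Re u"] Ln_of_real[of "1 + 1 / Re u"]
      by (metis Im_complex_of_real, metis Im_complex_of_real add_pos_pos zero_less_divide_1_iff zero_less_one)
    then show ?thesis by auto
  qed
  then have "Ln (u * (1 + 1 / u)) = Ln u + Ln (1 + 1 / u)"
    using u0 v0 by (intro Ln_times_simple) auto
  then show ?thesis by (simp add: eq)
qed

lemma stirling_ratio_plus_one:
  assumes u: "u \<notin> \<real>\<^sub>\<le>\<^sub>0" and ub: "u + b \<notin> \<int>\<^sub>\<le>\<^sub>0"
  shows "stirling_ratio b (u + 1) = stirling_ratio b u * exp (stirling_step b u)"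
proof -
  have u0: "u \<noteq> 0" using u by auto
  have ub0: "u + b \<noteq> 0" using ub by auto
  have G: "Gamma (u + 1 + b) = (u + b) * Gamma (u + b)"
    using Gamma_plus1[OF ub] by (simp add: add_ac)
  have "u + b = u * (1 + b / u)" using u0 by (simp add: field_simps)
  moreover have "1 + b / u \<noteq> 0" using ub0 u0 by (simp add: field_simps)
  ultimately have E: "u + b = exp (Ln u + Ln (1 + b / u))"
    using u0 by (simp add: exp_add)
  have "stirling_ratio b (u + 1) = Gamma (u + b) * ((u + b) * exp (- (u + 1 + b - 1/2) * (Ln u + Ln (1 + 1 / u)) + (u + 1)
      - stirling_coeff b / (u + 1)))"
    unfolding stirling_ratio_def G Ln_plus_one[OF u] by simp
  also have "\<dots> = Gamma (u + b) * exp ((Ln u + Ln (1 + b / u)) + (- (u + 1 + b - 1/2) * (Ln u + Ln (1 + 1 / u)) + (u + 1)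
      - stirling_coeff b / (u + 1)))"
    unfolding exp_add[of "Ln u + Ln (1 + b / u)"] E[symmetric] ..
  also have "(Ln u + Ln (1 + b / u)) + (- (u + 1 + b - 1/2) * (Ln u + Ln (1 + 1 / u)) + (u + 1) - stirling_coeff b / (u + 1))
      = (- (u + b - 1/2) * Ln u + u - stirling_coeff b / u) + stirling_step b u"
    unfolding stirling_step_def by (simp add: algebra_simps)
  also have "Gamma (u + b) * exp \<dots> = stirling_ratio b u * exp (stirling_step b u)"
    unfolding stirling_ratio_def exp_add by (simp only: mult.assoc)
  finally show ?thesis .
qed

text \<open>Comparison with a telescoping sum.\<close>

lemma sum_inverse_cubes_bound:
  fixes x :: real
  assumes "x \<ge> 1"
  shows "(\<Sum>m<M. 1 / (x + real m) ^ 3) \<le> 2 / x\<^sup>2"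
proof -
  have "1 / (x + real m) ^ 3 \<le> (2 / x) * (1 / (x + real m) - 1 / (x + real (Suc m)))" for m
  proof -
    let ?y = "x + real m"
    have y: "?y \<ge> 1" "?y \<ge> x" using assms by auto
    have "1 / ?y ^ 3 = (1 / ?y) * (1 / ?y\<^sup>2)" by (simp add: power3_eq_cube power2_eq_square)
    also have "\<dots> \<le> (1 / x) * (2 * (1 / ?y - 1 / (?y + 1)))"
    proof (intro mult_mono)
      show "1 / ?y \<le> 1 / x" using assms y by (intro frac_le) auto
      have h1: "1 / ?y - 1 / (?y + 1) = 1 / (?y * (?y + 1))" using y by (simp add: field_simps)
      have h2: "2 * (1 / (?y * (?y + ?y))) \<le> 2 * (1 / (?y * (?y + 1)))"
        using y by (intro mult_left_mono frac_le) auto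
      have "2 * (1 / (t * (t + t))) = 1 / t\<^sup>2" if "t \<ge> 1" for t :: real
        using that by (simp add: power2_eq_square field_simps)
      from this[OF y(1)] h2 show "1 / ?y\<^sup>2 \<le> 2 * (1 / ?y - 1 / (?y + 1))"
        unfolding h1 by (simp only:)
    qed (use assms in auto)
    finally show ?thesis by (simp add: add_ac)
  qed
  then have "(\<Sum>m<M. 1 / (x + real m) ^ 3) \<le> (\<Sum>m<M. (2 / x) * (1 / (x + real m) - 1 / (x + real (Suc m))))"
    by (intro sum_mono) auto
  also have "\<dots> = (2 / x) * (1 / x - 1 / (x + real M))"
    unfolding sum_distrib_left[symmetric] using sum_lessThan_telescope'[of "\<lambda>m. 1 / (x + real m)" M] by simp
  also have "\<dots> \<le> (2 / x) * (1 / x)"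
    using assms by (intro mult_left_mono) auto
  finally show ?thesis by (simp add: power2_eq_square)
qed

lemma sector_plus_not_nonpos_Int:
  assumes c: "0 \<le> c" "c < 1" and u: "Re u \<ge> - c * norm u"
    and big: "norm u * sqrt ((1 - c) / 2) > norm b"
  shows "u + b \<notin> \<int>\<^sub>\<le>\<^sub>0"
proof
  assume "u + b \<in> \<int>\<^sub>\<le>\<^sub>0"
  then obtain m :: nat where "u + b = - of_nat m" by (elim nonpos_Ints_cases')
  then have "u + of_real (real m) = - b"
    by (simp add: eq_neg_iff_add_eq_0 add_ac)
  then have "norm (u + of_real (real m)) = norm b"
    by simp
  moreover have "sqrt ((1 - c) / 2) * (norm u + real m) \<le> norm (u + of_real (real m))"
    by (rule sector_shift(1)[OF c u]) simp
  moreover have "sqrt ((1 - c) / 2) * norm u \<le> sqrt ((1 - c) / 2) * (norm u + real m)"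
    using c by (intro mult_left_mono) auto
  ultimately show False using big by (simp add: mult.commute)
qed

text \<open>
  Iterating the one-step relation moves the argument far to the right, while the exponents add up to a
  convergent series of size \<open>O(1/u\<^sup>2)\<close>, uniformly in the sector.
\<close>

lemma stirling_ratio_shift:
  assumes c: "0 \<le> c" "c < 1"
  obtains C \<rho> :: real where "0 < C" "1 \<le> \<rho>"
    "\<And>u M. norm u \<ge> \<rho> \<Longrightarrow> Re u \<ge> - c * norm u \<Longrightarrow> u + b \<notin> \<int>\<^sub>\<le>\<^sub>0 \<and>
       stirling_ratio b (u + of_nat M) = stirling_ratio b u * exp (\<Sum>m<M. stirling_step b (u + of_nat m)) \<and>
       (\<Sum>m<M. norm (stirling_step b (u + of_nat m))) \<le> C / (norm u)\<^sup>2"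
proof -
  define k where "k = sqrt ((1 - c) / 2)"
  have k: "0 < k" "k \<le> 1" using c by (auto simp: k_def)
  obtain C where C: "0 < C"
    "\<And>u::complex. norm u \<ge> 2 * (1 + norm b) \<Longrightarrow> norm (stirling_step b u) \<le> C / norm u ^ 3"
    using stirling_step_bound[of b] by blast
  define \<rho> where "\<rho> = 2 * (1 + norm b) / k"
  have rho: "\<rho> \<ge> 1" "k * \<rho> \<ge> 2 * (1 + norm b)"
  proof -
    show "k * \<rho> \<ge> 2 * (1 + norm b)" using k by (simp add: \<rho>_def)
    have "2 * (1 + norm b) / 1 \<le> \<rho>" unfolding \<rho>_def using k by (intro divide_left_mono) auto
    moreover have "1 \<le> 2 * (1 + norm b) / 1" by (simp add: add_increasing2)
    ultimately show "\<rho> \<ge> 1" by linarith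
  qed
  show thesis
  proof (rule that[of "2 * C / k ^ 3" \<rho>])
    show "0 < 2 * C / k ^ 3" using C k by simp
    show "1 \<le> \<rho>" by fact
    fix u :: complex and M :: nat
    assume u: "norm u \<ge> \<rho>" "Re u \<ge> - c * norm u"
    have u1: "norm u \<ge> 1" using u rho by linarith
    have lower: "norm (u + of_nat m) \<ge> k * (norm u + real m)" and sec: "Re (u + of_nat m) \<ge> - c * norm (u + of_nat m)" for m
      using sector_shift[OF c u(2), of "real m"] by (auto simp: k_def)
    have ge: "norm (u + of_nat m) \<ge> 2 * (1 + norm b)" for m
    proof -
      have "k * \<rho> \<le> k * (norm u + real m)" using u k by (intro mult_left_mono) auto
      then show ?thesis using lower[of m] rho by linarith
    qed
    have "0 < 2 * (1 + norm b)" by (simp add: add_pos_nonneg)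
    then have nz: "u + of_nat m \<noteq> 0" for m using ge[of m] by (metis norm_zero not_le)
    have nn: "u + of_nat m \<notin> \<real>\<^sub>\<le>\<^sub>0" for m
      using sector_not_nonpos[OF c(2) sec nz] .
    have ni0: "u + b \<notin> \<int>\<^sub>\<le>\<^sub>0"
    proof (rule sector_plus_not_nonpos_Int[OF c u(2)])
      have "k * \<rho> \<le> k * norm u" using u k by (intro mult_left_mono) auto
      then show "norm b < norm u * sqrt ((1 - c) / 2)"
        using rho(2) norm_ge_zero[of b] unfolding k_def[symmetric] distrib_left mult.commute[of "norm u" k] by linarith
    qed
    have ni: "u + of_nat m + b \<notin> \<int>\<^sub>\<le>\<^sub>0" for m
    proof
      assume "u + of_nat m + b \<in> \<int>\<^sub>\<le>\<^sub>0"
      then obtain j where "u + of_nat m + b = - of_nat j" by (elim nonpos_Ints_cases')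
      then have "u + b = - of_nat (j + m)" by (simp add: algebra_simps)
      then show False using ni0 by (metis minus_of_nat_in_nonpos_Ints)
    qed
    have step: "stirling_ratio b (u + of_nat M) = stirling_ratio b u * exp (\<Sum>m<M. stirling_step b (u + of_nat m))" for M
    proof (induction M)
      case (Suc M)
      have "stirling_ratio b (u + of_nat (Suc M)) = stirling_ratio b (u + of_nat M + 1)"
        by (simp add: add_ac)
      also have "\<dots> = stirling_ratio b (u + of_nat M) * exp (stirling_step b (u + of_nat M))"
        by (rule stirling_ratio_plus_one[OF nn ni])
      finally show ?case by (simp add: Suc exp_add mult.assoc)
    qed simp
    have "norm (stirling_step b (u + of_nat m)) \<le> (C / k ^ 3) * (1 / (norm u + real m) ^ 3)" for m
    proof -
      have "norm (stirling_step b (u + of_nat m)) \<le> C / norm (u + of_nat m) ^ 3" by (rule C(2)[OF ge])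
      also have "\<dots> \<le> C / (k * (norm u + real m)) ^ 3"
        using C(1) k u1 lower[of m] by (intro divide_left_mono power_mono mult_pos_pos zero_less_power add_pos_nonneg) (auto simp: nz)
      finally show ?thesis by (simp add: power_mult_distrib)
    qed
    then have "(\<Sum>m<M. norm (stirling_step b (u + of_nat m))) \<le> (\<Sum>m<M. (C / k ^ 3) * (1 / (norm u + real m) ^ 3))"
      by (intro sum_mono) auto
    also have "\<dots> \<le> (C / k ^ 3) * (2 / (norm u)\<^sup>2)"
      unfolding sum_distrib_left[symmetric] using C k u1 by (intro mult_left_mono sum_inverse_cubes_bound) auto
    finally have "(\<Sum>m<M. norm (stirling_step b (u + of_nat m))) \<le> 2 * C / k ^ 3 / (norm u)\<^sup>2" by (simp add: mult.commute)
    then show "u + b \<notin> \<int>\<^sub>\<le>\<^sub>0 \<and>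
       stirling_ratio b (u + of_nat M) = stirling_ratio b u * exp (\<Sum>m<M. stirling_step b (u + of_nat m)) \<and>
       (\<Sum>m<M. norm (stirling_step b (u + of_nat m))) \<le> 2 * C / k ^ 3 / (norm u)\<^sup>2"
      using ni0 step by blast
  qed
qed

lemma tendsto_mult_Ln_one_plus:
  fixes u :: complex
  shows "(\<lambda>M. of_nat M * Ln (1 + u / of_nat M)) \<longlonglongrightarrow> u"
proof (cases "u = 0")
  case False
  have "((\<lambda>z. Ln (1 + z)) has_field_derivative 1) (at 0)"
    by (auto intro!: derivative_eq_intros)
  then have "((\<lambda>h. Ln (1 + h) / h) \<longlongrightarrow> 1) (at 0)"
    by (simp add: has_field_derivative_iff)
  moreover have "filterlim (\<lambda>M. u / of_nat M) (at 0) sequentially"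
  proof (rule filterlim_atI)
    show "(\<lambda>M. u / of_nat M) \<longlonglongrightarrow> 0"
      by (rule tendsto_divide_0[OF tendsto_const tendsto_of_nat])
    show "\<forall>\<^sub>F M in sequentially. u / of_nat M \<noteq> 0"
      using eventually_gt_at_top[of 0] by eventually_elim (use False in auto)
  qed
  ultimately have "(\<lambda>M. Ln (1 + u / of_nat M) / (u / of_nat M)) \<longlonglongrightarrow> 1"
    by (rule filterlim_compose)
  from tendsto_mult[OF tendsto_const[of u] this] show ?thesis
    using False by (simp add: field_simps)
qed simp

lemma Ln_add_of_nat:
  fixes u :: complex
  assumes "real M > norm u"
  shows "Ln (u + of_nat M) = of_real (ln (real M)) + Ln (1 + u / of_nat M)"
proof -
  have M: "real M > 0" using assms norm_ge_zero[of u] by linarith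
  have "norm (u / of_nat M) < 1" using assms M by (simp add: norm_divide)
  then have "1 + u / of_nat M \<noteq> 0" by (metis add_eq_0_iff norm_minus_cancel norm_one order_less_irrefl)
  then have "Ln (of_real (real M) * (1 + u / of_nat M)) = of_real (ln (real M)) + Ln (1 + u / of_nat M)"
    using Ln_times_of_real[OF M] Ln_of_real[OF M] by simp
  moreover have "of_real (real M) * (1 + u / of_nat M) = u + of_nat M"
    using M by (simp add: field_simps)
  ultimately show ?thesis by simp
qed

text \<open>Euler's limit for \<open>\<Gamma>(u + b)\<close>: far to the right, the quotient of \<open>\<Gamma>\<close> by Stirling's main term
  depends neither on the starting point nor on \<open>b\<close>.\<close>

lemma stirling_ratio_quotient_limit:
  fixes u b :: complex
  assumes ub: "u + b \<notin> \<int>\<^sub>\<le>\<^sub>0"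
  shows "(\<lambda>M. stirling_ratio b (u + of_nat M) / stirling_ratio 1 (of_nat M)) \<longlonglongrightarrow> 1"
proof -
  define z where "z = u + b"
  have z: "z \<notin> \<int>\<^sub>\<le>\<^sub>0" using ub by (simp add: z_def)
  have Gz: "Gamma z \<noteq> 0" using z by (rule Gamma_nonzero)
  have lim1: "(\<lambda>M. Gamma z / Gamma_series z M) \<longlonglongrightarrow> 1"
    using tendsto_divide[OF tendsto_const[of "Gamma z"] Gamma_series_LIMSEQ[of z] Gz] Gz by simp
  have lim2: "(\<lambda>M. 1 + z / of_nat M) \<longlonglongrightarrow> 1"
    using tendsto_add[OF tendsto_const[of 1] tendsto_divide_0[OF tendsto_const[of z] tendsto_of_nat]] by simp
  have lim2': "(\<lambda>M. 1 + u / of_nat M) \<longlonglongrightarrow> 1"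
    using tendsto_add[OF tendsto_const[of 1] tendsto_divide_0[OF tendsto_const[of u] tendsto_of_nat]] by simp
  have "(\<lambda>M. Ln (1 + u / of_nat M)) \<longlonglongrightarrow> Ln 1"
    by (intro tendsto_Ln lim2') auto
  then have lim3: "(\<lambda>M. Ln (1 + u / of_nat M)) \<longlonglongrightarrow> 0" by simp
  have lim4: "(\<lambda>M. stirling_coeff b * (1 / (u + of_nat M))) \<longlonglongrightarrow> stirling_coeff b * 0"
    by (intro tendsto_mult tendsto_const tendsto_divide_0[OF tendsto_const] tendsto_add_filterlim_at_infinity[OF tendsto_const] tendsto_of_nat)
  have lim5: "(\<lambda>M. stirling_coeff 1 * (1 / of_nat M)) \<longlonglongrightarrow> stirling_coeff 1 * 0"
    by (intro tendsto_mult tendsto_const tendsto_divide_0[OF tendsto_const] tendsto_of_nat)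
  define E where "E = (\<lambda>M. - (u + b - 1/2) * Ln (1 + u / of_nat M) - of_nat M * Ln (1 + u / of_nat M) + u
      - stirling_coeff b * (1 / (u + of_nat M)) + stirling_coeff 1 * (1 / of_nat M))"
  have "E \<longlonglongrightarrow> - (u + b - 1/2) * 0 - u + u - stirling_coeff b * 0 + stirling_coeff 1 * 0"
    unfolding E_def by (intro tendsto_intros lim3 lim4 lim5 tendsto_mult_Ln_one_plus tendsto_mult tendsto_const)
  then have "E \<longlonglongrightarrow> 0" by simp
  then have "(\<lambda>M. exp (E M)) \<longlonglongrightarrow> exp 0" by (rule tendsto_exp)
  then have "(\<lambda>M. (Gamma z / Gamma_series z M) / (1 + z / of_nat M) * exp (E M)) \<longlonglongrightarrow> 1 / 1 * exp 0"
    by (intro tendsto_mult tendsto_divide lim1 lim2) auto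
  moreover have "\<forall>\<^sub>F M in sequentially. (Gamma z / Gamma_series z M) / (1 + z / of_nat M) * exp (E M)
      = stirling_ratio b (u + of_nat M) / stirling_ratio 1 (of_nat M)"
  proof -
    have "\<forall>\<^sub>F M :: nat in sequentially. real M > norm u" by (rule eventually_compose_filterlim[OF eventually_gt_at_top filterlim_real_sequentially])
    then show ?thesis using eventually_gt_at_top[of 0]
    proof eventually_elim
      case (elim M)
      have M0: "of_nat M \<noteq> (0::complex)" using elim by simp
      have poch: "pochhammer z (Suc M) = (z + of_nat M) * Gamma (z + of_nat M) / Gamma z"
        using pochhammer_Gamma[OF z, of M] by (simp add: pochhammer_Suc mult.commute)
      have zM: "z + of_nat M \<noteq> 0" using z by (metis add_eq_0_iff minus_of_nat_in_nonpos_Ints add.commute)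
      have "pochhammer z (Suc M) \<noteq> 0" using z by (metis pochhammer_eq_0_imp_nonpos_Int)
      then have GzM: "Gamma (z + of_nat M) \<noteq> 0" unfolding poch by auto
      have lnM: "Ln (of_nat M) = of_real (ln (real M))"
        using elim by (metis Ln_of_real of_nat_0_less_iff of_real_of_nat_eq)
      have GS: "Gamma z / Gamma_series z M = (z + of_nat M) * Gamma (z + of_nat M) / (fact M * exp (z * of_real (ln (real M))))"
        using Gz by (simp add: Gamma_series_def poch field_simps)
      have zz: "(z + of_nat M) / (1 + z / of_nat M) = of_nat M" using M0 zM by (simp add: field_simps)
      have Mexp: "of_nat M = exp (of_real (ln (real M)) :: complex)" using elim
        by (metis exp_ln of_nat_0_less_iff exp_of_real of_real_of_nat_eq)
      have "(Gamma z / Gamma_series z M) / (1 + z / of_nat M) * exp (E M)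
         = Gamma (z + of_nat M) / fact M * (of_nat M / exp (z * of_real (ln (real M))) * exp (E M))"
      proof -
        have "(Gamma z / Gamma_series z M) / (1 + z / of_nat M) * exp (E M)
           = ((z + of_nat M) / (1 + z / of_nat M)) * (Gamma (z + of_nat M) / fact M * (1 / exp (z * of_real (ln (real M))) * exp (E M)))"
          unfolding GS by (simp add: mult_ac)
        then show ?thesis unfolding zz by simp
      qed
      also have "\<dots> = Gamma (z + of_nat M) / fact M * exp (of_real (ln (real M)) - z * of_real (ln (real M)) + E M)"
        by (subst Mexp) (simp add: exp_add exp_diff)
      also have "of_real (ln (real M)) - z * of_real (ln (real M)) + E M =
         (- (u + of_nat M + b - 1/2) * Ln (u + of_nat M) + (u + of_nat M) - stirling_coeff b / (u + of_nat M))
         - (- (of_nat M + 1 - 1/2) * Ln (of_nat M) + of_nat M - stirling_coeff 1 / of_nat M)"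
        unfolding Ln_add_of_nat[OF elim(1)] lnM E_def z_def by (simp add: algebra_simps)
      also have "Gamma (z + of_nat M) / fact M * exp \<dots> = stirling_ratio b (u + of_nat M) / stirling_ratio 1 (of_nat M)"
        unfolding stirling_ratio_def exp_diff z_def
        by (simp add: Gamma_fact[symmetric] add_ac mult_ac)
      finally show ?case .
    qed
  qed
  ultimately show ?thesis by (simp add: Lim_transform_eventually)
qed

lemma stirling_ratio_one_converges:
  obtains \<kappa> where "\<kappa> \<noteq> 0" "(\<lambda>M. stirling_ratio 1 (of_nat M)) \<longlonglongrightarrow> \<kappa>"
proof -
  obtain C \<rho> :: real where C: "0 < C" "1 \<le> \<rho>"
    "\<And>u M. norm u \<ge> \<rho> \<Longrightarrow> Re u \<ge> - 0 * norm u \<Longrightarrow> u + 1 \<notin> \<int>\<^sub>\<le>\<^sub>0 \<and>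
       stirling_ratio 1 (u + of_nat M) = stirling_ratio 1 u * exp (\<Sum>m<M. stirling_step 1 (u + of_nat m)) \<and>
       (\<Sum>m<M. norm (stirling_step 1 (u + of_nat m))) \<le> C / (norm u)\<^sup>2"
    using stirling_ratio_shift[of 0 1] by auto
  obtain N :: nat where N: "real N \<ge> \<rho>" using real_arch_simple by blast
  define v :: complex where "v = of_nat N"
  have v: "norm v \<ge> \<rho>" "Re v \<ge> - 0 * norm v" using N by (auto simp: v_def)
  note S = C(3)[OF v]
  have "summable (\<lambda>m. stirling_step 1 (v + of_nat m))"
  proof (rule summable_norm_cancel, rule summableI_nonneg_bounded[of _ "C / (norm v)\<^sup>2"])
    show "(\<Sum>m<M. norm (stirling_step 1 (v + of_nat m))) \<le> C / (norm v)\<^sup>2" for M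
      using S[of M] by blast
  qed simp
  then have "(\<lambda>M. stirling_ratio 1 v * exp (\<Sum>m<M. stirling_step 1 (v + of_nat m)))
     \<longlonglongrightarrow> stirling_ratio 1 v * exp (suminf (\<lambda>m. stirling_step 1 (v + of_nat m)))"
    by (intro tendsto_mult tendsto_const tendsto_exp summable_LIMSEQ)
  then have "(\<lambda>M. stirling_ratio 1 (v + of_nat M)) \<longlonglongrightarrow> stirling_ratio 1 v * exp (suminf (\<lambda>m. stirling_step 1 (v + of_nat m)))"
    using S by simp
  then have "(\<lambda>M. stirling_ratio 1 (of_nat (M + N))) \<longlonglongrightarrow> stirling_ratio 1 v * exp (suminf (\<lambda>m. stirling_step 1 (v + of_nat m)))"
    by (simp add: v_def add_ac)
  then have "(\<lambda>M. stirling_ratio 1 (of_nat M)) \<longlonglongrightarrow> stirling_ratio 1 v * exp (suminf (\<lambda>m. stirling_step 1 (v + of_nat m)))"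
    by (rule LIMSEQ_offset)
  moreover have "stirling_ratio 1 v \<noteq> 0" unfolding stirling_ratio_def using S[of 0] Gamma_nonzero by auto
  then have "stirling_ratio 1 v * exp (suminf (\<lambda>m. stirling_step 1 (v + of_nat m))) \<noteq> 0" by simp
  ultimately show thesis using that by blast
qed

text \<open>The limit \<open>\<kappa>\<close> exists and is the same for all parameters.  Legendre's duplication formula relates
  the parameters \<open>0\<close> and \<open>1/2\<close> at \<open>z\<close> to the parameter \<open>0\<close> at \<open>2 z\<close>, which gives
  \<open>\<kappa>\<^sup>2 = sqrt (2 \<pi>) \<kappa>\<close>.\<close>

lemma stirling_ratio_one_limit:
  "(\<lambda>M. stirling_ratio 1 (of_nat M)) \<longlonglongrightarrow> of_real (sqrt (2 * pi))"
proof -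
  obtain \<kappa> where k: "\<kappa> \<noteq> 0" "(\<lambda>M. stirling_ratio 1 (of_nat M)) \<longlonglongrightarrow> \<kappa>"
    using stirling_ratio_one_converges .
  have gen: "(\<lambda>M. stirling_ratio b (of_nat (Suc M))) \<longlonglongrightarrow> \<kappa>" if b: "1 + b \<notin> \<int>\<^sub>\<le>\<^sub>0" for b
  proof -
    have "\<forall>\<^sub>F M in sequentially. stirling_ratio 1 (of_nat M) \<noteq> 0"
      using k by (metis tendsto_imp_eventually_ne)
    then have ev: "\<forall>\<^sub>F M in sequentially. stirling_ratio b (1 + of_nat M) / stirling_ratio 1 (of_nat M) * stirling_ratio 1 (of_nat M)
       = stirling_ratio b (of_nat (Suc M))"
      by eventually_elim simp
    have "(\<lambda>M. stirling_ratio b (1 + of_nat M) / stirling_ratio 1 (of_nat M) * stirling_ratio 1 (of_nat M)) \<longlonglongrightarrow> 1 * \<kappa>"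
      by (intro tendsto_mult stirling_ratio_quotient_limit k b)
    then show ?thesis using ev by (simp add: Lim_transform_eventually)
  qed
  have l0: "(\<lambda>M. stirling_ratio 0 (of_nat (Suc M))) \<longlonglongrightarrow> \<kappa>" by (rule gen) auto
  have lh: "(\<lambda>M. stirling_ratio (1/2) (of_nat (Suc M))) \<longlonglongrightarrow> \<kappa>"
  proof (rule gen)
    have "Re (1 + 1 / 2) > 0" by simp
    then show "1 + 1 / 2 \<notin> (\<int>\<^sub>\<le>\<^sub>0 :: complex set)"
      by (meson complex_nonpos_Reals_iff nonpos_Ints_subset_nonpos_Reals not_le subsetD)
  qed
  have l2: "(\<lambda>M. stirling_ratio 0 (of_nat (Suc (2 * M + 1)))) \<longlonglongrightarrow> \<kappa>"
    by (rule filterlim_compose[OF l0]) (rule filterlim_subseq, simp add: strict_mono_def)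
  define D :: "nat \<Rightarrow> complex" where "D = (\<lambda>M. (stirling_coeff 0 / 2 - stirling_coeff 0 - stirling_coeff (1/2)) * (1 / of_nat (Suc M)))"
  have "D \<longlonglongrightarrow> (stirling_coeff 0 / 2 - stirling_coeff 0 - stirling_coeff (1/2)) * 0"
    unfolding D_def by (intro tendsto_mult tendsto_const LIMSEQ_Suc[OF lim_1_over_n])
  then have Dl: "D \<longlonglongrightarrow> 0" by simp
  have eq: "stirling_ratio 0 (of_nat (Suc M)) * stirling_ratio (1/2) (of_nat (Suc M)) =
      of_real (sqrt (2 * pi)) * stirling_ratio 0 (of_nat (Suc (2 * M + 1))) * exp (D M)" for M
  proof -
    define z :: complex where "z = of_nat (Suc M)"
    define l :: complex where "l = of_real (ln (real (Suc M)))"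
    have z0: "z \<noteq> 0" unfolding z_def by (metis of_nat_eq_0_iff nat.distinct(1))
    have z2: "of_nat (Suc (2 * M + 1)) = 2 * z" by (simp add: z_def algebra_simps)
    have lz: "Ln z = l" unfolding z_def l_def by (metis Ln_of_real of_nat_0_less_iff of_real_of_nat_eq zero_less_Suc)
    have l2z: "Ln (2 * z) = of_real (ln 2) + l"
      using Ln_times_of_real[of 2 z] Ln_of_real[of 2] z0 lz by simp
    have dup: "Gamma z * Gamma (z + 1/2) = exp ((1 - 2 * z) * of_real (ln 2)) * of_real (sqrt pi) * Gamma (2 * z)"
    proof (rule Gamma_legendre_duplication)
      show "z \<notin> \<int>\<^sub>\<le>\<^sub>0" unfolding z_def
        by (metis Re_complex_of_real complex_nonpos_Reals_iff nonpos_Ints_subset_nonpos_Reals not_le of_nat_0_less_iff of_real_of_nat_eq subsetD zero_less_Suc)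
      have "Re (z + 1/2) > 0" by (simp add: z_def)
      then show "z + 1/2 \<notin> \<int>\<^sub>\<le>\<^sub>0"
        by (meson complex_nonpos_Reals_iff nonpos_Ints_subset_nonpos_Reals not_le subsetD)
    qed
    have s2: "complex_of_real (sqrt (2 * pi)) = exp (of_real (ln 2) / 2) * of_real (sqrt pi)"
    proof -
      have "exp (ln 2 / 2) = exp (ln (sqrt 2))" by (simp add: ln_sqrt)
      then have "exp (ln 2 / 2) = sqrt 2" by simp
      then have "complex_of_real (sqrt 2) = exp (of_real (ln 2 / 2))"
        by (simp only: exp_of_real)
      then have "complex_of_real (sqrt 2) = exp (of_real (ln 2) / 2)" by simp
      then show ?thesis by (simp add: real_sqrt_mult)
    qed
    have "stirling_ratio 0 z * stirling_ratio (1/2) z = (Gamma z * Gamma (z + 1/2)) *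
        exp ((- (z - 1/2) * l + z - stirling_coeff 0 / z) + (- z * l + z - stirling_coeff (1/2) / z))"
      unfolding stirling_ratio_def lz exp_add by simp
    also have "\<dots> = of_real (sqrt pi) * Gamma (2 * z) *
        exp ((1 - 2 * z) * of_real (ln 2) + ((- (z - 1/2) * l + z - stirling_coeff 0 / z) + (- z * l + z - stirling_coeff (1/2) / z)))"
      unfolding dup exp_add by (simp only: mult_ac)
    also have "(1 - 2 * z) * of_real (ln 2) + ((- (z - 1/2) * l + z - stirling_coeff 0 / z) + (- z * l + z - stirling_coeff (1/2) / z))
       = of_real (ln 2) / 2 + (- (2 * z - 1/2) * (of_real (ln 2) + l) + 2 * z - stirling_coeff 0 / (2 * z)) + D M"
    proof -
      define w where "w = 1 / z"
      have w: "x / z = x * w" "x / (2 * z) = x * w / 2" for x by (simp_all add: w_def)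
      show ?thesis unfolding D_def z_def[symmetric] w
        by (simp add: ring_distribs add_divide_distrib diff_divide_distrib)
    qed
    also have "of_real (sqrt pi) * Gamma (2 * z) * exp \<dots> = of_real (sqrt (2 * pi)) * stirling_ratio 0 (2 * z) * exp (D M)"
      unfolding stirling_ratio_def l2z s2 exp_add by simp
    finally show ?thesis unfolding z2 unfolding z_def .
  qed
  have "(\<lambda>M. stirling_ratio 0 (of_nat (Suc M)) * stirling_ratio (1/2) (of_nat (Suc M))) \<longlonglongrightarrow> \<kappa> * \<kappa>"
    by (intro tendsto_mult l0 lh)
  moreover have "(\<lambda>M. of_real (sqrt (2 * pi)) * stirling_ratio 0 (of_nat (Suc (2 * M + 1))) * exp (D M)) \<longlonglongrightarrow> of_real (sqrt (2 * pi)) * \<kappa> * exp 0"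
    by (intro tendsto_mult tendsto_const l2 tendsto_exp Dl)
  ultimately have "\<kappa> * \<kappa> = of_real (sqrt (2 * pi)) * \<kappa>"
    unfolding eq by (metis (no_types, lifting) LIMSEQ_unique exp_zero mult.right_neutral)
  then have "\<kappa> = of_real (sqrt (2 * pi))" using k by simp
  then show ?thesis using k by simp
qed

text \<open>The value at \<open>u\<close> and the limit along \<open>u + M\<close> differ by the exponential of a sum of size \<open>O(1 / u\<^sup>2)\<close>.\<close>

theorem stirling_ratio_asymptotics:
  assumes c: "0 \<le> c" "c < 1"
  obtains C \<rho> :: real where "0 < C" "1 \<le> \<rho>"
    "\<And>u. norm u \<ge> \<rho> \<Longrightarrow> Re u \<ge> - c * norm u \<Longrightarrow>
       norm (stirling_ratio b u - of_real (sqrt (2 * pi))) \<le> C / (norm u)\<^sup>2"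
proof -
  obtain C \<rho> :: real where C: "0 < C" "1 \<le> \<rho>"
    "\<And>u M. norm u \<ge> \<rho> \<Longrightarrow> Re u \<ge> - c * norm u \<Longrightarrow> u + b \<notin> \<int>\<^sub>\<le>\<^sub>0 \<and>
       stirling_ratio b (u + of_nat M) = stirling_ratio b u * exp (\<Sum>m<M. stirling_step b (u + of_nat m)) \<and>
       (\<Sum>m<M. norm (stirling_step b (u + of_nat m))) \<le> C / (norm u)\<^sup>2"
    using stirling_ratio_shift[OF c, of b] by metis
  define s where "s = sqrt (2 * pi)"
  have s: "s > 0" by (simp add: s_def)
  \<comment> \<open>The second bound makes the exponent at most \<open>1/2\<close>, where \<open>exp\<close> is close to its tangent.\<close>
  define \<rho>' where "\<rho>' = max \<rho> (2 * C + 1)"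
  show thesis
  proof (rule that[of "s * (2 * C)" \<rho>'])
    show "0 < s * (2 * C)" "1 \<le> \<rho>'" using C s by (auto simp: \<rho>'_def)
    fix u :: complex assume u: "norm u \<ge> \<rho>'" "Re u \<ge> - c * norm u"
    have ur: "norm u \<ge> \<rho>" "norm u \<ge> 2 * C + 1" using u by (auto simp: \<rho>'_def)
    note S = C(3)[OF ur(1) u(2)]
    define d where "d = C / (norm u)\<^sup>2"
    have "norm u * 1 \<le> norm u * norm u" using ur C by (intro mult_left_mono) auto
    then have "2 * C \<le> (norm u)\<^sup>2" using ur by (simp add: power2_eq_square)
    moreover have "norm u > 0" using ur C by linarith
    ultimately have d: "d \<le> 1/2" by (simp add: d_def divide_simps)
    have lim: "(\<lambda>M. stirling_ratio b (u + of_nat M)) \<longlonglongrightarrow> of_real s"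
    proof -
      have "\<forall>\<^sub>F M in sequentially. stirling_ratio 1 (of_nat M) \<noteq> 0"
        using stirling_ratio_one_limit s by (metis s_def less_irrefl of_real_eq_0_iff tendsto_imp_eventually_ne)
      then have ev: "\<forall>\<^sub>F M in sequentially. stirling_ratio b (u + of_nat M) / stirling_ratio 1 (of_nat M) * stirling_ratio 1 (of_nat M)
         = stirling_ratio b (u + of_nat M)"
        by eventually_elim simp
      have "(\<lambda>M. stirling_ratio b (u + of_nat M) / stirling_ratio 1 (of_nat M) * stirling_ratio 1 (of_nat M)) \<longlonglongrightarrow> 1 * of_real s"
        unfolding s_def using S by (intro tendsto_mult stirling_ratio_quotient_limit stirling_ratio_one_limit) auto
      then show ?thesis using ev by (simp add: Lim_transform_eventually)
    qed
    have bd: "norm (stirling_ratio b u - stirling_ratio b (u + of_nat M)) \<le> norm (stirling_ratio b (u + of_nat M)) * (2 * d)" for M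
    proof -
      define e where "e = (\<Sum>m<M. stirling_step b (u + of_nat m))"
      have e: "norm (- e) \<le> d"
        unfolding e_def d_def norm_minus_cancel using S[of M] by (intro order_trans[OF norm_sum]) auto
      have R: "stirling_ratio b u = stirling_ratio b (u + of_nat M) * exp (- e)"
        using S[of M] by (simp add: e_def[symmetric] exp_minus field_simps)
      have "norm (exp (- e) - 1) \<le> 3 / 2 * norm (- e)"
        using e d by (intro norm_exp_bounds(2)) auto
      then have "norm (exp (- e) - 1) \<le> 2 * d" using e norm_ge_zero[of "-e"] by linarith
      moreover have "stirling_ratio b u - stirling_ratio b (u + of_nat M) = stirling_ratio b (u + of_nat M) * (exp (- e) - 1)"
        by (subst R) (simp add: algebra_simps)
      ultimately show ?thesis by (simp add: norm_mult mult_left_mono)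
    qed
    have "norm (stirling_ratio b u - of_real s) \<le> norm (of_real s :: complex) * (2 * d)"
      by (rule LIMSEQ_le[OF tendsto_norm[OF tendsto_diff[OF tendsto_const lim]] tendsto_mult[OF tendsto_norm[OF lim] tendsto_const]])
        (use bd in auto)
    then show "norm (stirling_ratio b u - of_real (sqrt (2 * pi))) \<le> s * (2 * C) / (norm u)\<^sup>2"
      using s by (simp add: s_def[symmetric] d_def)
  qed
qed

section \<open>Products of Gamma functions in sectors\<close>

definition sector_at_infinity :: "real \<Rightarrow> complex filter" where
  "sector_at_infinity c = inf at_infinity (principal {u. Re u \<ge> - c * norm u})"

lemma eventually_sector_at_infinity:
  "eventually P (sector_at_infinity c) \<longleftrightarrow>
     (\<exists>\<rho>. \<forall>u. norm u \<ge> \<rho> \<longrightarrow> Re u \<ge> - c * norm u \<longrightarrow> P u)"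
  unfolding sector_at_infinity_def eventually_inf_principal eventually_at_infinity by auto

lemma eventually_sector_norm_ge: "\<forall>\<^sub>F u in sector_at_infinity c. norm u \<ge> (\<rho> :: real)"
  unfolding eventually_sector_at_infinity by blast

lemma eventually_sector_mem: "\<forall>\<^sub>F u in sector_at_infinity c. Re u \<ge> - c * norm u"
  unfolding eventually_sector_at_infinity by blast

lemma filterlim_sector_scale:
  assumes "(k :: real) > 0"
  shows "filterlim (\<lambda>u. of_real k * u) (sector_at_infinity c) (sector_at_infinity c)"
  unfolding filterlim_iff
proof (intro allI impI)
  fix P assume "eventually P (sector_at_infinity c)"
  then obtain \<rho> where r: "\<And>u. norm u \<ge> \<rho> \<Longrightarrow> Re u \<ge> - c * norm u \<Longrightarrow> P u"
    unfolding eventually_sector_at_infinity by blast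
  show "\<forall>\<^sub>F u in sector_at_infinity c. P (of_real k * u)"
    unfolding eventually_sector_at_infinity
  proof (intro exI allI impI)
    fix u :: complex assume u: "norm u \<ge> \<rho> / k" "Re u \<ge> - c * norm u"
    have "Re (of_real k * u) \<ge> - c * norm (of_real k * u)"
    proof -
      have "k * (- c * norm u) \<le> k * Re u" using u assms by (intro mult_left_mono) auto
      then show ?thesis using assms by (simp add: norm_mult mult_ac)
    qed
    moreover have "norm (of_real k * u) \<ge> \<rho>"
      using u assms by (simp add: norm_mult field_simps)
    ultimately show "P (of_real k * u)" by (intro r)
  qed
qed

text \<open>Two terms and a quadratic remainder are the precision to which the product of \<open>n\<close> Gamma functions
  is matched by a sum of two single ones.\<close>

definition gamma_expansion :: "real \<Rightarrow> complex \<Rightarrow> (complex \<Rightarrow> complex) \<Rightarrow> bool" where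
  "gamma_expansion c a f \<longleftrightarrow> (\<lambda>u. f u - (1 + a / u)) \<in> O[sector_at_infinity c](\<lambda>u. 1 / u\<^sup>2)"

lemma bigo_inverse_power:
  assumes "m \<ge> k"
  shows "(\<lambda>u. 1 / u ^ m) \<in> O[sector_at_infinity c](\<lambda>u. 1 / u ^ k)"
proof (rule bigoI[of _ 1])
  show "\<forall>\<^sub>F u in sector_at_infinity c. norm (1 / u ^ m) \<le> 1 * norm (1 / u ^ k)"
    using eventually_sector_norm_ge[of 1]
  proof eventually_elim
    case (elim u)
    have "norm u ^ k \<le> norm u ^ m" using elim assms by (intro power_increasing) auto
    moreover have "0 < norm u ^ k" using elim by (intro zero_less_power) linarith
    ultimately show ?case
      by (simp add: norm_divide norm_power divide_left_mono frac_le)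
  qed
qed

lemma bigo_cmult:
  fixes f :: "'a \<Rightarrow> complex"
  assumes "f \<in> O[F](g)"
  shows "(\<lambda>x. a * f x) \<in> O[F](g)"
proof (cases "a = 0")
  case False
  then show ?thesis using assms landau_o.big.cmult_in_iff[of a f F g] by blast
qed simp

lemma bigo_const_over: "(\<lambda>u. a / u) \<in> O[sector_at_infinity c](\<lambda>u. 1)"
proof -
  have "(\<lambda>u. a * (1 / u ^ 1)) \<in> O[sector_at_infinity c](\<lambda>u. 1 / u ^ 0)"
    by (intro bigo_cmult bigo_inverse_power) simp
  moreover have "(\<lambda>u. a * (1 / u ^ 1)) = (\<lambda>u. a / u)" by (rule ext) simp
  ultimately show ?thesis by (simp only: power_0 div_by_1)
qed

lemma gamma_expansion_mult:
  assumes "gamma_expansion c a f" "gamma_expansion c b g"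
  shows "gamma_expansion c (a + b) (\<lambda>u. f u * g u)"
proof -
  let ?S = "sector_at_infinity c"
  note F = assms[unfolded gamma_expansion_def]
  have one: "(\<lambda>u. 1 + b / u) \<in> O[?S](\<lambda>u. 1)" for b :: complex
    by (rule sum_in_bigo[OF _ bigo_const_over]) simp
  have g1: "g \<in> O[?S](\<lambda>u. 1)"
  proof -
    have "(\<lambda>u. (g u - (1 + b / u)) + (1 + b / u)) \<in> O[?S](\<lambda>u. 1)"
      by (rule sum_in_bigo[OF landau_o.big_trans[OF F(2)] one]) (use bigo_inverse_power[of 0 2 c] in simp)
    then show ?thesis by simp
  qed
  have "(\<lambda>u. (f u - (1 + a / u)) * g u) \<in> O[?S](\<lambda>u. 1 / u\<^sup>2 * 1)"
    by (intro landau_o.big.mult F g1)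
  moreover have "(\<lambda>u. (1 + a / u) * (g u - (1 + b / u))) \<in> O[?S](\<lambda>u. 1 * (1 / u\<^sup>2))"
    by (intro landau_o.big.mult F one)
  moreover have "(\<lambda>u. a * b * (1 / u\<^sup>2)) \<in> O[?S](\<lambda>u. 1 / u\<^sup>2)"
    by (rule bigo_cmult[OF landau_o.big_refl])
  ultimately have "(\<lambda>u. (f u - (1 + a / u)) * g u + (1 + a / u) * (g u - (1 + b / u)) + a * b * (1 / u\<^sup>2)) \<in> O[?S](\<lambda>u. 1 / u\<^sup>2)"
    by (intro sum_in_bigo) simp_all
  moreover have "(\<lambda>u. (f u - (1 + a / u)) * g u + (1 + a / u) * (g u - (1 + b / u)) + a * b * (1 / u\<^sup>2)) =
     (\<lambda>u. f u * g u - (1 + (a + b) / u))"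
    by (rule ext) (simp add: ring_distribs power2_eq_square add_divide_distrib)
  ultimately show ?thesis unfolding gamma_expansion_def by simp
qed

lemma gamma_expansion_prod:
  assumes "finite A" "\<And>i. i \<in> A \<Longrightarrow> gamma_expansion c (a i) (f i)"
  shows "gamma_expansion c (\<Sum>i\<in>A. a i) (\<lambda>u. \<Prod>i\<in>A. f i u)"
  using assms
proof (induction A rule: finite_induct)
  case empty
  then show ?case by (simp add: gamma_expansion_def)
next
  case (insert i A)
  then show ?case by (simp add: gamma_expansion_mult)
qed

lemma gamma_expansion_scale:
  assumes "gamma_expansion c a f" "(k :: real) > 0"
  shows "gamma_expansion c (a / of_real k) (\<lambda>u. f (of_real k * u))"
proof -
  have "(\<lambda>u. f (of_real k * u) - (1 + a / (of_real k * u))) \<in> O[sector_at_infinity c](\<lambda>u. 1 / (of_real k * u)\<^sup>2)"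
    using landau_o.big.compose[OF assms(1)[unfolded gamma_expansion_def] filterlim_sector_scale[OF assms(2)]] .
  also have "(\<lambda>u. 1 / (of_real k * u)\<^sup>2) = (\<lambda>u. (1 / (of_real k)\<^sup>2) * (1 / u\<^sup>2) :: complex)"
    by (simp add: power_mult_distrib)
  also have "O[sector_at_infinity c](\<dots>) = O[sector_at_infinity c](\<lambda>u. 1 / u\<^sup>2)"
    using assms(2) by (intro landau_o.big.cmult) simp
  finally show ?thesis unfolding gamma_expansion_def by simp
qed

lemma norm_exp_minus_one_minus:
  fixes z :: complex
  assumes "norm z \<le> 1/2"
  shows "norm (exp z - 1 - z) \<le> 2 * (norm z)\<^sup>2"
proof -
  have "norm ((exp z - 1 - z) - (exp 0 - 1 - 0)) \<le> 2 * norm z * norm (z - 0)"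
  proof (rule field_differentiable_bound[OF convex_cball[of 0 "norm z"], where f = "\<lambda>z. exp z - 1 - z" and f' = "\<lambda>z. exp z - 1"])
    show "((\<lambda>z. exp z - 1 - z) has_field_derivative exp x - 1) (at x within cball 0 (norm z))" for x
      by (auto intro!: derivative_eq_intros)
    show "norm (exp x - 1) \<le> 2 * norm z" if "x \<in> cball 0 (norm z)" for x :: complex
    proof -
      have x: "norm x \<le> norm z" using that by simp
      then have "norm (exp x - 1) \<le> 3 / 2 * norm x" using assms by (intro norm_exp_bounds(2)) auto
      then show ?thesis using x norm_ge_zero[of x] by linarith
    qed
  qed auto
  then show ?thesis by (simp add: power2_eq_square)
qed

lemma gamma_expansion_exp: "gamma_expansion c a (\<lambda>u. exp (a / u))"
  unfolding gamma_expansion_def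
proof (rule bigoI[of _ "2 * (norm a)\<^sup>2"])
  show "\<forall>\<^sub>F u in sector_at_infinity c. norm (exp (a / u) - (1 + a / u)) \<le> 2 * (norm a)\<^sup>2 * norm (1 / u\<^sup>2)"
    using eventually_sector_norm_ge[of "2 * norm a + 1"]
  proof eventually_elim
    case (elim u)
    then have "norm (a / u) \<le> 1/2" using norm_ge_zero[of a] by (auto simp: norm_divide divide_simps)
    from norm_exp_minus_one_minus[OF this] show ?case
      by (simp add: norm_divide power_divide norm_power diff_diff_eq)
  qed
qed

definition gamma_quotient :: "complex \<Rightarrow> complex \<Rightarrow> complex" where
  "gamma_quotient b u = Gamma (u + b) / (of_real (sqrt (2 * pi)) * exp ((u + b - 1/2) * Ln u - u))"

lemma Gamma_eq_quotient:
  "Gamma (u + b) = of_real (sqrt (2 * pi)) * exp ((u + b - 1/2) * Ln u - u) * gamma_quotient b u"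
  by (simp add: gamma_quotient_def)

text \<open>The \<open>1 / u\<close> term comes from the exponential of \<open>stirling_coeff b / u\<close>, by which this quotient differs
  from \<open>stirling_ratio b u\<close>.\<close>

theorem expansion_gamma_quotient:
  assumes c: "0 \<le> c" "c < 1"
  shows "gamma_expansion c (stirling_coeff b) (gamma_quotient b)"
proof -
  let ?s = "of_real (sqrt (2 * pi)) :: complex"
  have s: "?s \<noteq> 0" by simp
  obtain C \<rho> where C: "0 < C" "1 \<le> \<rho>"
    "\<And>u. norm u \<ge> \<rho> \<Longrightarrow> Re u \<ge> - c * norm u \<Longrightarrow> norm (stirling_ratio b u - ?s) \<le> C / (norm u)\<^sup>2"
    using stirling_ratio_asymptotics[OF c] by blast
  have "(\<lambda>u. stirling_ratio b u - ?s) \<in> O[sector_at_infinity c](\<lambda>u. 1 / u\<^sup>2)"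
  proof (rule bigoI[of _ C])
    show "\<forall>\<^sub>F u in sector_at_infinity c. norm (stirling_ratio b u - ?s) \<le> C * norm (1 / u\<^sup>2)"
      using eventually_sector_norm_ge[of \<rho>] eventually_sector_mem
      by eventually_elim (use C(3) in \<open>simp add: norm_divide norm_power\<close>)
  qed
  then have "(\<lambda>u. (1 / ?s) * (stirling_ratio b u - ?s)) \<in> O[sector_at_infinity c](\<lambda>u. 1 / u\<^sup>2)"
    using s by simp
  also have "(\<lambda>u. (1 / ?s) * (stirling_ratio b u - ?s)) = (\<lambda>u. stirling_ratio b u / ?s - (1 + 0 / u))"
    using s by (simp add: field_simps)
  finally have "gamma_expansion c 0 (\<lambda>u. stirling_ratio b u / ?s)"
    unfolding gamma_expansion_def .
  from gamma_expansion_mult[OF this gamma_expansion_exp[of c "stirling_coeff b"]]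
  have "gamma_expansion c (stirling_coeff b) (\<lambda>u. stirling_ratio b u / ?s * exp (stirling_coeff b / u))"
    by simp
  moreover have "(\<lambda>u. stirling_ratio b u / ?s * exp (stirling_coeff b / u)) = gamma_quotient b"
  proof
    fix u
    have "stirling_ratio b u * exp (stirling_coeff b / u) = Gamma (u + b) * exp (- ((u + b - 1/2) * Ln u - u))"
      unfolding stirling_ratio_def mult.assoc exp_add[symmetric] by (simp add: algebra_simps)
    then show "stirling_ratio b u / ?s * exp (stirling_coeff b / u) = gamma_quotient b u"
      unfolding gamma_quotient_def exp_minus by (simp add: field_simps)
  qed
  ultimately show ?thesis by simp
qed

text \<open>
  A product of \<open>n\<close> Gamma functions behaves like the single function \<open>Gamma (n u + B)\<close>, as in Gauss's
  multiplication formula; the second Gamma function absorbs the \<open>1/u\<close> term of the quotient, so that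
  the remainder gains two powers of \<open>u\<close>.
\<close>

theorem Gamma_product_asymptotics:
  fixes b :: "'a \<Rightarrow> complex" and A :: "'a set"
  assumes c: "0 \<le> c" "c < 1" and A: "finite A" "A \<noteq> {}"
  defines "n \<equiv> card A" and "B \<equiv> (\<Sum>a\<in>A. b a) - of_nat (card A) / 2 + 1/2"
  obtains \<gamma> :: complex and C \<rho> :: real where "0 < C" "1 \<le> \<rho>"
    "\<And>u. norm u \<ge> \<rho> \<Longrightarrow> Re u \<ge> - c * norm u \<Longrightarrow>
       norm ((\<Prod>a\<in>A. Gamma (u + b a)) - of_real ((2 * pi) powr ((real n - 1) / 2)) *
           exp (- (of_nat n * u + B - 1/2) * of_real (ln (real n))) *
           (Gamma (of_nat n * u + B) + \<gamma> * Gamma (of_nat n * u + (B - 1))))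
         \<le> C / (norm u)\<^sup>2 * norm (exp ((of_nat n * u + B - 1/2) * Ln u - of_nat n * u))"
proof -
  have n: "n > 0" using A by (simp add: n_def card_gt_0_iff)
  define s where "s = complex_of_real (sqrt (2 * pi))"
  have s0: "s \<noteq> 0" by (simp add: s_def)
  define e where "e = (\<Sum>a\<in>A. stirling_coeff (b a))"
  \<comment> \<open>The \<open>1 / u\<close> terms match: \<open>e = stirling_coeff B / n + \<gamma> / n\<close>.\<close>
  define \<gamma> where "\<gamma> = of_nat n * e - stirling_coeff B"
  define q where "q = (\<lambda>u. (\<Prod>a\<in>A. gamma_quotient (b a) u))"
  define m where "m = (\<lambda>u. gamma_quotient B (of_real (real n) * u) + \<gamma> * (gamma_quotient (B - 1) (of_real (real n) * u) / (of_nat n * u)))"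
  define S where "S = sector_at_infinity c"
  have q: "(\<lambda>u. q u - (1 + e / u)) \<in> O[S](\<lambda>u. 1 / u\<^sup>2)"
    using gamma_expansion_prod[OF A(1), of c "\<lambda>a. stirling_coeff (b a)" "\<lambda>a. gamma_quotient (b a)"] expansion_gamma_quotient[OF c]
    unfolding gamma_expansion_def q_def e_def S_def by blast
  have m1: "(\<lambda>u. gamma_quotient B (of_real (real n) * u) - (1 + stirling_coeff B / of_real (real n) / u)) \<in> O[S](\<lambda>u. 1 / u\<^sup>2)"
    using gamma_expansion_scale[OF expansion_gamma_quotient[OF c, of B], of "real n"] n
    unfolding gamma_expansion_def S_def by simp
  have m2: "(\<lambda>u. gamma_quotient (B - 1) (of_real (real n) * u) - 1) \<in> O[S](\<lambda>u. 1 / u)"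
  proof -
    let ?a = "stirling_coeff (B - 1) / of_real (real n)"
    have "(\<lambda>u. gamma_quotient (B - 1) (of_real (real n) * u) - (1 + ?a / u)) \<in> O[S](\<lambda>u. 1 / u\<^sup>2)"
      using gamma_expansion_scale[OF expansion_gamma_quotient[OF c, of "B - 1"], of "real n"] n
      unfolding gamma_expansion_def S_def by simp
    also have "(\<lambda>u. 1 / u\<^sup>2) \<in> O[S](\<lambda>u::complex. 1 / u ^ 1)"
      unfolding S_def by (rule bigo_inverse_power) simp
    finally have 1: "(\<lambda>u. gamma_quotient (B - 1) (of_real (real n) * u) - (1 + ?a / u)) \<in> O[S](\<lambda>u. 1 / u)" by simp
    have 2: "(\<lambda>u. ?a * (1 / u)) \<in> O[S](\<lambda>u. 1 / u)" by (rule bigo_cmult[OF landau_o.big_refl])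
    have "(\<lambda>u. (gamma_quotient (B - 1) (of_real (real n) * u) - (1 + ?a / u)) + ?a * (1 / u)) \<in> O[S](\<lambda>u. 1 / u)"
      by (rule sum_in_bigo[OF 1 2])
    then show ?thesis by simp
  qed
  have m3: "(\<lambda>u. (\<gamma> / of_nat n) * (1 / u) * (gamma_quotient (B - 1) (of_real (real n) * u) - 1)) \<in> O[S](\<lambda>u. 1 / u * (1 / u))"
    by (intro landau_o.big.mult m2 bigo_cmult landau_o.big_refl)
  have "(\<lambda>u. (q u - (1 + e / u)) - (gamma_quotient B (of_real (real n) * u) - (1 + stirling_coeff B / of_real (real n) / u))
      - (\<gamma> / of_nat n) * (1 / u) * (gamma_quotient (B - 1) (of_real (real n) * u) - 1)) \<in> O[S](\<lambda>u. 1 / u\<^sup>2)"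
  proof -
    have "(\<lambda>u. 1 / u * (1 / u)) = (\<lambda>u. 1 / u\<^sup>2 :: complex)" by (simp add: power2_eq_square)
    with m3 show ?thesis by (intro sum_in_bigo(2)[OF sum_in_bigo(2)[OF q m1]]) (simp only:)
  qed
  also have "(\<lambda>u. (q u - (1 + e / u)) - (gamma_quotient B (of_real (real n) * u) - (1 + stirling_coeff B / of_real (real n) / u))
      - (\<gamma> / of_nat n) * (1 / u) * (gamma_quotient (B - 1) (of_real (real n) * u) - 1)) = (\<lambda>u. q u - m u)"
  proof
    fix u :: complex
    define w where "w = 1 / u"
    have w: "x / u = x * w" "x / (of_nat n * u) = (x / of_nat n) * w" for x by (simp_all add: w_def)
    have g: "\<gamma> / of_nat n = e - stirling_coeff B / of_nat n"
      unfolding \<gamma>_def using n by (simp add: field_simps)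
    have gX: "\<gamma> * (X / (of_nat n * u)) = (\<gamma> / of_nat n) * (w * X)" for X by (simp add: w_def)
    have mu: "m u = gamma_quotient B (of_real (real n) * u) + (e - stirling_coeff B / of_nat n) * (w * gamma_quotient (B - 1) (of_real (real n) * u))"
      unfolding m_def gX g ..
    have stir: "stirling_coeff B / of_real (real n) / u = stirling_coeff B / of_nat n * w"
      by (simp add: w_def)
    show "(q u - (1 + e / u)) - (gamma_quotient B (of_real (real n) * u) - (1 + stirling_coeff B / of_real (real n) / u))
      - (\<gamma> / of_nat n) * (1 / u) * (gamma_quotient (B - 1) (of_real (real n) * u) - 1) = q u - m u"
      unfolding mu g stir w(1) by (simp add: algebra_simps)
  qed
  finally have "(\<lambda>u. q u - m u) \<in> O[S](\<lambda>u. 1 / u\<^sup>2)" .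
  then obtain C where C: "C > 0" "\<forall>\<^sub>F u in S. norm (q u - m u) \<le> C * norm (1 / u\<^sup>2)"
    by (elim landau_o.bigE)
  then obtain \<rho> where r: "\<And>u. norm u \<ge> \<rho> \<Longrightarrow> Re u \<ge> - c * norm u \<Longrightarrow> norm (q u - m u) \<le> C * norm (1 / u\<^sup>2)"
    unfolding S_def eventually_sector_at_infinity by blast
  show thesis
  proof (rule that[of "C * norm (s ^ n)" "max 1 \<rho>" \<gamma>])
    show "0 < C * norm (s ^ n)" using C s0 by simp
    show "1 \<le> max 1 \<rho>" by simp
    fix u :: complex assume u: "norm u \<ge> max 1 \<rho>" "Re u \<ge> - c * norm u"
    have u0: "u \<noteq> 0" using u by auto
    define lu where "lu = Ln u"
    define l where "l = complex_of_real (ln (real n))"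
    define E where "E = exp ((of_nat n * u + B - 1/2) * lu - of_nat n * u)"
    define K where "K = of_real ((2 * pi) powr ((real n - 1) / 2)) * exp (- (of_nat n * u + B - 1/2) * l)"
    have Lnn: "Ln (of_real (real n) * u) = l + lu"
      using Ln_times_of_real[of "real n" u] Ln_of_real[of "real n"] n u0 by (simp add: l_def lu_def)
    have P: "(\<Prod>a\<in>A. Gamma (u + b a)) = s ^ n * E * q u"
    proof -
      have "(\<Prod>a\<in>A. Gamma (u + b a)) = (\<Prod>a\<in>A. s) * (\<Prod>a\<in>A. exp ((u + b a - 1/2) * lu - u)) * q u"
        unfolding q_def Gamma_eq_quotient[of u] lu_def s_def by (simp add: prod.distrib)
      also have "(\<Prod>a\<in>A. exp ((u + b a - 1/2) * lu - u)) = exp (\<Sum>a\<in>A. (u + b a - 1/2) * lu - u)"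
        using A by (simp add: exp_sum)
      also have "(\<Sum>a\<in>A. (u + b a - 1/2) * lu - u) = (of_nat n * u + B - 1/2) * lu - of_nat n * u"
      proof -
        have "(\<Sum>a\<in>A. (u + b a - 1/2) * lu - u) = (\<Sum>a\<in>A. ((u - 1/2) * lu - u) + lu * b a)"
          by (intro sum.cong refl) (simp add: algebra_simps)
        also have "\<dots> = of_nat n * ((u - 1/2) * lu - u) + lu * (\<Sum>a\<in>A. b a)"
          unfolding sum.distrib sum_distrib_left[symmetric] by (simp add: n_def)
        also have "(\<Sum>a\<in>A. b a) = B + of_nat n / 2 - 1/2" by (simp add: B_def n_def)
        finally have eq: "(\<Sum>a\<in>A. (u + b a - 1/2) * lu - u) =
            of_nat n * ((u - 1/2) * lu - u) + lu * (B + of_nat n / 2 - 1/2)" .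
        show ?thesis unfolding eq by (simp add: field_simps)
      qed
      finally show ?thesis by (simp add: E_def n_def)
    qed
    have KK: "K * s * exp ((of_nat n * u + B - 1/2) * (l + lu) - of_nat n * u) = s ^ n * E"
    proof -
      have "(2 * pi) powr ((real n - 1) / 2) * sqrt (2 * pi) = sqrt (2 * pi) ^ n"
      proof -
        have pi2: "0 < 2 * pi" by simp
        have "(2 * pi) powr ((real n - 1) / 2) * sqrt (2 * pi) = (2 * pi) powr ((real n - 1) / 2 + 1 / 2)"
          by (simp add: powr_add powr_half_sqrt)
        also have "(real n - 1) / 2 + 1 / 2 = (1/2) * real n" by (simp add: field_simps)
        also have "(2 * pi) powr ((1/2) * real n) = sqrt (2 * pi) ^ n"
          unfolding powr_powr[symmetric] powr_half_sqrt[OF less_imp_le[OF pi2]] by (rule powr_realpow) (use pi2 in simp)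
        finally show ?thesis .
      qed
      then have 1: "of_real ((2 * pi) powr ((real n - 1) / 2)) * s = s ^ n"
        unfolding s_def by (metis of_real_mult of_real_power)
      have 2: "exp (- (of_nat n * u + B - 1/2) * l) * exp ((of_nat n * u + B - 1/2) * (l + lu) - of_nat n * u) = E"
      proof -
        have "- x * l + (x * (l + lu) - y) = x * lu - y" for x y :: complex by (simp add: algebra_simps)
        then show ?thesis unfolding exp_add[symmetric] E_def by (simp only:)
      qed
      show ?thesis unfolding K_def 1[symmetric] 2[symmetric] by (simp only: mult_ac)
    qed
    have nu: "of_nat n * u \<noteq> 0" using n u0 by simp
    have G1: "K * Gamma (of_nat n * u + B) = s ^ n * E * gamma_quotient B (of_real (real n) * u)"
    proof -
      have "Gamma (of_real (real n) * u + B) = s * exp ((of_nat n * u + B - 1/2) * (l + lu) - of_nat n * u) * gamma_quotient B (of_real (real n) * u)"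
        unfolding Gamma_eq_quotient[of "of_real (real n) * u"] Lnn s_def by simp
      then have "K * Gamma (of_nat n * u + B) = K * s * exp ((of_nat n * u + B - 1/2) * (l + lu) - of_nat n * u) * gamma_quotient B (of_real (real n) * u)"
        by simp
      then show ?thesis unfolding KK .
    qed
    have G2: "K * Gamma (of_nat n * u + (B - 1)) = s ^ n * E * (gamma_quotient (B - 1) (of_real (real n) * u) / (of_nat n * u))"
    proof -
      have ex: "exp (l + lu) = of_nat n * u" unfolding Lnn[symmetric] using nu by simp
      have "exp ((of_nat n * u + (B - 1) - 1/2) * (l + lu) - of_nat n * u) = exp (((of_nat n * u + B - 1/2) * (l + lu) - of_nat n * u) - (l + lu))"
      proof -
        have "(y + (B - 1) - 1/2) * k - y = ((y + B - 1/2) * k - y) - k" for y k :: complex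
          by (simp add: algebra_simps)
        then show ?thesis by (simp only:)
      qed
      also have "\<dots> = exp ((of_nat n * u + B - 1/2) * (l + lu) - of_nat n * u) / (of_nat n * u)"
        unfolding exp_diff[of _ "l + lu"] ex ..
      finally have ee: "exp ((of_nat n * u + (B - 1) - 1/2) * (l + lu) - of_nat n * u) = exp ((of_nat n * u + B - 1/2) * (l + lu) - of_nat n * u) / (of_nat n * u)" .
      have "Gamma (of_real (real n) * u + (B - 1)) = s * exp ((of_nat n * u + (B - 1) - 1/2) * (l + lu) - of_nat n * u) * gamma_quotient (B - 1) (of_real (real n) * u)"
        unfolding Gamma_eq_quotient[of "of_real (real n) * u"] Lnn s_def by simp
      then have "K * Gamma (of_nat n * u + (B - 1)) = K * s * exp ((of_nat n * u + B - 1/2) * (l + lu) - of_nat n * u) * (gamma_quotient (B - 1) (of_real (real n) * u) / (of_nat n * u))"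
        unfolding ee by simp
      then show ?thesis unfolding KK .
    qed
    have "(\<Prod>a\<in>A. Gamma (u + b a)) - K * (Gamma (of_nat n * u + B) + \<gamma> * Gamma (of_nat n * u + (B - 1)))
       = s ^ n * E * (q u - m u)"
    proof -
      have "K * (Gamma (of_nat n * u + B) + \<gamma> * Gamma (of_nat n * u + (B - 1))) = K * Gamma (of_nat n * u + B) + \<gamma> * (K * Gamma (of_nat n * u + (B - 1)))"
        by (simp add: algebra_simps)
      also have "\<dots> = s ^ n * E * m u" unfolding G1 G2 m_def by (simp add: algebra_simps)
      finally show ?thesis unfolding P by (simp add: algebra_simps)
    qed
    moreover have "norm (s ^ n * E * (q u - m u)) \<le> norm (s ^ n) * norm E * (C * norm (1 / u\<^sup>2))"
      unfolding norm_mult using u by (intro mult_left_mono r) auto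
    ultimately show "norm ((\<Prod>a\<in>A. Gamma (u + b a)) - of_real ((2 * pi) powr ((real n - 1) / 2)) *
           exp (- (of_nat n * u + B - 1/2) * of_real (ln (real n))) *
           (Gamma (of_nat n * u + B) + \<gamma> * Gamma (of_nat n * u + (B - 1))))
         \<le> C * norm (s ^ n) / (norm u)\<^sup>2 * norm (exp ((of_nat n * u + B - 1/2) * Ln u - of_nat n * u))"
      unfolding K_def l_def E_def lu_def by (simp add: norm_divide norm_power mult_ac)
  qed
qed

section \<open>Rays of descent\<close>

text \<open>
  The real part of the exponent \<open>u (Ln u - ln \<rho> - \<i> \<theta>) - u\<close> on the ray leaving the
  vertex \<open>\<rho>\<close> in the direction \<open>d\<close>, in units of \<open>\<rho>\<close>; the saddle point is \<open>exp (\<i> \<theta>)\<close>.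
\<close>

definition leg_exponent :: "real \<Rightarrow> complex \<Rightarrow> real \<Rightarrow> real" where
  "leg_exponent \<theta> d v = Re ((1 + of_real v * d) * (Ln (1 + of_real v * d) - \<i> * of_real \<theta>) - (1 + of_real v * d))"

definition leg_slope :: "real \<Rightarrow> complex \<Rightarrow> real \<Rightarrow> real" where
  "leg_slope \<theta> d v = Re (d * (Ln (1 + of_real v * d) - \<i> * of_real \<theta>))"

lemma leg_not_nonpos:
  assumes "Im d \<noteq> 0" "v \<ge> 0"
  shows "1 + complex_of_real v * d \<notin> \<real>\<^sub>\<le>\<^sub>0"
  using assms by (auto simp: complex_nonpos_Reals_iff)

lemma has_real_derivative_Re_of_real:
  fixes g :: "complex \<Rightarrow> complex"
  assumes "(g has_field_derivative D) (at (of_real v))"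
  shows "((\<lambda>v. Re (g (of_real v))) has_real_derivative Re D) (at v)"
proof -
  have "((\<lambda>x. g (of_real x)) has_vector_derivative D) (at v)"
    using assms has_vector_derivative_real_field by blast
  then show ?thesis
    unfolding has_real_derivative_iff_has_vector_derivative
    using bounded_linear.has_vector_derivative[OF bounded_linear_Re] by blast
qed

lemma leg_exponent_deriv:
  assumes "Im d \<noteq> 0" "v \<ge> 0"
  shows "(leg_exponent \<theta> d has_real_derivative leg_slope \<theta> d v) (at v)"
proof -
  have nn: "1 + of_real v * d \<notin> \<real>\<^sub>\<le>\<^sub>0" using leg_not_nonpos[OF assms] .
  then have nz: "1 + of_real v * d \<noteq> 0" by auto
  have P: "((\<lambda>w. 1 + w * d) has_field_derivative d) (at (of_real v))"
    by (auto intro!: derivative_eq_intros)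
  have L: "((\<lambda>w. Ln (1 + w * d) - \<i> * of_real \<theta>) has_field_derivative d / (1 + of_real v * d)) (at (of_real v))"
    using nn by (auto intro!: derivative_eq_intros simp: field_simps)
  have "((\<lambda>w. (1 + w * d) * (Ln (1 + w * d) - \<i> * of_real \<theta>) - (1 + w * d)) has_field_derivative
      d * (Ln (1 + of_real v * d) - \<i> * of_real \<theta>)) (at (of_real v))"
    using DERIV_diff[OF DERIV_mult[OF P L] P] nz by simp
  from has_real_derivative_Re_of_real[OF this] show ?thesis
    unfolding leg_exponent_def[abs_def] leg_slope_def .
qed

text \<open>For \<open>Re d < 0\<close> the numerator decreases in \<open>v\<close>, so along a ray the exponent is first convex and
  then concave, or concave from the start.\<close>

lemma leg_slope_deriv:
  assumes "Im d \<noteq> 0" "v \<ge> 0" "norm d = 1"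
  shows "(leg_slope \<theta> d has_real_derivative
    (Re (d\<^sup>2) + v * Re d) / (norm (1 + of_real v * d))\<^sup>2) (at v)"
proof -
  let ?z = "1 + of_real v * d"
  have nn: "?z \<notin> \<real>\<^sub>\<le>\<^sub>0" using leg_not_nonpos[OF assms(1,2)] .
  then have nz: "?z \<noteq> 0" by auto
  have "((\<lambda>w. d * (Ln (1 + w * d) - \<i> * of_real \<theta>)) has_field_derivative d\<^sup>2 / ?z) (at (of_real v))"
    using nn nz by (auto intro!: derivative_eq_intros simp: field_simps power2_eq_square)
  from has_real_derivative_Re_of_real[OF this]
  have "(leg_slope \<theta> d has_real_derivative Re (d\<^sup>2 / ?z)) (at v)"
    unfolding leg_slope_def[abs_def] .
  moreover have "Re (d\<^sup>2 / ?z) = (Re (d\<^sup>2) + v * Re d) / (norm ?z)\<^sup>2"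
  proof -
    have dd: "d * cnj d = 1" using assms(3) by (simp add: complex_norm_square[symmetric])
    have "d\<^sup>2 / ?z = d\<^sup>2 * cnj ?z / of_real ((norm ?z)\<^sup>2)"
      by (simp only: complex_div_cnj[of "d\<^sup>2" ?z])
    also have "d\<^sup>2 * cnj ?z = d\<^sup>2 + of_real v * (d * (d * cnj d))"
      by (simp add: algebra_simps power2_eq_square)
    also have "\<dots> = d\<^sup>2 + of_real v * d" unfolding dd by simp
    finally show ?thesis by (simp add: Re_divide_of_real)
  qed
  ultimately show ?thesis by simp
qed

text \<open>The slope is nonpositive at \<open>v0\<close> and, by the sign of its derivative, decreases strictly afterwards; one
  unit further on it has a negative value, which bounds it from there on.\<close>

lemma leg_decay:
  assumes d: "norm d = 1" "Im d \<noteq> 0" "Re d < 0" and v0: "v0 \<ge> 0"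
    and slope: "leg_slope \<theta> d v0 \<le> 0" and conc: "Re (d\<^sup>2) + v0 * Re d \<le> 0"
  obtains \<kappa> where "\<kappa> > 0"
    "\<And>v. v \<ge> v0 \<Longrightarrow> leg_exponent \<theta> d v \<le> leg_exponent \<theta> d v0 - \<kappa> * max 0 (v - (v0 + 1))"
proof -
  let ?f = "leg_exponent \<theta> d" and ?s = "leg_slope \<theta> d"
  have num: "Re (d\<^sup>2) + v * Re d \<le> 0" if "v \<ge> v0" for v
  proof -
    have "v * Re d \<le> v0 * Re d" using d that by (intro mult_right_mono_neg) auto
    then show ?thesis using conc by linarith
  qed
  have num': "Re (d\<^sup>2) + v * Re d < 0" if "v > v0" for v
  proof -
    have "v * Re d < v0 * Re d" using d that by (intro mult_strict_right_mono_neg) auto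
    then show ?thesis using conc by linarith
  qed
  have mono: "?s b \<le> ?s a" if "v0 \<le> a" "a \<le> b" for a b
  proof (rule DERIV_nonpos_imp_nonincreasing[OF that(2)])
    fix x assume "a \<le> x" "x \<le> b"
    then show "\<exists>y. DERIV ?s x :> y \<and> y \<le> 0"
      using leg_slope_deriv[OF d(2) _ d(1), of x \<theta>] num[of x] that v0
      by (intro exI[of _ "(Re (d\<^sup>2) + x * Re d) / (norm (1 + of_real x * d))\<^sup>2"])
        (auto intro: divide_nonpos_nonneg)
  qed
  have "?s (v0 + 1) < ?s (v0 + 1/2)"
  proof (rule DERIV_neg_imp_decreasing[where f = ?s])
    fix x assume x: "v0 + 1/2 \<le> x" "x \<le> v0 + 1"
    have "1 + of_real x * d \<noteq> 0" using leg_not_nonpos[OF d(2), of x] x v0 by auto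
    then show "\<exists>y. DERIV ?s x :> y \<and> y < 0"
      using leg_slope_deriv[OF d(2) _ d(1), of x \<theta>] num'[of x] x v0
      by (intro exI[of _ "(Re (d\<^sup>2) + x * Re d) / (norm (1 + of_real x * d))\<^sup>2"])
        (auto intro: divide_neg_pos)
  qed simp
  also have "?s (v0 + 1/2) \<le> ?s v0" by (rule mono) auto
  finally have neg: "?s (v0 + 1) < 0" using slope by linarith
  define \<kappa> where "\<kappa> = - ?s (v0 + 1)"
  show thesis
  proof (rule that[of \<kappa>])
    show "\<kappa> > 0" using neg by (simp add: \<kappa>_def)
    have nonincr: "?f b \<le> ?f a" if "v0 \<le> a" "a \<le> b" for a b
    proof (rule DERIV_nonpos_imp_nonincreasing[OF that(2)])
      fix x assume "a \<le> x" "x \<le> b"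
      then show "\<exists>y. DERIV ?f x :> y \<and> y \<le> 0"
        using leg_exponent_deriv[OF d(2), of x \<theta>] mono[of v0 x] slope that v0
        by (intro exI[of _ "?s x"]) auto
    qed
    fix v assume v: "v \<ge> v0"
    show "?f v \<le> ?f v0 - \<kappa> * max 0 (v - (v0 + 1))"
    proof (cases "v \<le> v0 + 1")
      case True
      then have "max 0 (v - (v0 + 1)) = 0" by simp
      then show ?thesis using nonincr[of v0 v] v by simp
    next
      case False
      have "?f v + \<kappa> * v \<le> ?f (v0 + 1) + \<kappa> * (v0 + 1)"
      proof (rule DERIV_nonpos_imp_nonincreasing[where f = "\<lambda>x. ?f x + \<kappa> * x"])
        show "v0 + 1 \<le> v" using False by simp
        fix x assume x: "v0 + 1 \<le> x" "x \<le> v"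
        have "((\<lambda>x. ?f x + \<kappa> * x) has_real_derivative (?s x + \<kappa>)) (at x)"
          using leg_exponent_deriv[OF d(2), of x \<theta>] x v0 by (auto intro!: derivative_eq_intros)
        moreover have "?s x + \<kappa> \<le> 0" using mono[of "v0 + 1" x] x by (simp add: \<kappa>_def)
        ultimately show "\<exists>y. ((\<lambda>x. ?f x + \<kappa> * x) has_real_derivative y) (at x) \<and> y \<le> 0" by blast
      qed
      moreover have "?f (v0 + 1) \<le> ?f v0" by (rule nonincr) auto
      moreover have "max 0 (v - (v0 + 1)) = v - (v0 + 1)" using False by simp
      ultimately show ?thesis by (simp add: algebra_simps)
    qed
  qed
qed

text \<open>The bound \<open>- cos \<theta>\<close> is the value of the exponent at the saddle point.  The linear decay far out
  outweighs the powers of \<open>u\<close> in Stirling's main term.\<close>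

definition descent_direction :: "real \<Rightarrow> complex \<Rightarrow> bool" where
  "descent_direction \<theta> d \<longleftrightarrow> norm d = 1 \<and> Re d < 0 \<and> Im d \<noteq> 0 \<and>
     (\<exists>\<kappa>>0. \<exists>v1\<ge>0. \<forall>v\<ge>0. leg_exponent \<theta> d v \<le> - cos \<theta> - \<kappa> * max 0 (v - v1))"

text \<open>A ray that does not turn towards the saddle point and along which the exponent is concave from the
  start descends from the value \<open>- 1\<close> at the vertex, which is at most \<open>- cos \<theta>\<close>.\<close>

lemma descent_direction_from_vertex:
  assumes d: "norm d = 1" "Im d \<noteq> 0" "Re d < 0" "Re (d\<^sup>2) \<le> 0" and th: "\<theta> * Im d \<le> 0"
  shows "descent_direction \<theta> d"
proof -
  have s0: "leg_slope \<theta> d 0 \<le> 0" using th by (simp add: leg_slope_def mult.commute)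
  obtain \<kappa> where k: "\<kappa> > 0"
    "\<And>v. v \<ge> 0 \<Longrightarrow> leg_exponent \<theta> d v \<le> leg_exponent \<theta> d 0 - \<kappa> * max 0 (v - (0 + 1))"
    using leg_decay[OF d(1-3) order_refl s0] d(4) by auto
  have "leg_exponent \<theta> d 0 = - 1" by (simp add: leg_exponent_def)
  moreover have "- 1 \<le> - cos \<theta>" by simp
  ultimately have "leg_exponent \<theta> d v \<le> - cos \<theta> - \<kappa> * max 0 (v - 1)" if "v \<ge> 0" for v
    using k(2)[OF that] unfolding add_0 by linarith
  then show ?thesis unfolding descent_direction_def using k(1) d by (intro conjI exI[of _ \<kappa>] exI[of _ 1]) auto
qed

lemma lower_descent_direction:
  assumes "\<theta> \<ge> 0"
  obtains d where "descent_direction \<theta> d" "Im d < 0"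
proof (rule that)
  let ?d = "Complex (- sqrt (1/2)) (- sqrt (1/2))"
  have n: "norm ?d = 1" by (simp add: cmod_def)
  show "descent_direction \<theta> ?d"
    by (rule descent_direction_from_vertex[OF n]) (use assms in \<open>auto simp: power2_eq_square\<close>)
  show "Im ?d < 0" by simp
qed

text \<open>
  For \<open>\<theta> > 0\<close> the upper leg is the chord from the vertex \<open>1\<close> to the saddle point \<open>exp (\<i> \<theta>)\<close>
  of the unit circle, prolonged to infinity: its direction is that of steepest descent.
\<close>

lemma upper_descent_direction:
  assumes th: "\<theta> \<ge> 0" "\<theta> < pi"
  obtains d where "descent_direction \<theta> d" "Im d > 0"
proof (cases "\<theta> = 0")
  case True
  let ?d = "Complex (- sqrt (1/2)) (sqrt (1/2))"
  have n: "norm ?d = 1" by (simp add: cmod_def)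
  have "descent_direction \<theta> ?d"
    by (rule descent_direction_from_vertex[OF n]) (use True in \<open>auto simp: power2_eq_square\<close>)
  then show thesis using that[of ?d] by simp
next
  case False
  then have t0: "\<theta> > 0" using th by simp
  define S C where "S = sin (\<theta> / 2)" and "C = cos (\<theta> / 2)"
  define d where "d = Complex (- S) C"
  have S: "S > 0" unfolding S_def using t0 th by (intro sin_gt_zero) auto
  have C: "C > 0" unfolding C_def using t0 th by (intro cos_gt_zero) auto
  have SC: "S\<^sup>2 + C\<^sup>2 = 1" by (simp add: S_def C_def)
  have ct: "cos \<theta> = C\<^sup>2 - S\<^sup>2" using cos_double[of "\<theta> / 2"] by (simp add: S_def C_def)
  have st: "sin \<theta> = 2 * S * C" using sin_double[of "\<theta> / 2"] by (simp add: S_def C_def)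
  have nd: "norm d = 1" using SC by (simp add: d_def cmod_def)
  have d2: "Re (d\<^sup>2) = - cos \<theta>" unfolding ct by (simp add: d_def power2_eq_square)
  \<comment> \<open>The length of the chord from \<open>1\<close> to the saddle point.\<close>
  define vs where "vs = 2 * S"
  have vs: "vs > 0" using S by (simp add: vs_def)
  have z: "1 + of_real vs * d = exp (\<i> * of_real \<theta>)"
  proof (rule complex_eqI)
    show "Re (1 + of_real vs * d) = Re (exp (\<i> * of_real \<theta>))"
      using SC by (simp add: vs_def d_def ct Re_exp power2_eq_square algebra_simps)
    show "Im (1 + of_real vs * d) = Im (exp (\<i> * of_real \<theta>))"
      by (simp add: vs_def d_def st Im_exp)
  qed
  have Lnz: "Ln (1 + of_real vs * d) = \<i> * of_real \<theta>"
    unfolding z by (rule Ln_exp) (use t0 th in auto)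
  have s_vs: "leg_slope \<theta> d vs = 0" unfolding leg_slope_def Lnz by simp
  have e_vs: "leg_exponent \<theta> d vs = - cos \<theta>"
    unfolding leg_exponent_def Lnz unfolding z by (simp add: Re_exp)
  have Imd: "Im d \<noteq> 0" "Im d > 0" "Re d < 0" using S C by (auto simp: d_def)
  have "vs * Re d = - (2 * S\<^sup>2)" by (simp add: vs_def d_def power2_eq_square)
  then have conc: "Re (d\<^sup>2) + vs * Re d \<le> 0" unfolding d2 ct using SC by (simp add: power2_eq_square)
  obtain \<kappa> where k: "\<kappa> > 0"
    "\<And>v. v \<ge> vs \<Longrightarrow> leg_exponent \<theta> d v \<le> leg_exponent \<theta> d vs - \<kappa> * max 0 (v - (vs + 1))"
    using leg_decay[OF nd Imd(1,3) less_imp_le[OF vs] _ conc, of \<theta>] s_vs by auto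
  have slope_nonneg: "leg_slope \<theta> d v \<ge> 0" if v: "0 \<le> v" "v \<le> vs" for v
  proof (cases "Re (d\<^sup>2) + v * Re d \<ge> 0")
    case True
    have "leg_slope \<theta> d 0 \<le> leg_slope \<theta> d v"
    proof (rule DERIV_nonneg_imp_nondecreasing[OF v(1)])
      fix x assume x: "0 \<le> x" "x \<le> v"
      have "v * Re d \<le> x * Re d" using x Imd by (intro mult_right_mono_neg) auto
      then have "Re (d\<^sup>2) + x * Re d \<ge> 0" using True by linarith
      then show "\<exists>y. DERIV (leg_slope \<theta> d) x :> y \<and> 0 \<le> y"
        using leg_slope_deriv[OF Imd(1) x(1) nd, of \<theta>]
        by (intro exI[of _ "(Re (d\<^sup>2) + x * Re d) / (norm (1 + of_real x * d))\<^sup>2"]) auto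
    qed
    moreover have "leg_slope \<theta> d 0 \<ge> 0" using t0 Imd by (simp add: leg_slope_def)
    ultimately show ?thesis by linarith
  next
    case False
    have "leg_slope \<theta> d vs \<le> leg_slope \<theta> d v"
    proof (rule DERIV_nonpos_imp_nonincreasing[OF v(2)])
      fix x assume x: "v \<le> x" "x \<le> vs"
      have "x * Re d \<le> v * Re d" using x Imd by (intro mult_right_mono_neg) auto
      then have "Re (d\<^sup>2) + x * Re d \<le> 0" using False by linarith
      then show "\<exists>y. DERIV (leg_slope \<theta> d) x :> y \<and> y \<le> 0"
        using leg_slope_deriv[OF Imd(1) _ nd, of x \<theta>] x v
        by (intro exI[of _ "(Re (d\<^sup>2) + x * Re d) / (norm (1 + of_real x * d))\<^sup>2"])
          (auto intro: divide_nonpos_nonneg)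
    qed
    then show ?thesis using s_vs by simp
  qed
  have before: "leg_exponent \<theta> d v \<le> - cos \<theta>" if v: "0 \<le> v" "v \<le> vs" for v
  proof -
    have "leg_exponent \<theta> d v \<le> leg_exponent \<theta> d vs"
    proof (rule DERIV_nonneg_imp_nondecreasing[OF v(2)])
      fix x assume "v \<le> x" "x \<le> vs"
      then show "\<exists>y. DERIV (leg_exponent \<theta> d) x :> y \<and> 0 \<le> y"
        using leg_exponent_deriv[OF Imd(1), of x \<theta>] slope_nonneg[of x] v
        by (intro exI[of _ "leg_slope \<theta> d x"]) auto
    qed
    then show ?thesis by (simp add: e_vs)
  qed
  have "leg_exponent \<theta> d v \<le> - cos \<theta> - \<kappa> * max 0 (v - (vs + 1))" if "v \<ge> 0" for v
  proof (cases "v \<le> vs")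
    case True
    then show ?thesis using before[OF that] by simp
  next
    case False
    then show ?thesis using k(2)[of v] e_vs by simp
  qed
  then have "descent_direction \<theta> d"
    unfolding descent_direction_def using k(1) vs nd Imd by (intro conjI exI[of _ \<kappa>] exI[of _ "vs + 1"]) auto
  then show thesis using that Imd by blast
qed

text \<open>The line through \<open>1\<close> with unit direction \<open>d\<close> has distance \<open>|Im d|\<close> from the origin, and along the ray
  the cosine of the argument stays above its limit \<open>Re d\<close>.\<close>

lemma leg_geometry:
  assumes d: "norm d = 1" "Re d < 0" and v: "v \<ge> 0"
  shows "norm (1 + of_real v * d) \<ge> \<bar>Im d\<bar>" "norm (1 + of_real v * d) \<le> 1 + v"
    "Re (1 + of_real v * d) \<ge> - (- Re d) * norm (1 + of_real v * d)"
proof -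
  define c where "c = - Re d"
  have c: "c > 0" using d by (simp add: c_def)
  have dd: "c\<^sup>2 + (Im d)\<^sup>2 = 1" using d(1) by (simp add: c_def cmod_def)
  then have c1: "c\<^sup>2 \<le> 1" by (metis le_add_same_cancel1 zero_le_power2)
  have N: "(norm (1 + of_real v * d))\<^sup>2 = 1 - 2 * c * v + v\<^sup>2"
  proof -
    have "(norm (1 + of_real v * d))\<^sup>2 = (1 - v * c)\<^sup>2 + (v * Im d)\<^sup>2"
      by (simp add: cmod_power2 c_def)
    also have "\<dots> = 1 - 2 * c * v + v\<^sup>2 * (c\<^sup>2 + (Im d)\<^sup>2)"
      by (simp add: power2_eq_square algebra_simps)
    finally show ?thesis by (simp add: dd)
  qed
  have "(norm (1 + of_real v * d))\<^sup>2 = (Im d)\<^sup>2 + (v - c)\<^sup>2"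
    unfolding N using dd by (simp add: power2_eq_square algebra_simps)
  then have "\<bar>Im d\<bar>\<^sup>2 \<le> (norm (1 + of_real v * d))\<^sup>2" by simp
  then show "norm (1 + of_real v * d) \<ge> \<bar>Im d\<bar>"
    by (rule power2_le_imp_le) simp
  have "norm (1 + of_real v * d) \<le> norm (1::complex) + norm (of_real v * d)" by (rule norm_triangle_ineq)
  then show "norm (1 + of_real v * d) \<le> 1 + v" using d v by (simp add: norm_mult)
  have "c * v - 1 \<le> c * norm (1 + of_real v * d)"
  proof (cases "c * v \<le> 1")
    case True
    moreover have "0 \<le> c * norm (1 + of_real v * d)" using c by simp
    ultimately show ?thesis by linarith
  next
    case False
    have "0 \<le> (1 - c\<^sup>2) * (2 * (c * v) - 1)" using False c1 by (intro mult_nonneg_nonneg) auto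
    then have "(c * v - 1)\<^sup>2 \<le> c\<^sup>2 * (1 - 2 * c * v + v\<^sup>2)"
      by (simp add: power2_eq_square algebra_simps)
    also have "\<dots> = (c * norm (1 + of_real v * d))\<^sup>2" by (simp add: N power_mult_distrib)
    finally show ?thesis by (rule power2_le_imp_le) (use c in simp)
  qed
  then show "Re (1 + of_real v * d) \<ge> - (- Re d) * norm (1 + of_real v * d)"
    by (simp add: c_def algebra_simps)
qed

text \<open>Comparison with \<open>1 / (1 + v)\<^sup>2\<close>, whose integral is bounded independently of the length \<open>V\<close> of the leg.\<close>

lemma contour_integral_leg_bound:
  fixes d :: complex
  assumes d: "norm d = 1" and \<rho>: "\<rho> \<ge> 0" and V: "V \<ge> 0" and K: "K \<ge> 0"
    and cont: "continuous_on (closed_segment (of_real \<rho>) (of_real \<rho> + of_real (\<rho> * V) * d)) F"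
    and bound: "\<And>v. 0 \<le> v \<Longrightarrow> v \<le> V \<Longrightarrow> norm (F (of_real \<rho> * (1 + of_real v * d))) \<le> K / (1 + v)\<^sup>2"
  shows "norm (contour_integral (linepath (of_real \<rho>) (of_real \<rho> + of_real (\<rho> * V) * d)) F) \<le> \<rho> * K"
proof -
  let ?a = "complex_of_real \<rho>" and ?b = "of_real \<rho> + of_real (\<rho> * V) * d"
  let ?f = "\<lambda>x. F (linepath ?a ?b x) * (?b - ?a)"
  let ?g = "\<lambda>x. \<rho> * K * V / (1 + V * x)\<^sup>2"
  have lp: "linepath ?a ?b x = of_real \<rho> * (1 + of_real (V * x) * d)" for x
    by (simp add: linepath_def scaleR_conv_of_real algebra_simps)
  have gint: "(?g has_integral (- \<rho> * K / (1 + V * 1)) - (- \<rho> * K / (1 + V * 0))) {0..1}"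
  proof (rule fundamental_theorem_of_calculus)
    fix x :: real assume x: "x \<in> {0..1}"
    have p: "0 < 1 + V * x" using x V by (intro add_pos_nonneg mult_nonneg_nonneg) auto
    have "((\<lambda>x. - \<rho> * K / (1 + V * x)) has_real_derivative ?g x) (at x within {0..1})"
      using p by (auto intro!: derivative_eq_intros simp: power2_eq_square field_simps)
    then show "((\<lambda>x. - \<rho> * K / (1 + V * x)) has_vector_derivative ?g x) (at x within {0..1})"
      by (simp add: has_real_derivative_iff_has_vector_derivative)
  qed simp
  have fint: "?f integrable_on {0..1}"
  proof (rule integrable_continuous_real)
    have "continuous_on {0..1} (\<lambda>x. F (linepath ?a ?b x))"
      using cont by (intro continuous_on_compose2[OF cont]) (auto simp: linepath_in_path intro!: continuous_intros)
    then show "continuous_on {0..1} ?f" by (intro continuous_intros)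
  qed
  have "norm (integral {0..1} ?f) \<le> integral {0..1} ?g"
  proof (rule integral_norm_bound_integral[OF fint])
    show "?g integrable_on {0..1}" using gint by blast
    fix x :: real assume x: "x \<in> {0..1}"
    have vx: "0 \<le> V * x" "V * x \<le> V" using x V by (auto simp: mult_left_le)
    have "norm (?f x) = norm (F (of_real \<rho> * (1 + of_real (V * x) * d))) * (\<rho> * V)"
      unfolding lp using d \<rho> V by (simp add: norm_mult)
    also have "\<dots> \<le> K / (1 + V * x)\<^sup>2 * (\<rho> * V)"
      using \<rho> V bound[OF vx] by (intro mult_right_mono) auto
    finally show "norm (?f x) \<le> ?g x" by (simp add: mult_ac)
  qed
  also have "integral {0..1} ?g = (- \<rho> * K / (1 + V * 1)) - (- \<rho> * K / (1 + V * 0))"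
    using gint by (rule integral_unique)
  also have "\<dots> \<le> \<rho> * K" using \<rho> K V by simp
  finally show ?thesis
    by (simp add: contour_integral_integral)
qed

lemma poly_exp_decay_bounded:
  fixes p \<kappa> v1 :: real
  assumes "\<kappa> > 0"
  obtains D where "D > 0" "\<And>v. v \<ge> 0 \<Longrightarrow> (1 + v) powr p * exp (- \<kappa> * max 0 (v - v1)) \<le> D"
proof -
  define q where "q = \<bar>p\<bar> + 1"
  have q: "q > 0" "p \<le> q" by (auto simp: q_def)
  have "((\<lambda>v::real. (1 + v) powr q * exp (- \<kappa> * (v - v1))) \<longlongrightarrow> 0) at_top"
    using assms q by real_asymp
  then have "\<forall>\<^sub>F v in at_top. (1 + v) powr q * exp (- \<kappa> * (v - v1)) < 1"
    by (rule order_tendstoD) simp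
  then obtain v2 where v2: "\<And>v. v \<ge> v2 \<Longrightarrow> (1 + v) powr q * exp (- \<kappa> * (v - v1)) < 1"
    unfolding eventually_at_top_linorder by blast
  define v3 where "v3 = max 0 v2"
  show thesis
  proof (rule that[of "max 1 ((1 + v3) powr q)"])
    fix v :: real assume v: "v \<ge> 0"
    have pq: "(1 + v) powr p \<le> (1 + v) powr q" using v q by (intro powr_mono) auto
    show "(1 + v) powr p * exp (- \<kappa> * max 0 (v - v1)) \<le> max 1 ((1 + v3) powr q)"
    proof (cases "v \<ge> v2")
      case True
      have "(1 + v) powr p * exp (- \<kappa> * max 0 (v - v1)) \<le> (1 + v) powr q * exp (- \<kappa> * (v - v1))"
        using pq assms by (intro mult_mono) auto
      then show ?thesis using v2[OF True] by simp
    next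
      case False
      have "(1 + v) powr p * exp (- \<kappa> * max 0 (v - v1)) \<le> (1 + v) powr q * 1"
        using pq assms by (intro mult_mono) auto
      also have "\<dots> \<le> (1 + v3) powr q" using False v q by (auto simp: v3_def intro!: powr_mono2)
      finally show ?thesis by simp
    qed
  qed simp
qed

text \<open>In units of \<open>\<rho>\<close> Stirling's main term is \<open>exp (n \<rho> leg_exponent)\<close> times powers of \<open>u\<close>.  Far out the linear
  decay of the exponent absorbs these powers, so up to a power of \<open>\<rho>\<close> the value at the saddle point
  bounds the integral, uniformly in the length of the leg.\<close>

theorem descent_leg_bound:
  fixes \<beta> d :: complex and n :: nat
  assumes d: "descent_direction \<theta> d" and n: "n > 0" and C: "C \<ge> 0"
  obtains K where "K > 0"
    "\<And>\<rho> V F. \<rho> \<ge> 1 \<Longrightarrow> V \<ge> 0 \<Longrightarrow>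
       continuous_on (closed_segment (of_real \<rho>) (of_real \<rho> + of_real (\<rho> * V) * d)) F \<Longrightarrow>
       (\<And>u v. 0 \<le> v \<Longrightarrow> u = of_real \<rho> * (1 + of_real v * d) \<Longrightarrow>
          norm (F u) \<le> C / (norm u)\<^sup>2 * norm (exp ((of_nat n * u + \<beta>) * Ln u - of_nat n * u
             - of_nat n * (of_real (ln \<rho>) + \<i> * of_real \<theta>) * u))) \<Longrightarrow>
       norm (contour_integral (linepath (of_real \<rho>) (of_real \<rho> + of_real (\<rho> * V) * d)) F)
         \<le> K * \<rho> powr (Re \<beta> - 1) * exp (- (real n * \<rho> * cos \<theta>))"
proof -
  have nd: "norm d = 1" "Re d < 0" "Im d \<noteq> 0" using d by (auto simp: descent_direction_def)
  obtain \<kappa> v1 where k: "\<kappa> > 0" "v1 \<ge> 0"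
    "\<And>v. v \<ge> 0 \<Longrightarrow> leg_exponent \<theta> d v \<le> - cos \<theta> - \<kappa> * max 0 (v - v1)"
    using d by (auto simp: descent_direction_def)
  \<comment> \<open>The factor \<open>1 / u\<^sup>2\<close> lowers the power of \<open>u\<close> by two; the length of the leg restores one of them.\<close>
  define q where "q = Re \<beta> - 2"
  define D where "D = \<bar>Im d\<bar> powr (- \<bar>q\<bar>)"
  have D: "D \<ge> 1"
  proof -
    have "\<bar>Im d\<bar> \<le> 1" using abs_Im_le_cmod[of d] nd by simp
    then have "\<bar>Im d\<bar> powr \<bar>q\<bar> \<le> 1" using nd powr_le1[of "\<bar>q\<bar>" "\<bar>Im d\<bar>"] by simp
    moreover have "0 < \<bar>Im d\<bar> powr \<bar>q\<bar>" using nd by simp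
    ultimately show ?thesis unfolding D_def powr_minus by (simp add: one_le_inverse)
  qed
  obtain E where E: "E > 0" "\<And>v. v \<ge> 0 \<Longrightarrow> (1 + v) powr (\<bar>q\<bar> + 2) * exp (- \<kappa> * max 0 (v - v1)) \<le> E"
    using poly_exp_decay_bounded[OF k(1)] by blast
  define K where "K = C * exp (pi * \<bar>Im \<beta>\<bar>) * D * E + 1"
  have K0: "K > 0" unfolding K_def using C D E by (intro add_nonneg_pos mult_nonneg_nonneg) auto
  show thesis
  proof (rule that[OF K0])
    fix \<rho> V :: real and F :: "complex \<Rightarrow> complex"
    assume \<rho>: "\<rho> \<ge> 1" and V: "V \<ge> 0"
      and cont: "continuous_on (closed_segment (of_real \<rho>) (of_real \<rho> + of_real (\<rho> * V) * d)) F"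
      and F: "\<And>u v. 0 \<le> v \<Longrightarrow> u = of_real \<rho> * (1 + of_real v * d) \<Longrightarrow>
          norm (F u) \<le> C / (norm u)\<^sup>2 * norm (exp ((of_nat n * u + \<beta>) * Ln u - of_nat n * u
             - of_nat n * (of_real (ln \<rho>) + \<i> * of_real \<theta>) * u))"
    define KK where "KK = K * \<rho> powr q * exp (- (real n * \<rho> * cos \<theta>))"
    have KK: "KK \<ge> 0" using K0 by (simp add: KK_def)
    have "norm (contour_integral (linepath (of_real \<rho>) (of_real \<rho> + of_real (\<rho> * V) * d)) F) \<le> \<rho> * KK"
    proof (rule contour_integral_leg_bound[OF nd(1) _ V KK cont])
      show "\<rho> \<ge> 0" using \<rho> by simp
      fix v :: real assume v: "0 \<le> v" "v \<le> V"
      define \<zeta> where "\<zeta> = 1 + of_real v * d"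
      define u where "u = of_real \<rho> * \<zeta>"
      have zn: "\<zeta> \<notin> \<real>\<^sub>\<le>\<^sub>0" unfolding \<zeta>_def by (rule leg_not_nonpos[OF nd(3) v(1)])
      then have z0: "\<zeta> \<noteq> 0" by auto
      have nz: "norm \<zeta> \<ge> \<bar>Im d\<bar>" "norm \<zeta> \<le> 1 + v" using leg_geometry[OF nd(1,2) v(1)] by (auto simp: \<zeta>_def)
      have nu: "norm u = \<rho> * norm \<zeta>" using \<rho> by (simp add: u_def norm_mult)
      have Lnu: "Ln u = of_real (ln \<rho>) + Ln \<zeta>"
        unfolding u_def using Ln_times_of_real[of \<rho> \<zeta>] Ln_of_real[of \<rho>] \<rho> z0 by simp
      have split: "(of_nat n * u + \<beta>) * Ln u - of_nat n * u - of_nat n * (of_real (ln \<rho>) + \<i> * of_real \<theta>) * u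
         = of_real (real n * \<rho>) * (\<zeta> * (Ln \<zeta> - \<i> * of_real \<theta>) - \<zeta>) + \<beta> * (of_real (ln \<rho>) + Ln \<zeta>)"
        unfolding Lnu by (simp add: u_def algebra_simps)
      have e1: "norm (exp (of_real (real n * \<rho>) * (\<zeta> * (Ln \<zeta> - \<i> * of_real \<theta>) - \<zeta>)))
          \<le> exp (- (real n * \<rho> * cos \<theta>)) * exp (- \<kappa> * max 0 (v - v1))"
      proof -
        have "Re (of_real (real n * \<rho>) * (\<zeta> * (Ln \<zeta> - \<i> * of_real \<theta>) - \<zeta>)) = real n * \<rho> * leg_exponent \<theta> d v"
          unfolding leg_exponent_def \<zeta>_def by simp
        also have "\<dots> \<le> real n * \<rho> * (- cos \<theta> - \<kappa> * max 0 (v - v1))"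
          using \<rho> k(3)[OF v(1)] by (intro mult_left_mono) auto
        also have "\<dots> = - (real n * \<rho> * cos \<theta>) - (real n * \<rho>) * (\<kappa> * max 0 (v - v1))"
          by (simp add: algebra_simps)
        also have "\<dots> \<le> - (real n * \<rho> * cos \<theta>) - 1 * (\<kappa> * max 0 (v - v1))"
        proof (intro diff_left_mono mult_right_mono)
          have "1 * 1 \<le> real n * \<rho>" using \<rho> n by (intro mult_mono) auto
          then show "1 \<le> real n * \<rho>" by simp
        qed (use k in auto)
        finally show ?thesis by (simp add: norm_exp_eq_Re exp_add[symmetric])
      qed
      have e2: "norm (exp (\<beta> * (of_real (ln \<rho>) + Ln \<zeta>))) \<le> \<rho> powr (Re \<beta>) * norm \<zeta> powr (Re \<beta>) * exp (pi * \<bar>Im \<beta>\<bar>)"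
      proof -
        have "Re (\<beta> * (of_real (ln \<rho>) + Ln \<zeta>)) = Re \<beta> * ln \<rho> + Re \<beta> * ln (norm \<zeta>) - Im \<beta> * Im (Ln \<zeta>)"
          using z0 by (simp add: algebra_simps)
        moreover have "- (Im \<beta> * Im (Ln \<zeta>)) \<le> pi * \<bar>Im \<beta>\<bar>"
        proof -
          have "\<bar>Im (Ln \<zeta>)\<bar> \<le> pi" using mpi_less_Im_Ln[OF z0] Im_Ln_le_pi[OF z0] by auto
          then have "\<bar>Im \<beta> * Im (Ln \<zeta>)\<bar> \<le> \<bar>Im \<beta>\<bar> * pi" unfolding abs_mult by (intro mult_left_mono) auto
          then show ?thesis by (simp add: mult.commute)
        qed
        ultimately have "norm (exp (\<beta> * (of_real (ln \<rho>) + Ln \<zeta>))) \<le> exp (Re \<beta> * ln \<rho> + Re \<beta> * ln (norm \<zeta>) + pi * \<bar>Im \<beta>\<bar>)"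
          by (simp add: norm_exp_eq_Re)
        also have "\<dots> = \<rho> powr (Re \<beta>) * norm \<zeta> powr (Re \<beta>) * exp (pi * \<bar>Im \<beta>\<bar>)"
          using \<rho> z0 by (simp add: exp_add powr_def)
        finally show ?thesis .
      qed
      have zq: "norm \<zeta> powr q \<le> D * (1 + v) powr \<bar>q\<bar>"
      proof (cases "q \<ge> 0")
        case True
        then have "norm \<zeta> powr q \<le> (1 + v) powr \<bar>q\<bar>" using nz by (auto intro: powr_mono2)
        also have "\<dots> \<le> D * (1 + v) powr \<bar>q\<bar>" using mult_right_mono[OF D, of "(1 + v) powr \<bar>q\<bar>"] by simp
        finally show ?thesis .
      next
        case False
        then have "norm \<zeta> powr q \<le> \<bar>Im d\<bar> powr q" using nz nd by (intro powr_mono2') auto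
        also have "\<bar>Im d\<bar> powr q = D" using False by (simp add: D_def)
        also have "D \<le> D * (1 + v) powr \<bar>q\<bar>"
        proof -
          have "1 \<le> (1 + v) powr \<bar>q\<bar>" using v by (intro ge_one_powr_ge_zero) auto
          then show ?thesis using mult_left_mono[of 1 "(1 + v) powr \<bar>q\<bar>" D] D by simp
        qed
        finally show ?thesis .
      qed
      have z2: "norm \<zeta> powr (Re \<beta>) = norm \<zeta> powr q * (norm \<zeta>)\<^sup>2" "\<rho> powr (Re \<beta>) = \<rho> powr q * \<rho>\<^sup>2"
      proof -
        have p: "x powr (Re \<beta>) = x powr q * x\<^sup>2" if "x > 0" for x :: real
        proof -
          have "x powr (Re \<beta>) = x powr (q + 2)" by (simp add: q_def)
          also have "\<dots> = x powr q * x powr 2" by (rule powr_add)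
          also have "x powr 2 = x\<^sup>2" using that powr_realpow[of x 2] by simp
          finally show ?thesis .
        qed
        show "norm \<zeta> powr (Re \<beta>) = norm \<zeta> powr q * (norm \<zeta>)\<^sup>2" "\<rho> powr (Re \<beta>) = \<rho> powr q * \<rho>\<^sup>2"
          using p z0 \<rho> by auto
      qed
      define X where "X = exp (- (real n * \<rho> * cos \<theta>))"
      define Y where "Y = exp (- \<kappa> * max 0 (v - v1))"
      have XY: "X > 0" "Y > 0" by (auto simp: X_def Y_def)
      have "norm (F u) \<le> C / (norm u)\<^sup>2 * (X * Y * (\<rho> powr (Re \<beta>) * norm \<zeta> powr (Re \<beta>) * exp (pi * \<bar>Im \<beta>\<bar>)))"
      proof -
        have "norm (exp ((of_nat n * u + \<beta>) * Ln u - of_nat n * u - of_nat n * (of_real (ln \<rho>) + \<i> * of_real \<theta>) * u))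
          \<le> X * Y * (\<rho> powr (Re \<beta>) * norm \<zeta> powr (Re \<beta>) * exp (pi * \<bar>Im \<beta>\<bar>))"
          unfolding split exp_add norm_mult X_def Y_def by (intro mult_mono e1 e2) auto
        then have "C / (norm u)\<^sup>2 * norm (exp ((of_nat n * u + \<beta>) * Ln u - of_nat n * u - of_nat n * (of_real (ln \<rho>) + \<i> * of_real \<theta>) * u))
          \<le> C / (norm u)\<^sup>2 * (X * Y * (\<rho> powr (Re \<beta>) * norm \<zeta> powr (Re \<beta>) * exp (pi * \<bar>Im \<beta>\<bar>)))"
          using C by (intro mult_left_mono) auto
        moreover have "norm (F u) \<le> C / (norm u)\<^sup>2 * norm (exp ((of_nat n * u + \<beta>) * Ln u - of_nat n * u
             - of_nat n * (of_real (ln \<rho>) + \<i> * of_real \<theta>) * u))"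
          by (rule F[OF v(1)]) (simp add: u_def \<zeta>_def)
        ultimately show ?thesis by (rule order_trans[rotated])
      qed
      also have "\<dots> = C * exp (pi * \<bar>Im \<beta>\<bar>) * X * \<rho> powr q * (Y * norm \<zeta> powr q)"
        unfolding z2 nu using \<rho> z0 by (simp add: power_mult_distrib)
      also have "\<dots> \<le> C * exp (pi * \<bar>Im \<beta>\<bar>) * X * \<rho> powr q * (Y * (D * (1 + v) powr \<bar>q\<bar>))"
        using C XY zq by (intro mult_left_mono) auto
      also have "Y * (D * (1 + v) powr \<bar>q\<bar>) = D * ((1 + v) powr (\<bar>q\<bar> + 2) * Y) / (1 + v)\<^sup>2"
      proof -
        have "(1 + v) powr (\<bar>q\<bar> + 2) = (1 + v) powr \<bar>q\<bar> * (1 + v)\<^sup>2"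
          using v powr_realpow[of "1 + v" 2] by (simp add: powr_add)
        then show ?thesis using v by simp
      qed
      also have "C * exp (pi * \<bar>Im \<beta>\<bar>) * X * \<rho> powr q * (D * ((1 + v) powr (\<bar>q\<bar> + 2) * Y) / (1 + v)\<^sup>2)
          \<le> C * exp (pi * \<bar>Im \<beta>\<bar>) * X * \<rho> powr q * (D * E / (1 + v)\<^sup>2)"
        using C XY D E(2)[OF v(1)] by (intro mult_left_mono divide_right_mono) (auto simp: Y_def)
      also have "\<dots> = (C * exp (pi * \<bar>Im \<beta>\<bar>) * D * E) * (\<rho> powr q * X) / (1 + v)\<^sup>2" by simp
      also have "\<dots> \<le> K * (\<rho> powr q * X) / (1 + v)\<^sup>2"
        using XY by (intro divide_right_mono mult_right_mono) (auto simp: K_def)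
      finally show "norm (F (of_real \<rho> * (1 + of_real v * d))) \<le> KK / (1 + v)\<^sup>2"
        by (simp add: u_def \<zeta>_def KK_def X_def mult_ac)
    qed
    also have "\<rho> * KK = K * \<rho> powr (Re \<beta> - 1) * exp (- (real n * \<rho> * cos \<theta>))"
    proof -
      have "\<rho> powr (Re \<beta> - 1) = \<rho> powr (q + 1)" by (simp add: q_def)
      also have "\<dots> = \<rho> powr q * \<rho>" using \<rho> by (simp add: powr_add)
      finally show ?thesis by (simp add: KK_def mult_ac)
    qed
    finally show "norm (contour_integral (linepath (of_real \<rho>) (of_real \<rho> + of_real (\<rho> * V) * d)) F)
         \<le> K * \<rho> powr (Re \<beta> - 1) * exp (- (real n * \<rho> * cos \<theta>))" .
  qed
qed

section \<open>Mellin--Barnes integrands and their residues\<close>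

text \<open>Shifting the argument \<open>r + 1\<close> steps to the right writes \<open>\<Gamma>\<close> as a holomorphic function divided by a
  Pochhammer symbol, exactly one factor of which vanishes at \<open>z0\<close>.\<close>

lemma residue_mult_Gamma:
  fixes g :: "complex \<Rightarrow> complex" and \<kappa> b z0 :: complex
  assumes s: "open s" "z0 \<in> s" "g holomorphic_on s" and k: "\<kappa> \<noteq> 0"
    and z0: "\<kappa> * z0 + b = - of_nat r"
  shows "residue (\<lambda>u. g u * Gamma (\<kappa> * u + b)) z0 = g z0 * ((- 1) ^ r / (fact r * \<kappa>))"
proof -
  define s' where "s' = s \<inter> {u. norm (\<kappa> * u + b + of_nat r) < 1/2}"
  have op: "open s'" unfolding s'_def
    by (intro open_Int s open_Collect_less continuous_intros)
  have zs: "z0 \<in> s'" using s z0 by (simp add: s'_def)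
  define h where "h = (\<lambda>u. g u * Gamma (\<kappa> * u + b + of_nat (Suc r)) / (\<kappa> * pochhammer (\<kappa> * u + b) r))"
  have np: "\<kappa> * u + b + of_nat j \<noteq> 0" if "u \<in> s'" "j < r" for u j
  proof
    assume "\<kappa> * u + b + of_nat j = 0"
    then have "\<kappa> * u + b + of_nat r = of_nat r - of_nat j" by (simp add: algebra_simps)
    also have "\<dots> = of_nat (r - j)" using that by simp
    finally have "norm (\<kappa> * u + b + of_nat r) = real (r - j)" by (simp only: norm_of_nat)
    moreover have "real (r - j) \<ge> 1" using that by simp
    ultimately show False using that by (simp add: s'_def)
  qed
  then have poch: "pochhammer (\<kappa> * u + b) r \<noteq> 0" if "u \<in> s'" for u
    using that by (auto simp: pochhammer_prod)
  have Gpos: "\<kappa> * u + b + of_nat (Suc r) \<notin> \<int>\<^sub>\<le>\<^sub>0" if "u \<in> s'" for u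
  proof -
    have "\<bar>Re (\<kappa> * u + b + of_nat r)\<bar> < 1/2"
      using that abs_Re_le_cmod[of "\<kappa> * u + b + of_nat r"] by (auto simp: s'_def)
    moreover have "Re (\<kappa> * u + b + of_nat (Suc r)) = Re (\<kappa> * u + b + of_nat r) + 1" by simp
    ultimately have "Re (\<kappa> * u + b + of_nat (Suc r)) > 0" by linarith
    then show ?thesis by (meson complex_nonpos_Reals_iff nonpos_Ints_subset_nonpos_Reals not_le subsetD)
  qed
  have hol: "h holomorphic_on s'"
  proof -
    have "g holomorphic_on s'" using s by (rule_tac holomorphic_on_subset[of _ s]) (auto simp: s'_def)
    moreover have "(\<lambda>u. Gamma (\<kappa> * u + b + of_nat (Suc r))) holomorphic_on s'"
      using Gpos by (intro holomorphic_intros) auto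
    moreover have "(\<lambda>u. \<kappa> * pochhammer (\<kappa> * u + b) r) holomorphic_on s'"
      unfolding pochhammer_prod by (intro holomorphic_intros)
    ultimately show ?thesis unfolding h_def
      by (intro holomorphic_on_divide[OF holomorphic_on_mult]) (use poch k in simp_all)
  qed
  have "\<forall>\<^sub>F u in at z0. g u * Gamma (\<kappa> * u + b) = h u / (u - z0)"
  proof -
    have "\<forall>\<^sub>F u in at z0. u \<in> s' - {z0}"
      by (rule eventually_at_in_open[OF op zs])
    then show ?thesis
    proof eventually_elim
      case (elim u)
      define w where "w = \<kappa> * u + b"
      have wr: "w + of_nat r = \<kappa> * (u - z0)"
      proof -
        have "\<kappa> * z0 = - of_nat r - b" using z0 by (simp add: eq_diff_eq)
        then show ?thesis by (simp add: w_def right_diff_distrib)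
      qed
      have "w + of_nat r \<noteq> 0" unfolding wr using elim k by simp
      then have pw: "pochhammer w (Suc r) \<noteq> 0" using poch[of u] elim by (simp add: pochhammer_Suc w_def)
      have "w \<notin> \<int>\<^sub>\<le>\<^sub>0"
      proof
        assume "w \<in> \<int>\<^sub>\<le>\<^sub>0"
        then obtain j where j: "w = - of_nat j" by (elim nonpos_Ints_cases')
        have "j \<le> r"
        proof (rule ccontr)
          assume "\<not> j \<le> r"
          then have "w + of_nat (Suc r) = - of_nat (j - Suc r)" using j by (simp add: of_nat_diff algebra_simps)
          then have "w + of_nat (Suc r) \<in> \<int>\<^sub>\<le>\<^sub>0" by (metis minus_of_nat_in_nonpos_Ints)
          then show False using Gpos[of u] elim by (simp add: w_def)
        qed
        then have "pochhammer w (Suc r) = 0" using j by (auto simp: pochhammer_prod)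
        then show False using pw by simp
      qed
      from pochhammer_Gamma[OF this, of "Suc r"] have "Gamma w = Gamma (w + of_nat (Suc r)) / pochhammer w (Suc r)"
        using pw Gamma_nonzero[OF \<open>w \<notin> \<int>\<^sub>\<le>\<^sub>0\<close>] by (simp add: field_simps)
      then show ?case unfolding h_def w_def[symmetric] pochhammer_Suc wr by simp
    qed
  qed
  then have "residue (\<lambda>u. g u * Gamma (\<kappa> * u + b)) z0 = residue (\<lambda>u. h u / (u - z0)) z0"
    by (rule residue_cong) simp
  also have "\<dots> = h z0" by (rule residue_simple[OF op zs hol])
  also have "\<dots> = g z0 * ((- 1) ^ r / (fact r * \<kappa>))"
  proof -
    have "- of_nat r + of_nat (Suc r) = (1 :: complex)" by simp
    then have "h z0 = g z0 * Gamma 1 / (\<kappa> * ((- 1) ^ r * fact r))"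
      unfolding h_def z0 pochhammer_same by (simp only:)
    moreover have "(- 1 :: complex) ^ r = 1 \<or> (- 1 :: complex) ^ r = - 1" by (cases "even r") auto
    ultimately show ?thesis by auto
  qed
  finally show ?thesis .
qed

text \<open>In Euler's limit formula every factor satisfies the corresponding inequality.\<close>

lemma norm_Gamma_le:
  fixes z :: complex
  assumes "Re z > 0"
  shows "norm (Gamma z) \<le> Gamma (Re z)"
proof (rule LIMSEQ_le[OF tendsto_norm[OF Gamma_series_LIMSEQ] Gamma_series_LIMSEQ])
  have "norm (Gamma_series z n) \<le> Gamma_series (Re z) n" for n
  proof -
    have "pochhammer (Re z) (n + 1) \<le> norm (pochhammer z (n + 1))"
    proof -
      have "(\<Prod>i = 0..<n + 1. Re z + of_nat i) \<le> (\<Prod>i = 0..<n + 1. norm (z + of_nat i))"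
        using assms by (intro prod_mono) (auto intro!: order_trans[OF _ complex_Re_le_cmod])
      then show ?thesis by (simp only: pochhammer_prod prod_norm)
    qed
    moreover have "pochhammer (Re z) (n + 1) > 0" using assms by (rule pochhammer_pos)
    ultimately show ?thesis
      unfolding Gamma_series_def norm_divide norm_mult norm_exp_eq_Re
      by (intro frac_le) auto
  qed
  then show "\<exists>N. \<forall>n\<ge>N. norm (Gamma_series z n) \<le> Gamma_series (Re z) n" by blast
qed

text \<open>After a shift into the right half-plane \<open>\<Gamma>\<close> is bounded on vertical lines, and the factors of the
  shift are bounded below by their real parts.\<close>

lemma norm_Gamma_vertical_bound:
  fixes y :: real
  assumes "y \<notin> \<nat>"
  obtains C where "C \<ge> 1" "\<And>v :: complex. Re v = - y \<Longrightarrow> norm (Gamma v) \<le> C"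
proof -
  obtain N :: nat where N: "real N > y" using reals_Archimedean2 by blast
  define P where "P = (\<Prod>j = 0..<N. \<bar>real j - y\<bar>)"
  have P: "P > 0" unfolding P_def
  proof (rule prod_pos)
    fix j assume "j \<in> {0..<N}"
    have "real j \<noteq> y" using assms by auto
    then show "0 < \<bar>real j - y\<bar>" by simp
  qed
  show thesis
  proof (rule that[of "max 1 (Gamma (real N - y) / P)"])
    fix v :: complex assume v: "Re v = - y"
    have "v \<notin> \<int>\<^sub>\<le>\<^sub>0"
    proof
      assume "v \<in> \<int>\<^sub>\<le>\<^sub>0"
      then obtain j where "v = - of_nat j" by (elim nonpos_Ints_cases')
      then have "y = real j" using v by simp
      then show False using assms by simp
    qed
    from pochhammer_Gamma[OF this, of N] Gamma_nonzero[OF this]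
    have eq: "Gamma (v + of_nat N) = pochhammer v N * Gamma v" by simp
    have "norm (Gamma (v + of_nat N)) \<le> Gamma (Re (v + of_nat N))" using v N by (intro norm_Gamma_le) simp
    then have "norm (pochhammer v N) * norm (Gamma v) \<le> Gamma (real N - y)"
      unfolding eq norm_mult using v by simp
    moreover have "P \<le> norm (pochhammer v N)"
      unfolding P_def pochhammer_prod prod_norm[symmetric]
    proof (rule prod_mono)
      fix j assume "j \<in> {0..<N}"
      show "0 \<le> \<bar>real j - y\<bar> \<and> \<bar>real j - y\<bar> \<le> norm (v + of_nat j)"
        using abs_Re_le_cmod[of "v + of_nat j"] v by simp
    qed
    ultimately have "P * norm (Gamma v) \<le> Gamma (real N - y)"
      by (meson mult_right_mono norm_ge_zero order_trans)
    then show "norm (Gamma v) \<le> max 1 (Gamma (real N - y) / P)"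
      using P by (simp add: pos_le_divide_eq mult.commute le_max_iff_disj)
  qed simp
qed

text \<open>The \<open>j\<close>-th step to the left divides by a number of modulus at least \<open>j\<close>.\<close>

lemma norm_Gamma_shift_left:
  fixes v :: complex
  assumes "Re v \<le> 0" "v \<notin> \<int>"
  shows "norm (Gamma (v - of_nat m)) \<le> norm (Gamma v) / fact m"
proof (induction m)
  case (Suc m)
  have "v - of_nat (Suc m) \<notin> \<int>\<^sub>\<le>\<^sub>0"
  proof
    assume "v - of_nat (Suc m) \<in> \<int>\<^sub>\<le>\<^sub>0"
    then have "(v - of_nat (Suc m)) + of_nat (Suc m) \<in> \<int>" by (meson Ints_add Ints_of_nat nonpos_Ints_Int)
    then show False using assms by simp
  qed
  from Gamma_plus1[OF this] have "Gamma (v - of_nat m) = (v - of_nat (Suc m)) * Gamma (v - of_nat (Suc m))"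
    by (simp add: algebra_simps)
  then have "norm (Gamma (v - of_nat m)) = norm (v - of_nat (Suc m)) * norm (Gamma (v - of_nat (Suc m)))"
    by (simp add: norm_mult)
  moreover have "real (Suc m) \<le> norm (v - of_nat (Suc m))"
    using abs_Re_le_cmod[of "v - of_nat (Suc m)"] assms(1) by simp
  ultimately have "real (Suc m) * norm (Gamma (v - of_nat (Suc m))) \<le> norm (Gamma v) / fact m"
    using Suc by (metis mult_right_mono norm_ge_zero order_trans)
  then have "norm (Gamma (v - of_nat (Suc m))) \<le> norm (Gamma v) / fact m / real (Suc m)"
    by (subst pos_le_divide_eq) (simp_all only: mult.commute of_nat_0_less_iff zero_less_Suc)
  then show ?case by (simp add: mult.commute)
qed simp

text \<open>The dilation \<open>\<kappa>\<close> covers at once the product of \<open>n\<close> Gamma functions (\<open>\<kappa> = 1\<close>) and its model, a single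
  Gamma function of \<open>n u\<close> (\<open>\<kappa> = n\<close> with a one-element index set).\<close>

definition barnes :: "'a set \<Rightarrow> nat \<Rightarrow> complex \<Rightarrow> ('a \<Rightarrow> complex) \<Rightarrow> complex \<Rightarrow> complex" where
  "barnes A \<kappa> \<mu> b u = exp (- \<mu> * u) * (\<Prod>a\<in>A. Gamma (of_nat \<kappa> * u + b a))"

definition barnes_pole :: "nat \<Rightarrow> ('a \<Rightarrow> complex) \<Rightarrow> 'a \<times> nat \<Rightarrow> complex" where
  "barnes_pole \<kappa> b = (\<lambda>(a, r). - (b a + of_nat r) / of_nat \<kappa>)"

definition barnes_residue :: "'a set \<Rightarrow> nat \<Rightarrow> complex \<Rightarrow> ('a \<Rightarrow> complex) \<Rightarrow> 'a \<Rightarrow> nat \<Rightarrow> complex" where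
  "barnes_residue A \<kappa> \<mu> b a r = exp (\<mu> * (b a + of_nat r) / of_nat \<kappa>) *
     ((- 1) ^ r / (fact r * of_nat \<kappa>)) * (\<Prod>a'\<in>A - {a}. Gamma (b a' - b a - of_nat r))"

lemma barnes_pole_iff:
  assumes "\<kappa> > 0"
  shows "of_nat \<kappa> * u + b a \<in> \<int>\<^sub>\<le>\<^sub>0 \<longleftrightarrow> (\<exists>r. u = barnes_pole \<kappa> b (a, r))"
proof -
  have k: "of_nat \<kappa> \<noteq> (0::complex)" using assms by simp
  have "of_nat \<kappa> * u + b a \<in> \<int>\<^sub>\<le>\<^sub>0 \<longleftrightarrow> (\<exists>r::nat. of_nat \<kappa> * u + b a = - of_nat r)"
    by (auto elim: nonpos_Ints_cases')
  moreover have "(of_nat \<kappa> * u + b a = - of_nat r) \<longleftrightarrow> u = barnes_pole \<kappa> b (a, r)" for r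
  proof -
    have "of_nat \<kappa> * u + b a = - of_nat r \<longleftrightarrow> of_nat \<kappa> * u = - (b a + of_nat r)"
      by (metis add.commute add_diff_cancel_left' diff_minus_eq_add minus_add_distrib uminus_add_conv_diff)
    also have "\<dots> \<longleftrightarrow> u = - (b a + of_nat r) / of_nat \<kappa>"
      using k nonzero_eq_divide_eq[OF k, of u "- (b a + of_nat r)"] by (simp add: mult.commute)
    finally show ?thesis by (simp add: barnes_pole_def)
  qed
  ultimately show ?thesis by simp
qed

lemma barnes_holomorphic:
  assumes "\<kappa> > 0" "finite A"
  shows "barnes A \<kappa> \<mu> b holomorphic_on (- (barnes_pole \<kappa> b ` (A \<times> UNIV)))"
proof -
  have "of_nat \<kappa> * u + b a \<notin> \<int>\<^sub>\<le>\<^sub>0" if "u \<notin> barnes_pole \<kappa> b ` (A \<times> UNIV)" "a \<in> A" for u a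
    using that unfolding barnes_pole_iff[OF assms(1)] by auto
  then show ?thesis
    unfolding barnes_def[abs_def] by (intro holomorphic_intros) auto
qed

lemma residue_barnes:
  assumes k: "\<kappa> > 0" and A: "finite A" "a \<in> A"
    and b: "\<And>a'. a' \<in> A \<Longrightarrow> a' \<noteq> a \<Longrightarrow> b a' - b a \<notin> \<int>"
  shows "residue (barnes A \<kappa> \<mu> b) (barnes_pole \<kappa> b (a, r)) = barnes_residue A \<kappa> \<mu> b a r"
proof -
  let ?p = "barnes_pole \<kappa> b (a, r)"
  have k0: "of_nat \<kappa> \<noteq> (0::complex)" using k by simp
  have kp: "of_nat \<kappa> * ?p = - (b a + of_nat r)" using k0 by (simp add: barnes_pole_def)
  then have p: "of_nat \<kappa> * ?p + b a = - of_nat r" by simp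
  define g where "g = (\<lambda>u. exp (- \<mu> * u) * (\<Prod>a'\<in>A - {a}. Gamma (of_nat \<kappa> * u + b a')))"
  define s where "s = (\<Inter>a'\<in>A - {a}. {u. of_nat \<kappa> * u + b a' \<notin> \<int>\<^sub>\<le>\<^sub>0})"
  have F: "barnes A \<kappa> \<mu> b = (\<lambda>u. g u * Gamma (of_nat \<kappa> * u + b a))"
    unfolding barnes_def[abs_def] g_def using A by (simp add: prod.remove mult_ac)
  have op: "open s" unfolding s_def
  proof (intro open_INT ballI)
    fix a' assume "a' \<in> A - {a}"
    have "{u. of_nat \<kappa> * u + b a' \<notin> \<int>\<^sub>\<le>\<^sub>0} = (\<lambda>u. of_nat \<kappa> * u + b a') -` (- \<int>\<^sub>\<le>\<^sub>0)" by auto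
    moreover have "open \<dots>" by (intro open_vimage open_Compl closed_nonpos_Ints continuous_intros)
    ultimately show "open {u. of_nat \<kappa> * u + b a' \<notin> \<int>\<^sub>\<le>\<^sub>0}" by simp
  qed (use A in auto)
  have ps: "?p \<in> s" unfolding s_def
  proof (intro INT_I CollectI)
    fix a' assume a': "a' \<in> A - {a}"
    show "of_nat \<kappa> * ?p + b a' \<notin> \<int>\<^sub>\<le>\<^sub>0"
    proof
      assume "of_nat \<kappa> * ?p + b a' \<in> \<int>\<^sub>\<le>\<^sub>0"
      then have "of_nat \<kappa> * ?p + b a' + of_nat r \<in> \<int>" by (meson Ints_add Ints_of_nat nonpos_Ints_Int)
      then show False using b[of a'] a' unfolding kp by simp
    qed
  qed
  have hol: "g holomorphic_on s" unfolding g_def s_def by (intro holomorphic_intros) auto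
  have "g ?p = exp (\<mu> * (b a + of_nat r) / of_nat \<kappa>) * (\<Prod>a'\<in>A - {a}. Gamma (b a' - b a - of_nat r))"
    unfolding g_def kp by (simp add: barnes_pole_def algebra_simps)
  then show ?thesis
    unfolding F residue_mult_Gamma[OF op ps hol k0 p] barnes_residue_def by simp
qed

text \<open>Ratio test: the Gamma factors do not grow as their arguments move left beyond \<open>- 1\<close>, and
  \<open>1 / fact r\<close> beats the exponential.\<close>

lemma summable_barnes_residue:
  assumes k: "\<kappa> > 0" and A: "finite A" "a \<in> A"
    and b: "\<And>a'. a' \<in> A \<Longrightarrow> a' \<noteq> a \<Longrightarrow> b a' - b a \<notin> \<int>"
  shows "summable (barnes_residue A \<kappa> \<mu> b a)"
proof -
  define e where "e = norm (exp (\<mu> / of_nat \<kappa>))"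
  define M where "M = (\<Sum>a'\<in>A. \<bar>Re (b a' - b a)\<bar>)"
  obtain N1 :: nat where N1: "real N1 \<ge> M" using real_arch_simple by blast
  obtain N2 :: nat where N2: "real N2 \<ge> 2 * e" using real_arch_simple by blast
  show ?thesis
  proof (rule summable_ratio_test[of "1/2" "max N1 N2"])
    fix r assume r: "r \<ge> max N1 N2"
    have G: "norm (Gamma (b a' - b a - of_nat (Suc r))) \<le> norm (Gamma (b a' - b a - of_nat r))"
      if a': "a' \<in> A - {a}" for a'
    proof -
      define z where "z = b a' - b a - of_nat (Suc r)"
      have "z \<notin> \<int>\<^sub>\<le>\<^sub>0"
      proof
        assume "z \<in> \<int>\<^sub>\<le>\<^sub>0"
        then have "z + of_nat (Suc r) \<in> \<int>" by (meson Ints_add Ints_of_nat nonpos_Ints_Int)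
        then show False using b[of a'] a' by (simp add: z_def)
      qed
      from Gamma_plus1[OF this] have "norm (Gamma (z + 1)) = norm z * norm (Gamma z)" by (simp add: norm_mult)
      moreover have "1 \<le> norm z"
      proof -
        have "\<bar>Re (b a' - b a)\<bar> \<le> M" unfolding M_def using A a' by (intro member_le_sum) auto
        moreover have "Re z = Re (b a' - b a) - (1 + real r)" by (simp add: z_def)
        moreover have "real N1 \<le> real r" using r by simp
        ultimately have "Re z \<le> - 1" using N1 by linarith
        then show ?thesis using abs_Re_le_cmod[of z] by linarith
      qed
      ultimately have "norm (Gamma z) \<le> norm (Gamma (z + 1))"
        using mult_right_mono[of 1 "norm z" "norm (Gamma z)"] by simp
      moreover have "z + 1 = b a' - b a - of_nat r" by (simp add: z_def)
      ultimately show ?thesis by (simp only: z_def)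
    qed
    have P: "(\<Prod>a'\<in>A - {a}. norm (Gamma (b a' - b a - of_nat (Suc r)))) \<le> (\<Prod>a'\<in>A - {a}. norm (Gamma (b a' - b a - of_nat r)))"
      using G by (intro prod_mono) auto
    have ex: "exp (\<mu> * (b a + of_nat (Suc r)) / of_nat \<kappa>) = exp (\<mu> * (b a + of_nat r) / of_nat \<kappa>) * exp (\<mu> / of_nat \<kappa>)"
      unfolding exp_add[symmetric] by (simp add: field_simps add_divide_distrib)
    have fr: "1 / (fact (Suc r) * real \<kappa>) = (1 / real (Suc r)) * (1 / (fact r * real \<kappa>))" by simp
    define X where "X = norm (exp (\<mu> * (b a + of_nat r) / of_nat \<kappa>)) * (1 / (fact r * real \<kappa>))"
    have X: "X \<ge> 0" by (simp add: X_def)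
    have "norm (barnes_residue A \<kappa> \<mu> b a (Suc r)) = X * (e / real (Suc r)) * (\<Prod>a'\<in>A - {a}. norm (Gamma (b a' - b a - of_nat (Suc r))))"
      unfolding barnes_residue_def ex norm_mult norm_divide norm_power norm_fact prod_norm[symmetric] X_def e_def
      by (simp add: mult_ac)
    also have "\<dots> \<le> X * (1/2) * (\<Prod>a'\<in>A - {a}. norm (Gamma (b a' - b a - of_nat r)))"
    proof (intro mult_mono P mult_left_mono X)
      show "e / real (Suc r) \<le> 1 / 2" using N2 r by (simp add: field_simps)
    qed (use X in \<open>auto simp: e_def intro!: mult_nonneg_nonneg prod_nonneg\<close>)
    also have "\<dots> = 1/2 * norm (barnes_residue A \<kappa> \<mu> b a r)"
      unfolding barnes_residue_def norm_mult norm_divide norm_power norm_fact prod_norm[symmetric] X_def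
      by (simp add: mult_ac)
    finally show "norm (barnes_residue A \<kappa> \<mu> b a (Suc r)) \<le> 1/2 * norm (barnes_residue A \<kappa> \<mu> b a r)" .
  qed simp
qed

text \<open>One step to the left divides each Gamma factor by \<open>\<kappa>\<close> numbers of growing modulus, which produces
  the factorial.\<close>

lemma barnes_vertical_bound:
  assumes k: "\<kappa> > 0" and A: "finite A" "A \<noteq> {}"
    and X0: "\<And>a. a \<in> A \<Longrightarrow> real \<kappa> * X0 - Re (b a) \<notin> \<int> \<and> real \<kappa> * X0 - Re (b a) > 0"
  obtains C where "C > 0"
    "\<And>u M. Re u = - (X0 + real M) \<Longrightarrow> norm (barnes A \<kappa> \<mu> b u) \<le> C * exp (norm \<mu> * norm u) / fact M"
proof -
  have "\<forall>a\<in>A. \<exists>C\<ge>1. \<forall>v. Re v = - (real \<kappa> * X0 - Re (b a)) \<longrightarrow> norm (Gamma v) \<le> C"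
  proof
    fix a assume "a \<in> A"
    then have "real \<kappa> * X0 - Re (b a) \<notin> \<nat>" using X0 Nats_subset_Ints by blast
    from norm_Gamma_vertical_bound[OF this]
    show "\<exists>C\<ge>1. \<forall>v. Re v = - (real \<kappa> * X0 - Re (b a)) \<longrightarrow> norm (Gamma v) \<le> C" by metis
  qed
  then obtain C where C: "\<And>a. a \<in> A \<Longrightarrow> C a \<ge> 1"
    "\<And>a v. a \<in> A \<Longrightarrow> Re v = - (real \<kappa> * X0 - Re (b a)) \<Longrightarrow> norm (Gamma v) \<le> C a" by metis
  have PC: "prod C A > 0" using C by (intro prod_pos) (meson less_le_trans zero_less_one)
  show thesis
  proof (rule that[of "prod C A"])
    show "prod C A > 0" by (rule PC)
    fix u M assume u: "Re u = - (X0 + real M)"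
    have G: "norm (Gamma (of_nat \<kappa> * u + b a)) \<le> C a / fact M" if a: "a \<in> A" for a
    proof -
      define v where "v = of_nat \<kappa> * u + b a + of_nat (\<kappa> * M)"
      have v: "Re v = - (real \<kappa> * X0 - Re (b a))" by (simp add: v_def u) (simp add: algebra_simps)
      have "v \<notin> \<int>"
      proof
        assume "v \<in> \<int>"
        then have "Re v \<in> \<int>" by (auto elim!: Ints_cases)
        then show False using X0[OF a] v by (metis Ints_minus minus_minus)
      qed
      then have "norm (Gamma (v - of_nat (\<kappa> * M))) \<le> norm (Gamma v) / fact (\<kappa> * M)"
        using v X0[OF a] by (intro norm_Gamma_shift_left) auto
      also have "\<dots> \<le> C a / fact M"
      proof (rule frac_le)
        show "fact M \<le> (fact (\<kappa> * M) :: real)" using k by (intro fact_mono) simp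
      qed (use C(1)[OF a] C(2)[OF a v] in auto)
      finally show ?thesis by (simp add: v_def)
    qed
    have "(\<Prod>a\<in>A. norm (Gamma (of_nat \<kappa> * u + b a))) \<le> (\<Prod>a\<in>A. C a / fact M)"
      using G by (intro prod_mono) auto
    also have "\<dots> = prod C A / fact M ^ card A" by (simp add: prod_dividef)
    also have "\<dots> \<le> prod C A / fact M ^ 1"
    proof (rule divide_left_mono)
      show "fact M ^ 1 \<le> (fact M ^ card A :: real)"
        using A by (intro power_increasing) (auto simp: Suc_le_eq card_gt_0_iff)
    qed (use PC in auto)
    finally have "(\<Prod>a\<in>A. norm (Gamma (of_nat \<kappa> * u + b a))) \<le> prod C A / fact M" by simp
    moreover have "norm (exp (- \<mu> * u)) \<le> exp (norm \<mu> * norm u)"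
      using norm_exp[of "- \<mu> * u"] by (simp add: norm_mult)
    ultimately have "norm (barnes A \<kappa> \<mu> b u) \<le> exp (norm \<mu> * norm u) * (prod C A / fact M)"
      unfolding barnes_def norm_mult prod_norm[symmetric] by (intro mult_mono) (auto intro!: prod_nonneg)
    then show "norm (barnes A \<kappa> \<mu> b u) \<le> prod C A * exp (norm \<mu> * norm u) / fact M" by (simp add: mult_ac)
  qed
qed

section \<open>The residue theorem on growing triangles\<close>

text \<open>The point with real part \<open>- X\<close> on the ray from \<open>\<rho>\<close> with direction \<open>d\<close>, in the form
  \<open>\<rho> + \<rho> v d\<close> that the estimate of the integral along a leg uses.\<close>

definition leg_end :: "real \<Rightarrow> real \<Rightarrow> complex \<Rightarrow> complex" where
  "leg_end \<rho> X d = of_real \<rho> + of_real (\<rho> * ((\<rho> + X) / (\<rho> * (- Re d)))) * d"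

text \<open>The open region to the left of the vertex \<open>\<rho>\<close> between the rays with directions \<open>d1\<close> and \<open>d2\<close>.\<close>

definition wedge :: "real \<Rightarrow> complex \<Rightarrow> complex \<Rightarrow> complex set" where
  "wedge \<rho> d1 d2 = {z. - (Im d1 / Re d1) * (\<rho> - Re z) < Im z \<and> Im z < - (Im d2 / Re d2) * (\<rho> - Re z)}"

lemma leg_end_coords:
  assumes "\<rho> > 0" "Re d < 0"
  shows "Re (leg_end \<rho> X d) = - X" "Im (leg_end \<rho> X d) = - (Im d / Re d) * (\<rho> + X)"
  using assms by (auto simp: leg_end_def field_simps)

text \<open>Barycentric coordinates place a point of the wedge to the right of the vertical side in the interior of
  the triangle; the sign of the winding number is that of the orientation, which is positive because
  the lower leg is traversed first.\<close>

lemma triangle_contour: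
  fixes d1 d2 :: complex
  assumes \<rho>: "\<rho> > 0" "\<rho> + X > 0" and d: "Re d1 < 0" "Im d1 < 0" "Re d2 < 0" "Im d2 > 0"
  defines "V \<equiv> complex_of_real \<rho>" and "D \<equiv> leg_end \<rho> X d1" and "U \<equiv> leg_end \<rho> X d2"
  defines "\<gamma> \<equiv> linepath D V +++ linepath V U +++ linepath U D"
  shows "\<And>z. z \<in> wedge \<rho> d1 d2 \<Longrightarrow> Re z > - X \<Longrightarrow> winding_number \<gamma> z = 1"
    and "\<And>z. Re z < - X \<Longrightarrow> winding_number \<gamma> z = 0"
    and "\<And>z. z \<in> path_image \<gamma> \<Longrightarrow> Re z \<ge> - X"
    and "\<And>z. z \<in> path_image \<gamma> \<Longrightarrow> z \<in> wedge \<rho> d1 d2 \<Longrightarrow> Re z = - X"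
proof -
  define m1 where "m1 = - (Im d1 / Re d1)"
  define m2 where "m2 = - (Im d2 / Re d2)"
  have m: "m1 < 0" "m2 > 0" using d by (auto simp: m1_def m2_def divide_neg_neg divide_pos_neg)
  define T where "T = \<rho> + X"
  have T: "T > 0" using \<rho> by (simp add: T_def)
  have cD: "Re D = - X" "Im D = m1 * T" using leg_end_coords[OF \<rho>(1) d(1), of X] by (auto simp: D_def m1_def T_def)
  have cU: "Re U = - X" "Im U = m2 * T" using leg_end_coords[OF \<rho>(1) d(3), of X] by (auto simp: U_def m2_def T_def)
  have cV: "Re V = \<rho>" "Im V = 0" by (auto simp: V_def)
  have W: "z \<in> wedge \<rho> d1 d2 \<longleftrightarrow> m1 * (\<rho> - Re z) < Im z \<and> Im z < m2 * (\<rho> - Re z)" for z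
    by (simp add: wedge_def m1_def m2_def)
  have pi: "path_image \<gamma> = closed_segment D V \<union> (closed_segment V U \<union> closed_segment U D)"
    unfolding \<gamma>_def by (simp add: path_image_join)
  have seg: "z \<in> closed_segment a b \<Longrightarrow> \<exists>t\<ge>0. t \<le> 1 \<and> Re z = (1 - t) * Re a + t * Re b \<and> Im z = (1 - t) * Im a + t * Im b" for a b z :: complex
    by (auto simp: in_segment)
  have conv: "convex {z. Re z \<ge> - X}" by (rule convex_halfspace_Re_ge)
  have hull: "path_image \<gamma> \<subseteq> {z. Re z \<ge> - X}"
    unfolding pi using \<rho> by (intro Un_least closed_segment_subset conv) (auto simp: cD cU cV)
  then show "Re z \<ge> - X" if "z \<in> path_image \<gamma>" for z using that by auto
  show "Re z = - X" if z: "z \<in> path_image \<gamma>" "z \<in> wedge \<rho> d1 d2" for z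
  proof -
    consider "z \<in> closed_segment D V" | "z \<in> closed_segment V U" | "z \<in> closed_segment U D" using z(1) pi by blast
    then show ?thesis
    proof cases
      case 1
      from seg[OF this] obtain t where t: "Re z = (1 - t) * Re D + t * Re V" "Im z = (1 - t) * Im D + t * Im V" by blast
      have "\<rho> - Re z = (1 - t) * T" unfolding t cD cV T_def by (simp add: algebra_simps)
      then have "m1 * (\<rho> - Re z) = Im z" unfolding t cD cV by simp
      then show ?thesis using z(2) W by simp
    next
      case 2
      from seg[OF this] obtain t where t: "Re z = (1 - t) * Re V + t * Re U" "Im z = (1 - t) * Im V + t * Im U" by blast
      have "\<rho> - Re z = t * T" unfolding t cU cV T_def by (simp add: algebra_simps)
      then have "m2 * (\<rho> - Re z) = Im z" unfolding t cU cV by simp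
      then show ?thesis using z(2) W by simp
    next
      case 3
      from seg[OF this] show ?thesis by (auto simp: cD cU algebra_simps)
    qed
  qed
  have loop: "pathfinish \<gamma> = pathstart \<gamma>" "path \<gamma>" by (auto simp: \<gamma>_def)
  show "winding_number \<gamma> z = 0" if "Re z < - X" for z
    by (rule winding_number_zero_outside[OF loop(2) conv loop(1) _ hull]) (use that in simp)
  show "winding_number \<gamma> z = 1" if z: "z \<in> wedge \<rho> d1 d2" "Re z > - X" for z
  proof -
    let ?S = "{z. m1 * (\<rho> - Re z) < Im z} \<inter> {z. Im z < m2 * (\<rho> - Re z)} \<inter> {z. Re z > - X}"
    have op: "open ?S" by (intro open_Int open_Collect_less continuous_intros)
    have "?S \<subseteq> convex hull {D, V, U}"
    proof
      fix w assume w: "w \<in> ?S"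
      define t where "t = \<rho> - Re w"
      have wt: "m1 * t < Im w" "Im w < m2 * t" "t < T" using w by (auto simp: t_def T_def)
      then have "0 < (m2 - m1) * t" by (simp add: algebra_simps)
      then have t: "t > 0" using m by (simp add: zero_less_mult_iff)
      define \<tau> where "\<tau> = t / T"
      define s where "s = (m2 * t - Im w) / ((m2 - m1) * t)"
      have mm: "(m2 - m1) * t > 0" using m t by simp
      have q: "m2 * t - Im w \<ge> 0" "m2 * t - Im w \<le> (m2 - m1) * t" using wt unfolding left_diff_distrib by linarith+
      have s: "0 \<le> s" "s \<le> 1" unfolding s_def using q mm by (auto simp only: divide_le_eq_1_pos divide_nonneg_pos)
      have \<tau>: "0 \<le> \<tau>" "\<tau> \<le> 1" using t wt T by (auto simp: \<tau>_def)
      have "w = (\<tau> * s) *\<^sub>R D + (1 - \<tau>) *\<^sub>R V + (\<tau> * (1 - s)) *\<^sub>R U"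
      proof (rule complex_eqI)
        have "\<tau> * T = t" using T by (simp add: \<tau>_def)
        have "Re ((\<tau> * s) *\<^sub>R D + (1 - \<tau>) *\<^sub>R V + (\<tau> * (1 - s)) *\<^sub>R U) = \<rho> - \<tau> * T"
          by (simp add: cD cU cV T_def algebra_simps)
        then show "Re w = Re ((\<tau> * s) *\<^sub>R D + (1 - \<tau>) *\<^sub>R V + (\<tau> * (1 - s)) *\<^sub>R U)"
          using \<open>\<tau> * T = t\<close> by (simp add: t_def)
        have "Im ((\<tau> * s) *\<^sub>R D + (1 - \<tau>) *\<^sub>R V + (\<tau> * (1 - s)) *\<^sub>R U) = (\<tau> * T) * (m2 - s * (m2 - m1))"
          by (simp add: cD cU cV algebra_simps)
        also have "\<dots> = m2 * t - s * ((m2 - m1) * t)" using \<open>\<tau> * T = t\<close> by (simp add: algebra_simps)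
        also have "s * ((m2 - m1) * t) = m2 * t - Im w"
        proof -
          have "x / q * q = x" if "q > 0" for x q :: real using that by simp
          from this[OF mm] show ?thesis unfolding s_def .
        qed
        finally show "Im w = Im ((\<tau> * s) *\<^sub>R D + (1 - \<tau>) *\<^sub>R V + (\<tau> * (1 - s)) *\<^sub>R U)" by simp
      qed
      moreover have "0 \<le> \<tau> * s" "0 \<le> 1 - \<tau>" "0 \<le> \<tau> * (1 - s)" "\<tau> * s + (1 - \<tau>) + \<tau> * (1 - s) = 1"
        using s \<tau> by (auto simp: algebra_simps mult_left_le)
      ultimately show "w \<in> convex hull {D, V, U}" unfolding convex_hull_3 by blast
    qed
    then have "?S \<subseteq> interior (convex hull {D, V, U})" using op by (rule interior_maximal)
    moreover have "z \<in> ?S" using z W by auto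
    ultimately have "z \<in> interior (convex hull {D, V, U})" by blast
    from winding_number_triangle[OF this]
    have "winding_number \<gamma> z = (if 0 < Im ((V - D) * cnj (V - z)) then 1 else - 1)" unfolding \<gamma>_def .
    moreover have "0 < Im ((V - D) * cnj (V - z))"
    proof -
      have "Im ((V - D) * cnj (V - z)) = (- m1 * T) * (\<rho> - Re z) + T * Im z"
        by (simp add: cD cV T_def algebra_simps)
      also have "\<dots> = T * (Im z - m1 * (\<rho> - Re z))" by (simp add: algebra_simps)
      finally show ?thesis using T z W by (simp add: zero_less_mult_iff)
    qed
    ultimately show ?thesis by simp
  qed
qed

text \<open>The residue theorem on triangles that grow to the left: on the vertical side the integrand decays
  like \<open>1 / fact M\<close> against an exponential in \<open>M\<close>, so that in the limit the two legs carry the sum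
  of all residues.  The shift \<open>X0\<close> is chosen such that no vertical side meets a pole.\<close>

theorem barnes_residue_sum:
  fixes d1 d2 \<mu> :: complex and b :: "'a \<Rightarrow> complex"
  assumes k: "\<kappa> > 0" and A: "finite A" "A \<noteq> {}"
    and distinct: "\<forall>a\<in>A. \<forall>a'\<in>A. a' \<noteq> a \<longrightarrow> b a' - b a \<notin> \<int>"
    and shift: "\<forall>a\<in>A. real \<kappa> * X0 - Re (b a) \<notin> \<int> \<and> real \<kappa> * X0 - Re (b a) > 0"
    and \<rho>: "\<rho> > 0" "\<rho> + X0 > 0" and d: "Re d1 < 0" "Im d1 < 0" "Re d2 < 0" "Im d2 > 0"
    and in_wedge: "\<forall>a\<in>A. \<forall>r. barnes_pole \<kappa> b (a, r) \<in> wedge \<rho> d1 d2"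
  defines "F \<equiv> barnes A \<kappa> \<mu> b"
  shows "\<And>M. continuous_on (closed_segment (of_real \<rho>) (leg_end \<rho> (X0 + real M) d1)) F"
    and "\<And>M. continuous_on (closed_segment (of_real \<rho>) (leg_end \<rho> (X0 + real M) d2)) F"
    and "(\<lambda>M. contour_integral (linepath (of_real \<rho>) (leg_end \<rho> (X0 + real M) d2)) F
            - contour_integral (linepath (of_real \<rho>) (leg_end \<rho> (X0 + real M) d1)) F)
         \<longlonglongrightarrow> 2 * of_real pi * \<i> * (\<Sum>a\<in>A. suminf (barnes_residue A \<kappa> \<mu> b a))"
proof -
  have b: "\<And>a a'. a \<in> A \<Longrightarrow> a' \<in> A \<Longrightarrow> a' \<noteq> a \<Longrightarrow> b a' - b a \<notin> \<int>"
    using distinct by blast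
  have X0: "\<And>a. a \<in> A \<Longrightarrow> real \<kappa> * X0 - Re (b a) \<notin> \<int> \<and> real \<kappa> * X0 - Re (b a) > 0"
    by (rule bspec[OF shift])
  have poles: "\<And>a r. a \<in> A \<Longrightarrow> barnes_pole \<kappa> b (a, r) \<in> wedge \<rho> d1 d2"
    using in_wedge by blast
  let ?P = "barnes_pole \<kappa> b"
  have kr: "real \<kappa> > 0" using k by simp
  define X where "X = (\<lambda>M::nat. X0 + real M)"
  define V where "V = complex_of_real \<rho>"
  define D where "D = (\<lambda>M. leg_end \<rho> (X M) d1)"
  define U where "U = (\<lambda>M. leg_end \<rho> (X M) d2)"
  define \<gamma> where "\<gamma> = (\<lambda>M. linepath (D M) V +++ linepath V (U M) +++ linepath (U M) (D M))"
  have XM: "\<rho> + X M > 0" for M using \<rho> by (simp add: X_def)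
  have tri1: "winding_number (\<gamma> M) z = 1" if "z \<in> wedge \<rho> d1 d2" "Re z > - X M" for z M
    unfolding \<gamma>_def D_def U_def V_def by (rule triangle_contour(1)[OF \<rho>(1) XM d that])
  have tri2: "winding_number (\<gamma> M) z = 0" if "Re z < - X M" for z M
    unfolding \<gamma>_def D_def U_def V_def by (rule triangle_contour(2)[OF \<rho>(1) XM d that])
  have tri3: "Re z \<ge> - X M" if "z \<in> path_image (\<gamma> M)" for z M
    using triangle_contour(3)[OF \<rho>(1) XM d] that unfolding \<gamma>_def D_def U_def V_def by blast
  have tri4: "Re z = - X M" if "z \<in> path_image (\<gamma> M)" "z \<in> wedge \<rho> d1 d2" for z M
    using triangle_contour(4)[OF \<rho>(1) XM d] that unfolding \<gamma>_def D_def U_def V_def by blast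
  have ReP: "Re (?P (a, r)) = - (Re (b a) + real r) / real \<kappa>" for a r
    by (simp add: barnes_pole_def Re_divide_of_real[of _ "real \<kappa>", simplified] )
  have Re_ne: "Re (?P (a, r)) \<noteq> - X M" if "a \<in> A" for a r M
  proof
    assume "Re (?P (a, r)) = - X M"
    then have "real \<kappa> * X M = Re (b a) + real r" unfolding ReP using kr by (simp add: field_simps)
    then have "real \<kappa> * X0 - Re (b a) = real r - real (\<kappa> * M)" by (simp add: X_def algebra_simps)
    then have "real \<kappa> * X0 - Re (b a) \<in> \<int>" by (simp only: Ints_diff Ints_of_nat)
    then show False using X0[OF that] by blast
  qed
  have path_no_pole: "z \<notin> ?P ` (A \<times> UNIV)" if z: "z \<in> path_image (\<gamma> M)" for z M
  proof
    assume "z \<in> ?P ` (A \<times> UNIV)"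
    then obtain a r where ar: "a \<in> A" "z = ?P (a, r)" by auto
    have "Re z = - X M" by (rule tri4[OF z]) (use poles ar in auto)
    then show False using Re_ne[OF ar(1)] ar(2) by simp
  qed
  have holF: "F holomorphic_on (- ?P ` (A \<times> UNIV))" unfolding F_def by (rule barnes_holomorphic[OF k A(1)])
  have img: "path_image (\<gamma> M) = closed_segment (D M) V \<union> (closed_segment V (U M) \<union> closed_segment (U M) (D M))" for M
    unfolding \<gamma>_def by (simp add: path_image_join)
  have contP: "continuous_on (path_image (\<gamma> M)) F" for M
    by (rule continuous_on_subset[OF holomorphic_on_imp_continuous_on[OF holF]]) (use path_no_pole in auto)
  then have contD: "continuous_on (closed_segment V (D M)) F" and contU: "continuous_on (closed_segment V (U M)) F"
    and contL: "continuous_on (closed_segment (U M) (D M)) F" for M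
    by (auto intro: continuous_on_subset simp: img closed_segment_commute)
  show "continuous_on (closed_segment (of_real \<rho>) (leg_end \<rho> (X0 + real M) d1)) F" for M
    using contD by (simp add: V_def D_def X_def)
  show "continuous_on (closed_segment (of_real \<rho>) (leg_end \<rho> (X0 + real M) d2)) F" for M
    using contU by (simp add: V_def U_def X_def)
  define N where "N = (\<lambda>a M. nat \<lceil>real \<kappa> * X M - Re (b a)\<rceil>)"
  have N_iff: "Re (?P (a, r)) > - X M \<longleftrightarrow> r < N a M" if "a \<in> A" for a r M
  proof -
    have pos: "real \<kappa> * X M - Re (b a) > 0"
    proof -
      have "real \<kappa> * X0 \<le> real \<kappa> * X M" using kr by (intro mult_left_mono) (auto simp: X_def)
      then show ?thesis using X0[OF that] by linarith
    qed
    have "Re (?P (a, r)) > - X M \<longleftrightarrow> real r < real \<kappa> * X M - Re (b a)"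
      unfolding ReP using kr by (simp add: field_simps)
    also have "\<dots> \<longleftrightarrow> r < N a M" unfolding N_def using pos by linarith
    finally show ?thesis .
  qed
  have inj: "inj_on ?P (A \<times> UNIV)"
  proof (rule inj_onI, clarify)
    fix a r a' r' assume aa: "a \<in> A" "a' \<in> A" and eq: "?P (a, r) = ?P (a', r')"
    have k0: "of_nat \<kappa> \<noteq> (0::complex)" using k by simp
    have "- (b a + of_nat r) / of_nat \<kappa> = - (b a' + of_nat r') / of_nat \<kappa>"
      using eq by (simp add: barnes_pole_def)
    then have "- (b a + of_nat r) = - (b a' + of_nat r')"
      unfolding divide_cancel_right using k0 by blast
    then have e: "b a + of_nat r = b a' + of_nat r'" by (simp only: neg_equal_iff_equal)
    then have "b a' - b a = of_nat r - of_nat r'" by (simp add: algebra_simps)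
    then have "b a' - b a \<in> \<int>" by (simp only: Ints_diff Ints_of_nat)
    then have "a = a'" using b[of a a'] aa by blast
    then show "a = a' \<and> r = r'" using e by simp
  qed
  have residue_thm: "contour_integral (\<gamma> M) F = 2 * of_real pi * \<i> * (\<Sum>a\<in>A. \<Sum>r<N a M. barnes_residue A \<kappa> \<mu> b a r)" for M
  proof -
    define H where "H = {z. Re z > - X (Suc M)}"
    \<comment> \<open>The half-plane is one step larger than the triangle, so that it contains the closed contour.\<close>
    define pts where "pts = {p \<in> ?P ` (A \<times> UNIV). Re p > - X (Suc M)}"
    have XS: "X M < X (Suc M)" by (simp add: X_def)
    have pts_eq: "pts = ?P ` (SIGMA a:A. {..<N a (Suc M)})"
      unfolding pts_def using N_iff by (auto simp: image_iff)
    have fin: "finite pts" unfolding pts_eq using A by auto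
    have "contour_integral (\<gamma> M) F = 2 * pi * \<i> * (\<Sum>p\<in>pts. winding_number (\<gamma> M) p * residue F p)"
    proof (rule Residue_theorem[of H])
      show "open H" unfolding H_def by (intro open_Collect_less continuous_intros)
      show "connected H" unfolding H_def by (intro convex_connected convex_halfspace_Re_gt)
      show "finite pts" by (rule fin)
      show "F holomorphic_on H - pts"
        by (rule holomorphic_on_subset[OF holF]) (auto simp: H_def pts_def)
      show "valid_path (\<gamma> M)" by (simp add: \<gamma>_def)
      show "pathfinish (\<gamma> M) = pathstart (\<gamma> M)" by (simp add: \<gamma>_def)
      show "path_image (\<gamma> M) \<subseteq> H - pts"
        using tri3[of _ M] path_no_pole[of _ M] XS by (force simp: H_def pts_def)
      show "\<forall>z. z \<notin> H \<longrightarrow> winding_number (\<gamma> M) z = 0"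
        using tri2[of _ M] XS by (auto simp: H_def)
    qed
    also have "(\<Sum>p\<in>pts. winding_number (\<gamma> M) p * residue F p) =
       (\<Sum>x\<in>(SIGMA a:A. {..<N a (Suc M)}). winding_number (\<gamma> M) (?P x) * residue F (?P x))"
      unfolding pts_eq by (rule sum.reindex_cong[OF _ refl refl]) (rule inj_on_subset[OF inj], auto)
    also have "\<dots> = (\<Sum>x\<in>(SIGMA a:A. {..<N a (Suc M)}). if snd x < N (fst x) M then barnes_residue A \<kappa> \<mu> b (fst x) (snd x) else 0)"
    proof (rule sum.cong[OF refl], clarify)
      fix a r assume a: "a \<in> A"
      have res: "residue F (?P (a, r)) = barnes_residue A \<kappa> \<mu> b a r"
        unfolding F_def by (rule residue_barnes[OF k A(1) a]) (use b a in auto)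
      show "winding_number (\<gamma> M) (?P (a, r)) * residue F (?P (a, r)) =
         (if snd (a, r) < N (fst (a, r)) M then barnes_residue A \<kappa> \<mu> b (fst (a, r)) (snd (a, r)) else 0)"
      proof (cases "r < N a M")
        case True
        then have "winding_number (\<gamma> M) (?P (a, r)) = 1"
          using N_iff[OF a] poles[OF a] by (intro tri1) auto
        then show ?thesis using True res by simp
      next
        case False
        then have "Re (?P (a, r)) < - X M" using N_iff[OF a, of M r] Re_ne[OF a, of r M] by linarith
        then have "winding_number (\<gamma> M) (?P (a, r)) = 0" by (rule tri2)
        then show ?thesis using False by simp
      qed
    qed
    also have "\<dots> = (\<Sum>a\<in>A. \<Sum>r<N a (Suc M). if r < N a M then barnes_residue A \<kappa> \<mu> b a r else 0)"
      using A by (subst sum.Sigma) (auto simp: case_prod_unfold)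
    also have "\<dots> = (\<Sum>a\<in>A. \<Sum>r<N a M. barnes_residue A \<kappa> \<mu> b a r)"
    proof (rule sum.cong[OF refl])
      fix a
      have "N a M \<le> N a (Suc M)" unfolding N_def using kr by (intro nat_mono ceiling_mono) (auto simp: X_def)
      then show "(\<Sum>r<N a (Suc M). if r < N a M then barnes_residue A \<kappa> \<mu> b a r else 0) = (\<Sum>r<N a M. barnes_residue A \<kappa> \<mu> b a r)"
        by (intro sum.mono_neutral_cong_right) auto
    qed
    finally show ?thesis by simp
  qed
  have N_lim: "filterlim (N a) at_top sequentially" for a
  proof -
    have "filterlim (\<lambda>M. real \<kappa> * X M - Re (b a)) at_top sequentially"
      unfolding X_def using kr by real_asymp
    then have ev: "\<forall>\<^sub>F M in sequentially. real Z \<le> real \<kappa> * X M - Re (b a)" for Z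
      by (simp add: filterlim_at_top)
    show ?thesis unfolding filterlim_at_top
    proof
      fix Z
      show "\<forall>\<^sub>F M in sequentially. Z \<le> N a M"
        using ev[of Z] by eventually_elim (simp add: N_def, linarith)
    qed
  qed
  have sums: "(\<lambda>M. \<Sum>a\<in>A. \<Sum>r<N a M. barnes_residue A \<kappa> \<mu> b a r) \<longlonglongrightarrow> (\<Sum>a\<in>A. suminf (barnes_residue A \<kappa> \<mu> b a))"
  proof (rule tendsto_sum)
    fix a assume a: "a \<in> A"
    have "summable (barnes_residue A \<kappa> \<mu> b a)" by (rule summable_barnes_residue[OF k A(1) a]) (use b a in auto)
    from filterlim_compose[OF summable_LIMSEQ[OF this] N_lim]
    show "(\<lambda>M. \<Sum>r<N a M. barnes_residue A \<kappa> \<mu> b a r) \<longlonglongrightarrow> suminf (barnes_residue A \<kappa> \<mu> b a)" .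
  qed
  have left: "(\<lambda>M. contour_integral (linepath (U M) (D M)) F) \<longlonglongrightarrow> 0"
  proof -
    obtain C where C: "C > 0"
      "\<And>u M. Re u = - (X0 + real M) \<Longrightarrow> norm (barnes A \<kappa> \<mu> b u) \<le> C * exp (norm \<mu> * norm u) / fact M"
      using barnes_vertical_bound[where b = b and \<mu> = \<mu>, OF k A X0] by blast
    define s where "s = \<bar>Im d1 / Re d1\<bar> + \<bar>Im d2 / Re d2\<bar>"
    define c where "c = (1 + s) * (\<rho> + \<bar>X0\<bar> + 1)"
    have s0: "s \<ge> 0" by (simp add: s_def)
    have c0: "c > 0" unfolding c_def using s0 \<rho> by (intro mult_pos_pos) auto
    have bnd: "norm z \<le> c * (1 + real M)" if z: "z \<in> closed_segment (U M) (D M)" for z M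
    proof -
      have R: "Re (U M) = - X M" "Re (D M) = - X M" "Im (U M) = - (Im d2 / Re d2) * (\<rho> + X M)" "Im (D M) = - (Im d1 / Re d1) * (\<rho> + X M)"
        using leg_end_coords[OF \<rho>(1)] d by (auto simp: U_def D_def)
      have e: "norm w \<le> (1 + s) * (\<rho> + \<bar>X0\<bar> + real M)" if w: "w = U M \<or> w = D M" for w
      proof -
        have x: "\<bar>X M\<bar> \<le> \<rho> + \<bar>X0\<bar> + real M" "\<bar>\<rho> + X M\<bar> \<le> \<rho> + \<bar>X0\<bar> + real M" using \<rho> by (auto simp: X_def)
        have "\<bar>Im w\<bar> \<le> s * (\<rho> + \<bar>X0\<bar> + real M)"
        proof -
          have "\<exists>m. Im w = m * (\<rho> + X M) \<and> \<bar>m\<bar> \<le> s"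
          proof (cases "w = U M")
            case True
            then show ?thesis using R(3) by (intro exI[of _ "- (Im d2 / Re d2)"]) (simp add: s_def)
          next
            case False
            then show ?thesis using w R(4) by (intro exI[of _ "- (Im d1 / Re d1)"]) (simp add: s_def)
          qed
          then have "\<bar>Im w\<bar> \<le> s * \<bar>\<rho> + X M\<bar>" by (auto simp: abs_mult intro!: mult_right_mono)
          also have "\<dots> \<le> s * (\<rho> + \<bar>X0\<bar> + real M)" using s0 x by (intro mult_left_mono) auto
          finally show ?thesis .
        qed
        moreover have "\<bar>Re w\<bar> \<le> \<rho> + \<bar>X0\<bar> + real M" using w R x by auto
        ultimately show ?thesis using cmod_le[of w] by (simp add: ring_distribs)
      qed
      have "norm z \<le> (1 + s) * (\<rho> + \<bar>X0\<bar> + real M)"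
      proof -
        have "closed_segment (U M) (D M) \<subseteq> cball 0 ((1 + s) * (\<rho> + \<bar>X0\<bar> + real M))"
          using e by (intro closed_segment_subset) auto
        then show ?thesis using z by auto
      qed
      also have "\<dots> \<le> c * (1 + real M)"
      proof -
        have "\<rho> + \<bar>X0\<bar> + real M \<le> (\<rho> + \<bar>X0\<bar> + 1) * (1 + real M)" using \<rho> by (simp add: algebra_simps)
        then show ?thesis unfolding c_def mult.assoc using s0 by (intro mult_left_mono) auto
      qed
      finally show ?thesis .
    qed
    define g where "g = (\<lambda>M::nat. C * exp (norm \<mu> * (c * (1 + real M))) / fact M * (2 * (c * (1 + real M))))"
    have gb: "norm (contour_integral (linepath (U M) (D M)) F) \<le> g M" for M
    proof -
      have "norm (contour_integral (linepath (U M) (D M)) F) \<le> (C * exp (norm \<mu> * (c * (1 + real M))) / fact M) * norm (D M - U M)"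
      proof (rule contour_integral_bound_linepath)
        show "F contour_integrable_on linepath (U M) (D M)"
          by (rule contour_integrable_continuous_linepath[OF contL])
        show "0 \<le> C * exp (norm \<mu> * (c * (1 + real M))) / fact M" using C by simp
        fix x assume x: "x \<in> closed_segment (U M) (D M)"
        have "Re x = - X M"
        proof -
          have "Re (U M) = - X M" "Re (D M) = - X M" using leg_end_coords[OF \<rho>(1)] d by (auto simp: U_def D_def)
          moreover obtain t where "x = (1 - t) *\<^sub>R U M + t *\<^sub>R D M" using x unfolding in_segment by blast
          ultimately have "Re x = (1 - t) * (- X M) + t * (- X M)" by simp
          then show ?thesis by (simp only: left_diff_distrib)
        qed
        then have "norm (F x) \<le> C * exp (norm \<mu> * norm x) / fact M" unfolding F_def X_def by (rule C(2))
        also have "\<dots> \<le> C * exp (norm \<mu> * (c * (1 + real M))) / fact M"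
          using C(1) bnd[OF x] by (intro divide_right_mono mult_left_mono) (auto intro!: mult_left_mono)
        finally show "norm (F x) \<le> C * exp (norm \<mu> * (c * (1 + real M))) / fact M" .
      qed
      also have "\<dots> \<le> g M"
      proof -
        have "norm (D M - U M) \<le> norm (D M) + norm (U M)" by (rule norm_triangle_ineq4)
        also have "\<dots> \<le> 2 * (c * (1 + real M))" using bnd[of "D M" M] bnd[of "U M" M] by simp
        finally show ?thesis unfolding g_def using C(1) by (intro mult_left_mono) auto
      qed
      finally show ?thesis .
    qed
    have g0: "g \<longlonglongrightarrow> 0"
    proof -
      define a where "a = exp (norm \<mu> * c + 1)"
      have le: "g M \<le> 2 * C * c * a * (a ^ M / fact M)" for M
      proof -
        have "1 + real M \<le> exp (1 + real M)" using exp_ge_add_one_self[of "1 + real M"] by linarith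
        then have "exp (norm \<mu> * (c * (1 + real M))) * (1 + real M) \<le> exp (norm \<mu> * (c * (1 + real M))) * exp (1 + real M)"
          by (intro mult_left_mono) auto
        also have "\<dots> = a * a ^ M"
          unfolding a_def exp_of_nat_mult[symmetric] exp_add[symmetric] by (simp add: algebra_simps)
        finally have "2 * C * c * (exp (norm \<mu> * (c * (1 + real M))) * (1 + real M)) / fact M \<le> 2 * C * c * (a * a ^ M) / fact M"
          using C(1) c0 by (intro divide_right_mono mult_left_mono) auto
        then show ?thesis unfolding g_def by (simp only: times_divide_eq_left times_divide_eq_right mult_ac)
      qed
      have nonneg: "0 \<le> g M" for M unfolding g_def using C(1) c0 by simp
      have "(\<lambda>M. a ^ M / fact M) \<longlonglongrightarrow> 0"
        using summable_LIMSEQ_zero[OF summable_exp[of a]] by (simp add: field_simps)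
      then have "(\<lambda>M. 2 * C * c * a * (a ^ M / fact M)) \<longlonglongrightarrow> 2 * C * c * a * 0"
        by (intro tendsto_mult tendsto_const)
      then have lim0: "(\<lambda>M. 2 * C * c * a * (a ^ M / fact M)) \<longlonglongrightarrow> 0" by simp
      show ?thesis
        by (rule tendsto_sandwich[OF _ _ tendsto_const lim0]) (use le nonneg in auto)
    qed
    show ?thesis by (rule Lim_null_comparison[OF _ g0]) (simp add: gb)
  qed
  have split: "contour_integral (\<gamma> M) F - contour_integral (linepath (U M) (D M)) F =
      contour_integral (linepath V (U M)) F - contour_integral (linepath V (D M)) F" for M
  proof -
    have i: "F contour_integrable_on linepath (D M) V" "F contour_integrable_on linepath V (U M)" "F contour_integrable_on linepath (U M) (D M)"
      by (rule contour_integrable_continuous_linepath[OF contD[of M, unfolded closed_segment_commute[of V]]]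
          contour_integrable_continuous_linepath[OF contU] contour_integrable_continuous_linepath[OF contL])+
    have "contour_integral (\<gamma> M) F = contour_integral (linepath (D M) V) F + (contour_integral (linepath V (U M)) F + contour_integral (linepath (U M) (D M)) F)"
    proof -
      have "F contour_integrable_on linepath V (U M) +++ linepath (U M) (D M)"
        using i by (intro contour_integrable_joinI) auto
      then show ?thesis unfolding \<gamma>_def using i by (simp add: contour_integral_join)
    qed
    moreover have "contour_integral (linepath (D M) V) F = - contour_integral (linepath V (D M)) F"
      using contour_integral_reversepath[of "linepath V (D M)" F] by simp
    ultimately show ?thesis by simp
  qed
  have "(\<lambda>M. contour_integral (\<gamma> M) F - contour_integral (linepath (U M) (D M)) F) \<longlonglongrightarrow>
      2 * of_real pi * \<i> * (\<Sum>a\<in>A. suminf (barnes_residue A \<kappa> \<mu> b a)) - 0"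
    unfolding residue_thm by (intro tendsto_diff left tendsto_mult tendsto_const sums)
  then show "(\<lambda>M. contour_integral (linepath (of_real \<rho>) (leg_end \<rho> (X0 + real M) d2)) F
            - contour_integral (linepath (of_real \<rho>) (leg_end \<rho> (X0 + real M) d1)) F)
         \<longlonglongrightarrow> 2 * of_real pi * \<i> * (\<Sum>a\<in>A. suminf (barnes_residue A \<kappa> \<mu> b a))"
    unfolding split by (simp add: V_def U_def D_def X_def)
qed

section \<open>Asymptotics of the sum of residues\<close>

text \<open>All poles lie in a half-strip that does not depend on \<open>\<rho>\<close>; for large \<open>\<rho>\<close> the wedge contains it.\<close>

lemma wedge_contains_left_strip:
  assumes d: "Re d1 < 0" "Im d1 < 0" "Re d2 < 0" "Im d2 > 0"
  obtains \<rho>0 where "\<rho>0 > 0"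
    "\<And>\<rho> z. \<rho> \<ge> \<rho>0 \<Longrightarrow> Re z \<le> B \<Longrightarrow> \<bar>Im z\<bar> \<le> B \<Longrightarrow> z \<in> wedge \<rho> d1 d2"
proof -
  define m1 where "m1 = Im d1 / Re d1"
  define m2 where "m2 = - (Im d2 / Re d2)"
  have m: "m1 > 0" "m2 > 0" using d by (auto simp: m1_def m2_def divide_neg_neg divide_pos_neg)
  define \<rho>0 where "\<rho>0 = \<bar>B\<bar> + (\<bar>B\<bar> + 1) / m1 + (\<bar>B\<bar> + 1) / m2 + 1"
  show thesis
  proof (rule that[of \<rho>0])
    show "\<rho>0 > 0" unfolding \<rho>0_def using m by (intro add_nonneg_pos add_nonneg_nonneg) auto
    fix \<rho> z assume r: "\<rho> \<ge> \<rho>0" and z: "Re z \<le> B" "\<bar>Im z\<bar> \<le> B"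
    have q: "(\<bar>B\<bar> + 1) / m1 \<ge> 0" "(\<bar>B\<bar> + 1) / m2 \<ge> 0" using m by auto
    have "\<rho> - Re z \<ge> (\<bar>B\<bar> + 1) / m1" "\<rho> - Re z \<ge> (\<bar>B\<bar> + 1) / m2"
      using r z q unfolding \<rho>0_def by linarith+
    then have "m1 * (\<rho> - Re z) \<ge> \<bar>B\<bar> + 1" "m2 * (\<rho> - Re z) \<ge> \<bar>B\<bar> + 1"
      using m by (auto simp: pos_divide_le_eq mult.commute)
    then have "- (m1 * (\<rho> - Re z)) < Im z" "Im z < m2 * (\<rho> - Re z)" using z by linarith+
    then show "z \<in> wedge \<rho> d1 d2" by (simp add: wedge_def m1_def m2_def)
  qed
qed

text \<open>Only countably many positions of the vertical side meet a pole.  One position has to serve the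
  original integrand and the two model integrands at once, whence the set of pairs.\<close>

lemma exists_generic_shift:
  fixes S :: "(nat \<times> real) set"
  assumes "finite S" "\<And>k \<beta>. (k, \<beta>) \<in> S \<Longrightarrow> k > 0"
  obtains X where "X > 0" "\<And>k \<beta>. (k, \<beta>) \<in> S \<Longrightarrow> real k * X - \<beta> \<notin> \<int> \<and> real k * X - \<beta> > 0"
proof -
  define c where "c = (\<Sum>x\<in>S. \<bar>snd x\<bar>)"
  have c0: "c \<ge> 0" unfolding c_def by (intro sum_nonneg) auto
  have cge: "\<beta> \<le> c" if "(k, \<beta>) \<in> S" for k \<beta>
  proof -
    have "\<bar>snd (k, \<beta>)\<bar> \<le> c" unfolding c_def by (rule member_le_sum[OF that]) (use assms in auto)
    then show ?thesis by simp
  qed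
  define bad where "bad = (\<Union>x\<in>S. (\<lambda>j::int. (of_int j + snd x) / real (fst x)) ` UNIV)"
  have "countable bad" unfolding bad_def
  proof (rule countable_UN)
    show "countable S" using assms(1) by (rule countable_finite)
    show "countable (range (\<lambda>j::int. (of_int j + snd x) / real (fst x)))" for x :: "nat \<times> real"
      by (intro countable_image) simp
  qed
  moreover have "uncountable {c<..<c+1}" by (simp add: uncountable_open_interval)
  ultimately obtain X where X: "X \<in> {c<..<c+1}" "X \<notin> bad"
    by (meson countable_subset subsetI)
  show thesis
  proof (rule that[of X])
    show "X > 0" using X c0 by auto
    fix k \<beta> assume k: "(k, \<beta>) \<in> S"
    have k1: "real k \<ge> 1" using assms(2)[OF k] by simp
    have "\<beta> < X" using cge[OF k] X by simp
    also have "1 * X \<le> real k * X" using k1 X c0 by (intro mult_right_mono) auto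
    finally have pos: "real k * X - \<beta> > 0" by simp
    have "real k * X - \<beta> \<notin> \<int>"
    proof
      assume "real k * X - \<beta> \<in> \<int>"
      then obtain j :: int where "real k * X - \<beta> = of_int j" by (elim Ints_cases)
      then have "X = (of_int j + \<beta>) / real k" using k1 by (simp add: field_simps)
      then have "X \<in> bad" unfolding bad_def using k by force
      then show False using X by simp
    qed
    then show "real k * X - \<beta> \<notin> \<int> \<and> real k * X - \<beta> > 0" using pos by simp
  qed
qed

text \<open>For a single Gamma function the series of residues is an exponential series.\<close>

lemma suminf_single_barnes_residue:
  assumes n: "n > 0" and Y: "Y = exp (\<mu> / of_nat n)"
  shows "suminf (barnes_residue {()} n \<mu> (\<lambda>_. \<beta>) ()) = exp (\<mu> / of_nat n * \<beta>) * exp (- Y) / of_nat n"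
proof -
  have "barnes_residue {()} n \<mu> (\<lambda>_. \<beta>) () r = exp (\<mu> / of_nat n * \<beta>) / of_nat n * ((- Y) ^ r /\<^sub>R fact r)" for r
  proof -
    have "exp (\<mu> * (\<beta> + of_nat r) / of_nat n) = exp (\<mu> / of_nat n * \<beta>) * Y ^ r"
      unfolding Y exp_of_nat_mult[symmetric] exp_add[symmetric]
      by (simp add: add_divide_distrib ring_distribs mult_ac)
    moreover have "(- Y) ^ r = (- 1) ^ r * Y ^ r" by (simp add: power_mult_distrib[symmetric])
    ultimately show ?thesis by (simp add: barnes_residue_def scaleR_conv_of_real divide_simps)
  qed
  then have "barnes_residue {()} n \<mu> (\<lambda>_. \<beta>) () = (\<lambda>r. exp (\<mu> / of_nat n * \<beta>) / of_nat n * ((- Y) ^ r /\<^sub>R fact r))" by blast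
  moreover have "(\<lambda>r. exp (\<mu> / of_nat n * \<beta>) / of_nat n * ((- Y) ^ r /\<^sub>R fact r)) sums (exp (\<mu> / of_nat n * \<beta>) / of_nat n * exp (- Y))"
    by (intro sums_mult exp_converges)
  ultimately show ?thesis by (simp add: sums_iff)
qed

definition barnes_sum :: "('n::finite \<Rightarrow> complex) \<Rightarrow> complex \<Rightarrow> complex" where
  "barnes_sum b L = (\<Sum>a\<in>UNIV. suminf (barnes_residue UNIV 1 L b a))"

text \<open>Here \<open>l = L / n\<close>, so that \<open>exp l\<close> is the saddle point.\<close>

definition barnes_lead :: "nat \<Rightarrow> complex \<Rightarrow> complex \<Rightarrow> complex" where
  "barnes_lead n B l = of_real ((2 * pi) powr ((real n - 1) / 2) / sqrt (real n)) * exp (B * l) * exp (- of_nat n * exp l)"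

text \<open>The residue theorem is applied to the integrand minus its two-term model.  On both legs this
  difference is bounded by \<open>1 / u\<^sup>2\<close> times Stirling's main term, so the sum of its residues is smaller by
  \<open>\<rho>\<^bsup>-3/2\<^esup>\<close> than the leading term.  The residues of the model give the leading term itself and, from its
  second Gamma function, a multiple smaller by \<open>n \<rho>\<close>.\<close>

lemma barnes_sum_asymptotics_upper:
  fixes b :: "'n::finite \<Rightarrow> complex"
  assumes b: "\<And>a a'. a' \<noteq> a \<Longrightarrow> b a' - b a \<notin> \<int>"
    and th: "0 \<le> \<theta>" "\<theta> < pi"
  defines "n \<equiv> CARD('n)" and "B \<equiv> (\<Sum>a\<in>UNIV. b a) - of_nat CARD('n) / 2 + 1/2"
  obtains C \<rho>0 :: real where "C > 0" "\<rho>0 \<ge> 1"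
    "\<And>\<rho>. \<rho> \<ge> \<rho>0 \<Longrightarrow> norm (barnes_sum b (of_nat n * (of_real (ln \<rho>) + \<i> * of_real \<theta>)) - barnes_lead n B (of_real (ln \<rho>) + \<i> * of_real \<theta>))
       \<le> C / \<rho> * norm (barnes_lead n B (of_real (ln \<rho>) + \<i> * of_real \<theta>))"
proof -
  have n: "n > 0" by (simp add: n_def)
  obtain d1 where d1: "descent_direction \<theta> d1" "Im d1 < 0" using lower_descent_direction[OF th(1)] .
  obtain d2 where d2: "descent_direction \<theta> d2" "Im d2 > 0" using upper_descent_direction[OF th] .
  have nd: "norm d1 = 1" "Re d1 < 0" "norm d2 = 1" "Re d2 < 0" using d1 d2 by (auto simp: descent_direction_def)
  define c where "c = max (- Re d1) (- Re d2)"
  have "(Re d1)\<^sup>2 + (Im d1)\<^sup>2 = 1" "(Re d2)\<^sup>2 + (Im d2)\<^sup>2 = 1" using nd by (auto simp: cmod_def)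
  moreover have "(Im d1)\<^sup>2 > 0" "(Im d2)\<^sup>2 > 0" using d1 d2 by auto
  ultimately have "(Re d1)\<^sup>2 < 1" "(Re d2)\<^sup>2 < 1" by linarith+
  then have "(- Re d1)\<^sup>2 < 1\<^sup>2" "(- Re d2)\<^sup>2 < 1\<^sup>2" by simp_all
  then have "- Re d1 < 1" "- Re d2 < 1"
    using power2_less_imp_less[of "- Re d1" 1] power2_less_imp_less[of "- Re d2" 1] by simp_all
  then have c: "0 \<le> c" "c < 1" using nd by (auto simp: c_def)
  define c0 where "c0 = (2 * pi) powr ((real n - 1) / 2)"
  have c0: "c0 > 0" by (simp add: c0_def)
  obtain \<gamma> C1 \<rho>1 where G: "0 < C1" "1 \<le> \<rho>1"
    "\<And>u. norm u \<ge> \<rho>1 \<Longrightarrow> Re u \<ge> - c * norm u \<Longrightarrow>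
       norm ((\<Prod>a\<in>UNIV. Gamma (u + b a)) - of_real c0 * exp (- (of_nat n * u + B - 1/2) * of_real (ln (real n))) *
           (Gamma (of_nat n * u + B) + \<gamma> * Gamma (of_nat n * u + (B - 1))))
         \<le> C1 / (norm u)\<^sup>2 * norm (exp ((of_nat n * u + B - 1/2) * Ln u - of_nat n * u))"
    unfolding n_def B_def c0_def
  proof (rule Gamma_product_asymptotics[OF c finite_class.finite_UNIV UNIV_not_empty, where b = b], goal_cases)
    case (1 \<gamma> C \<rho>)
    show ?case by (rule 1(1)[OF 1(2) 1(3) 1(4)])
  qed
  obtain K1 where K1: "K1 > 0" "\<And>\<rho> V F. \<rho> \<ge> 1 \<Longrightarrow> V \<ge> 0 \<Longrightarrow>
       continuous_on (closed_segment (of_real \<rho>) (of_real \<rho> + of_real (\<rho> * V) * d1)) F \<Longrightarrow>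
       (\<And>u v. 0 \<le> v \<Longrightarrow> u = of_real \<rho> * (1 + of_real v * d1) \<Longrightarrow>
          norm (F u) \<le> C1 / (norm u)\<^sup>2 * norm (exp ((of_nat n * u + (B - 1/2)) * Ln u - of_nat n * u
             - of_nat n * (of_real (ln \<rho>) + \<i> * of_real \<theta>) * u))) \<Longrightarrow>
       norm (contour_integral (linepath (of_real \<rho>) (of_real \<rho> + of_real (\<rho> * V) * d1)) F)
         \<le> K1 * \<rho> powr (Re (B - 1/2) - 1) * exp (- (real n * \<rho> * cos \<theta>))"
    using descent_leg_bound[OF d1(1) n less_imp_le[OF G(1)], of "B - 1/2"] by metis
  obtain K2 where K2: "K2 > 0" "\<And>\<rho> V F. \<rho> \<ge> 1 \<Longrightarrow> V \<ge> 0 \<Longrightarrow>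
       continuous_on (closed_segment (of_real \<rho>) (of_real \<rho> + of_real (\<rho> * V) * d2)) F \<Longrightarrow>
       (\<And>u v. 0 \<le> v \<Longrightarrow> u = of_real \<rho> * (1 + of_real v * d2) \<Longrightarrow>
          norm (F u) \<le> C1 / (norm u)\<^sup>2 * norm (exp ((of_nat n * u + (B - 1/2)) * Ln u - of_nat n * u
             - of_nat n * (of_real (ln \<rho>) + \<i> * of_real \<theta>) * u))) \<Longrightarrow>
       norm (contour_integral (linepath (of_real \<rho>) (of_real \<rho> + of_real (\<rho> * V) * d2)) F)
         \<le> K2 * \<rho> powr (Re (B - 1/2) - 1) * exp (- (real n * \<rho> * cos \<theta>))"
    using descent_leg_bound[OF d2(1) n less_imp_le[OF G(1)], of "B - 1/2"] by metis
  obtain X0 where X0: "X0 > 0" "\<And>k \<beta>. (k, \<beta>) \<in> range (\<lambda>a. (1::nat, Re (b a))) \<union> {(n, Re B), (n, Re (B - 1))} \<Longrightarrow>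
      real k * X0 - \<beta> \<notin> \<int> \<and> real k * X0 - \<beta> > 0"
    by (rule exists_generic_shift[of "range (\<lambda>a. (1::nat, Re (b a))) \<union> {(n, Re B), (n, Re (B - 1))}"]) (use n in auto)
  define Bd where "Bd = (\<Sum>a\<in>UNIV. norm (b a)) + norm B + norm (B - 1)"
  have Bd: "norm (b a) \<le> Bd" "norm B \<le> Bd" "norm (B - 1) \<le> Bd" for a
  proof -
    have "norm (b a) \<le> (\<Sum>a\<in>UNIV. norm (b a))" by (rule member_le_sum) auto
    moreover have "(\<Sum>a\<in>UNIV. norm (b a)) \<ge> 0" by (intro sum_nonneg) auto
    ultimately show "norm (b a) \<le> Bd" "norm B \<le> Bd" "norm (B - 1) \<le> Bd"
      unfolding Bd_def using norm_ge_zero[of B] norm_ge_zero[of "B - 1"] by linarith+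
  qed
  obtain \<rho>2 where \<rho>2: "\<rho>2 > 0" "\<And>\<rho> z. \<rho> \<ge> \<rho>2 \<Longrightarrow> Re z \<le> Bd \<Longrightarrow> \<bar>Im z\<bar> \<le> Bd \<Longrightarrow> z \<in> wedge \<rho> d1 d2"
    using wedge_contains_left_strip[OF nd(2) d1(2) nd(4) d2(2)] by blast
  have pole_wedge: "barnes_pole k e (a, r) \<in> wedge \<rho> d1 d2"
    if "\<rho> \<ge> \<rho>2" "k > 0" "norm (e a) \<le> Bd" for \<rho> k r a and e :: "'x \<Rightarrow> complex"
  proof (rule \<rho>2(2)[OF that(1)])
    have p: "barnes_pole k e (a, r) = of_real (- 1 / real k) * (e a + of_nat r)"
      by (simp add: barnes_pole_def add_divide_distrib diff_divide_distrib)
    have k1: "1 / real k \<le> 1" "1 / real k > 0" using that by auto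
    have "Re (barnes_pole k e (a, r)) = - ((1 / real k) * Re (e a)) - real r / real k"
      unfolding p by (simp add: add_divide_distrib)
    also have "\<dots> \<le> \<bar>(1 / real k) * Re (e a)\<bar>"
    proof -
      have "real r / real k \<ge> 0" by simp
      then show ?thesis by linarith
    qed
    also have "\<dots> \<le> 1 * norm (e a)"
      unfolding abs_mult using k1 abs_Re_le_cmod[of "e a"] by (intro mult_mono) auto
    finally show "Re (barnes_pole k e (a, r)) \<le> Bd" using that by simp
    have "\<bar>Im (barnes_pole k e (a, r))\<bar> = \<bar>1 / real k\<bar> * \<bar>Im (e a)\<bar>" unfolding p by simp
    also have "\<dots> \<le> 1 * norm (e a)"
      using k1 abs_Im_le_cmod[of "e a"] by (intro mult_mono) auto
    finally show "\<bar>Im (barnes_pole k e (a, r))\<bar> \<le> Bd" using that by simp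
  qed
  define mn where "mn = min \<bar>Im d1\<bar> \<bar>Im d2\<bar>"
  have mn: "mn > 0" using d1 d2 by (auto simp: mn_def)
  define \<rho>0 where "\<rho>0 = max 1 (max \<rho>2 (\<rho>1 / mn))"
  define c1 where "c1 = c0 / sqrt (real n)"
  have c1: "c1 > 0" using c0 n by (simp add: c1_def)
  define C where "C = (K1 + K2) / (c1 * exp (- \<bar>\<theta> * Im B\<bar>)) + norm \<gamma> + 1"
  have Cpos: "C > 0" unfolding C_def using K1 K2 c1 by (intro add_nonneg_pos add_nonneg_nonneg divide_nonneg_pos) auto
  show thesis
  proof (rule that[of C \<rho>0])
    show "C > 0" by (rule Cpos)
    show "\<rho>0 \<ge> 1" by (simp add: \<rho>0_def)
    fix \<rho> assume "\<rho> \<ge> \<rho>0"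
    then have \<rho>: "\<rho> \<ge> 1" "\<rho> \<ge> \<rho>2" "\<rho> \<ge> \<rho>1 / mn" by (auto simp: \<rho>0_def)
    have rp: "\<rho> > 0" using \<rho> by simp
    define l where "l = of_real (ln \<rho>) + \<i> * of_real \<theta>"
    define L where "L = of_nat n * l"
    define ln_n where "ln_n = complex_of_real (ln (real n))"
    define \<mu> where "\<mu> = L + of_nat n * ln_n"
    define Y where "Y = of_nat n * exp l"
    have n0: "of_nat n \<noteq> (0::complex)" using n by simp
    have expn: "exp ln_n = of_nat n" unfolding ln_n_def using n by (simp add: exp_of_real)
    have mun: "\<mu> / of_nat n = l + ln_n" using n0 by (simp add: \<mu>_def L_def field_simps)
    have Y: "Y = exp (\<mu> / of_nat n)" unfolding mun exp_add expn Y_def by simp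
    have Y0: "Y \<noteq> 0" using n0 by (simp add: Y_def)
    have nexp: "norm (exp l) = \<rho>" using rp by (simp add: l_def norm_exp_eq_Re)
    have nY: "norm Y = real n * \<rho>" unfolding Y_def norm_mult nexp by simp
    define k0 where "k0 = of_real c0 * exp (- (B - 1/2) * ln_n)"
    define f where "f = barnes (UNIV :: 'n set) 1 L b"
    define g1 where "g1 = barnes {()} n \<mu> (\<lambda>_. B)"
    define g2 where "g2 = barnes {()} n \<mu> (\<lambda>_. B - 1)"
    define F where "F = (\<lambda>u. f u - k0 * (g1 u + \<gamma> * g2 u))"
    define PU where "PU = (\<lambda>M. linepath (of_real \<rho>) (leg_end \<rho> (X0 + real M) d2))"
    define PD where "PD = (\<lambda>M. linepath (of_real \<rho>) (leg_end \<rho> (X0 + real M) d1))"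
    have rX: "\<rho> + X0 > 0" using rp X0 by simp
    have pole_f: "\<forall>a\<in>UNIV. \<forall>r. barnes_pole 1 b (a, r) \<in> wedge \<rho> d1 d2"
      by (intro ballI allI pole_wedge[OF \<rho>(2)]) (use Bd in auto)
    have pole_g1: "\<forall>a\<in>{()}. \<forall>r. barnes_pole n (\<lambda>_. B) (a, r) \<in> wedge \<rho> d1 d2"
      by (intro ballI allI pole_wedge[OF \<rho>(2) n]) (use Bd in auto)
    have pole_g2: "\<forall>a\<in>{()}. \<forall>r. barnes_pole n (\<lambda>_. B - 1) (a, r) \<in> wedge \<rho> d1 d2"
      by (intro ballI allI pole_wedge[OF \<rho>(2) n]) (use Bd in auto)
    have Xf: "\<forall>a\<in>UNIV. real 1 * X0 - Re (b a) \<notin> \<int> \<and> real 1 * X0 - Re (b a) > 0"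
      by (intro ballI X0(2)) simp
    have X1: "\<forall>a\<in>{()}. real n * X0 - Re B \<notin> \<int> \<and> real n * X0 - Re B > 0"
      by (intro ballI X0(2)) simp
    have X2: "\<forall>a\<in>{()}. real n * X0 - Re (B - 1) \<notin> \<int> \<and> real n * X0 - Re (B - 1) > 0"
      by (intro ballI X0(2)) simp
    have bf: "\<forall>a\<in>UNIV. \<forall>a'\<in>UNIV. a' \<noteq> a \<longrightarrow> b a' - b a \<notin> \<int>" using b by blast
    have bu: "\<forall>a\<in>{()}. \<forall>a'\<in>{()}. a' \<noteq> a \<longrightarrow> e - e \<notin> \<int>" for e :: complex by simp
    have fu: "finite {()}" "{()} \<noteq> {}" by auto
    note Rf = barnes_residue_sum[where \<mu> = L and b = b and A = UNIV and \<kappa> = 1,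
        OF zero_less_one finite_class.finite_UNIV UNIV_not_empty bf Xf rp rX nd(2) d1(2) nd(4) d2(2) pole_f, folded f_def]
    note Rg1 = barnes_residue_sum[where \<mu> = \<mu> and b = "\<lambda>_. B" and A = "{()}" and \<kappa> = n,
        OF n fu bu X1 rp rX nd(2) d1(2) nd(4) d2(2) pole_g1, folded g1_def]
    note Rg2 = barnes_residue_sum[where \<mu> = \<mu> and b = "\<lambda>_. B - 1" and A = "{()}" and \<kappa> = n,
        OF n fu bu X2 rp rX nd(2) d1(2) nd(4) d2(2) pole_g2, folded g2_def]
    have Tf: "(\<lambda>M. contour_integral (PU M) f - contour_integral (PD M) f) \<longlonglongrightarrow> 2 * of_real pi * \<i> * barnes_sum b L"
      unfolding PU_def PD_def barnes_sum_def using Rf(3) by simp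
    define s1 where "s1 = exp ((l + ln_n) * B) * exp (- Y) / of_nat n"
    define s2 where "s2 = exp ((l + ln_n) * (B - 1)) * exp (- Y) / of_nat n"
    have S1: "(\<Sum>a\<in>{()}. suminf (barnes_residue {()} n \<mu> (\<lambda>_. B) a)) = s1"
      using suminf_single_barnes_residue[OF n Y, of B] by (simp add: s1_def mun)
    have S2: "(\<Sum>a\<in>{()}. suminf (barnes_residue {()} n \<mu> (\<lambda>_. B - 1) a)) = s2"
      using suminf_single_barnes_residue[OF n Y, of "B - 1"] by (simp add: s2_def mun)
    have cD: "continuous_on (closed_segment (of_real \<rho>) (leg_end \<rho> (X0 + real M) d1)) F" for M
      unfolding F_def by (intro continuous_intros Rf Rg1 Rg2)
    have cU: "continuous_on (closed_segment (of_real \<rho>) (leg_end \<rho> (X0 + real M) d2)) F" for M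
      unfolding F_def by (intro continuous_intros Rf Rg1 Rg2)
    have split: "contour_integral P F = contour_integral P f - k0 * (contour_integral P g1 + \<gamma> * contour_integral P g2)"
      if "P = linepath p q" "continuous_on (closed_segment p q) f" "continuous_on (closed_segment p q) g1" "continuous_on (closed_segment p q) g2" for P p q
    proof -
      have i: "f contour_integrable_on P" "g1 contour_integrable_on P" "g2 contour_integrable_on P"
        unfolding that(1) by (rule contour_integrable_continuous_linepath[OF that(2)] contour_integrable_continuous_linepath[OF that(3)] contour_integrable_continuous_linepath[OF that(4)])+
      have "((\<lambda>u. f u - k0 * (g1 u + \<gamma> * g2 u)) has_contour_integral
          (contour_integral P f - k0 * (contour_integral P g1 + \<gamma> * contour_integral P g2))) P"
        by (intro has_contour_integral_diff has_contour_integral_lmul has_contour_integral_add has_contour_integral_integral i)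
      then show ?thesis unfolding F_def by (rule contour_integral_unique)
    qed
    have "(\<lambda>M. contour_integral (PU M) F - contour_integral (PD M) F) \<longlonglongrightarrow>
        2 * of_real pi * \<i> * barnes_sum b L - k0 * (2 * of_real pi * \<i> * s1 + \<gamma> * (2 * of_real pi * \<i> * s2))"
    proof -
      have eq: "contour_integral (PU M) F - contour_integral (PD M) F =
         (contour_integral (PU M) f - contour_integral (PD M) f) - k0 * ((contour_integral (PU M) g1 - contour_integral (PD M) g1)
           + \<gamma> * (contour_integral (PU M) g2 - contour_integral (PD M) g2))" for M
      proof -
        have 1: "contour_integral (PU M) F = contour_integral (PU M) f - k0 * (contour_integral (PU M) g1 + \<gamma> * contour_integral (PU M) g2)"
          by (rule split[OF _ Rf(2) Rg1(2) Rg2(2)]) (simp add: PU_def)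
        have 2: "contour_integral (PD M) F = contour_integral (PD M) f - k0 * (contour_integral (PD M) g1 + \<gamma> * contour_integral (PD M) g2)"
          by (rule split[OF _ Rf(1) Rg1(1) Rg2(1)]) (simp add: PD_def)
        show ?thesis unfolding 1 2 by (simp add: algebra_simps)
      qed
      show ?thesis unfolding eq
        using Tf Rg1(3)[unfolded S1] Rg2(3)[unfolded S2] unfolding PU_def PD_def
        by (intro tendsto_diff tendsto_mult tendsto_const tendsto_add)
    qed
    then have lim: "(\<lambda>M. contour_integral (PU M) F - contour_integral (PD M) F) \<longlonglongrightarrow>
        2 * of_real pi * \<i> * (barnes_sum b L - k0 * (s1 + \<gamma> * s2))"
      by (simp add: algebra_simps)
    define R where "R = \<rho> powr (Re (B - 1/2) - 1) * exp (- (real n * \<rho> * cos \<theta>))"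
    have Fb: "norm (F u) \<le> C1 / (norm u)\<^sup>2 * norm (exp ((of_nat n * u + (B - 1/2)) * Ln u - of_nat n * u
             - of_nat n * (of_real (ln \<rho>) + \<i> * of_real \<theta>) * u))"
      if "0 \<le> v" "u = of_real \<rho> * (1 + of_real v * d)" "d = d1 \<or> d = d2" for u v d
    proof -
      have dd: "norm d = 1" "Re d < 0" using that nd by auto
      have nu: "norm u = \<rho> * norm (1 + of_real v * d)" using that rp by (simp add: norm_mult)
      have "mn \<le> \<bar>Im d\<bar>" using that by (auto simp: mn_def)
      then have "mn \<le> norm (1 + of_real v * d)" using leg_geometry(1)[OF dd that(1)] by linarith
      then have "\<rho> * mn \<le> norm u" unfolding nu using rp by (intro mult_left_mono) auto
      then have u1: "norm u \<ge> \<rho>1" using \<rho>(3) mn by (simp add: pos_divide_le_eq)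
      have "Re (1 + of_real v * d) \<ge> - (- Re d) * norm (1 + of_real v * d)" by (rule leg_geometry(3)[OF dd that(1)])
      moreover have "(- Re d) * norm (1 + of_real v * d) \<le> c * norm (1 + of_real v * d)"
        using that by (intro mult_right_mono) (auto simp: c_def)
      ultimately have "Re (1 + of_real v * d) \<ge> - c * norm (1 + of_real v * d)" by simp
      then have "\<rho> * Re (1 + of_real v * d) \<ge> \<rho> * (- c * norm (1 + of_real v * d))" using rp by (intro mult_left_mono) auto
      then have u2: "Re u \<ge> - c * norm u" unfolding nu using that(2) by (simp add: mult_ac)
      have Fu: "F u = exp (- L * u) * ((\<Prod>a\<in>UNIV. Gamma (u + b a)) - of_real c0 * exp (- (of_nat n * u + B - 1/2) * ln_n) *
           (Gamma (of_nat n * u + B) + \<gamma> * Gamma (of_nat n * u + (B - 1))))"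
      proof -
        have e: "k0 * exp (- \<mu> * u) = exp (- L * u) * (of_real c0 * exp (- (of_nat n * u + B - 1/2) * ln_n))"
        proof -
          have "exp (- (B - 1/2) * ln_n) * exp (- \<mu> * u) = exp (- L * u) * exp (- (of_nat n * u + B - 1/2) * ln_n)"
            unfolding exp_add[symmetric] \<mu>_def by (rule arg_cong[of _ _ exp]) (simp add: algebra_simps)
          then show ?thesis unfolding k0_def by (simp add: mult_ac)
        qed
        have "k0 * (g1 u + \<gamma> * g2 u) = (k0 * exp (- \<mu> * u)) * (Gamma (of_nat n * u + B) + \<gamma> * Gamma (of_nat n * u + (B - 1)))"
          unfolding g1_def g2_def barnes_def by (simp add: algebra_simps)
        then show ?thesis unfolding F_def e f_def barnes_def by (simp add: algebra_simps)
      qed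
      have "norm (F u) \<le> norm (exp (- L * u)) * (C1 / (norm u)\<^sup>2 * norm (exp ((of_nat n * u + B - 1/2) * Ln u - of_nat n * u)))"
        unfolding Fu norm_mult ln_n_def by (intro mult_left_mono G(3) u1 u2) auto
      also have "\<dots> = C1 / (norm u)\<^sup>2 * norm (exp (- L * u) * exp ((of_nat n * u + B - 1/2) * Ln u - of_nat n * u))"
        by (simp add: norm_mult)
      also have "exp (- L * u) * exp ((of_nat n * u + B - 1/2) * Ln u - of_nat n * u) =
          exp ((of_nat n * u + (B - 1/2)) * Ln u - of_nat n * u - of_nat n * (of_real (ln \<rho>) + \<i> * of_real \<theta>) * u)"
        unfolding exp_add[symmetric] L_def l_def by (rule arg_cong[of _ _ exp]) (simp add: algebra_simps)
      finally show ?thesis .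
    qed
    have Vn: "(\<rho> + (X0 + real M)) / (\<rho> * (- Re d)) \<ge> 0" if "Re d < 0" for d M
      using that rp X0 by (intro divide_nonneg_pos mult_pos_pos) auto
    have bU: "norm (contour_integral (PU M) F) \<le> K2 * R" for M
      unfolding PU_def R_def leg_end_def mult.assoc[symmetric]
      by (rule K2(2)[OF \<rho>(1) Vn[OF nd(4)] cU[unfolded leg_end_def]]) (rule Fb, auto)
    have bD: "norm (contour_integral (PD M) F) \<le> K1 * R" for M
      unfolding PD_def R_def leg_end_def mult.assoc[symmetric]
      by (rule K1(2)[OF \<rho>(1) Vn[OF nd(2)] cD[unfolded leg_end_def]]) (rule Fb, auto)
    have "norm (contour_integral (PU M) F - contour_integral (PD M) F) \<le> (K1 + K2) * R" for M
      using norm_triangle_ineq4[of "contour_integral (PU M) F" "contour_integral (PD M) F"] bU[of M] bD[of M]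
      unfolding distrib_right by linarith
    then have "norm (2 * of_real pi * \<i> * (barnes_sum b L - k0 * (s1 + \<gamma> * s2))) \<le> (K1 + K2) * R"
      by (intro LIMSEQ_le_const2[OF tendsto_norm[OF lim]]) auto
    then have diff: "2 * pi * norm (barnes_sum b L - k0 * (s1 + \<gamma> * s2)) \<le> (K1 + K2) * R"
      by (simp add: norm_mult)
    define lead where "lead = barnes_lead n B l"
    have k0s1: "k0 * s1 = lead"
    proof -
      have "exp (- (B - 1/2) * ln_n) * exp ((l + ln_n) * B) = exp (B * l) * exp (ln_n / 2)"
        unfolding exp_add[symmetric] by (rule arg_cong[of _ _ exp]) (simp add: algebra_simps)
      then have "k0 * s1 = of_real c0 * (exp (B * l) * exp (ln_n / 2)) * exp (- Y) / of_nat n"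
        unfolding k0_def s1_def by (simp add: mult_ac)
      also have "exp (ln_n / 2) = of_real (sqrt (real n))"
      proof -
        have "exp (ln (real n) / 2) = sqrt (real n)" using n by (simp add: ln_sqrt[symmetric])
        then have "complex_of_real (exp (ln (real n) / 2)) = of_real (sqrt (real n))" by simp
        then show ?thesis by (simp add: ln_n_def exp_of_real[symmetric])
      qed
      also have "of_real c0 * (exp (B * l) * of_real (sqrt (real n))) * exp (- Y) / of_nat n
         = of_real c0 * (of_real (sqrt (real n)) / of_nat n) * exp (B * l) * exp (- Y)" by simp
      also have "of_real (sqrt (real n)) / of_nat n = (1 / of_real (sqrt (real n)) :: complex)"
      proof -
        have "x / (x * x) = 1 / x" if "x > 0" for x :: real using that by simp
        from this[of "sqrt (real n)"] have "sqrt (real n) / real n = 1 / sqrt (real n)" using n by simp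
        then have "complex_of_real (sqrt (real n) / real n) = of_real (1 / sqrt (real n))" by simp
        then show ?thesis by simp
      qed
      finally show ?thesis by (simp add: lead_def barnes_lead_def Y_def c0_def)
    qed
    have s2s1: "s2 = s1 / Y"
    proof -
      have "exp ((l + ln_n) * (B - 1)) = exp ((l + ln_n) * B) / exp (l + ln_n)"
        unfolding exp_diff[symmetric] by (simp add: algebra_simps)
      also have "exp (l + ln_n) = Y" unfolding Y mun ..
      finally show ?thesis by (simp add: s1_def s2_def)
    qed
    have main: "k0 * (s1 + \<gamma> * s2) = lead + \<gamma> / Y * lead"
      unfolding s2s1 k0s1[symmetric] by (simp add: algebra_simps)
    have nlead: "norm lead = c1 * \<rho> powr (Re B) * exp (- (\<theta> * Im B)) * exp (- (real n * \<rho> * cos \<theta>))"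
    proof -
      have "norm (exp (B * l)) = exp (Re B * ln \<rho> - \<theta> * Im B)" by (simp add: norm_exp_eq_Re l_def algebra_simps)
      also have "\<dots> = \<rho> powr (Re B) * exp (- (\<theta> * Im B))" using rp by (simp add: exp_diff powr_def exp_minus field_simps)
      finally have 1: "norm (exp (B * l)) = \<rho> powr (Re B) * exp (- (\<theta> * Im B))" .
      have "Re (exp l) = \<rho> * cos \<theta>" using rp by (simp add: l_def Re_exp)
      then have 2: "norm (exp (- of_nat n * exp l)) = exp (- (real n * \<rho> * cos \<theta>))" by (simp add: norm_exp_eq_Re)
      show ?thesis unfolding lead_def barnes_lead_def norm_mult 1 2 norm_of_real c1_def using c0 by (simp add: c0_def)
    qed
    have RK: "(K1 + K2) * R \<le> (K1 + K2) / (c1 * exp (- \<bar>\<theta> * Im B\<bar>)) / \<rho> * norm lead"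
    proof -
      have "\<rho> powr (Re (B - 1/2) - 1) \<le> \<rho> powr (Re B - 1)" using \<rho> by (intro powr_mono) auto
      also have "\<dots> = \<rho> powr (Re B) / \<rho>" using rp by (simp add: powr_diff)
      finally have p: "\<rho> powr (Re (B - 1/2) - 1) \<le> \<rho> powr (Re B) / \<rho>" .
      have e1: "1 \<le> exp (- (\<theta> * Im B)) / exp (- \<bar>\<theta> * Im B\<bar>)"
        unfolding exp_diff[symmetric] by simp
      define E where "E = exp (- (real n * \<rho> * cos \<theta>))"
      have "R \<le> \<rho> powr (Re B) / \<rho> * E" unfolding R_def E_def using p by (intro mult_right_mono) auto
      also have "\<dots> = 1 * (\<rho> powr (Re B) / \<rho> * E)" by simp
      also have "\<dots> \<le> exp (- (\<theta> * Im B)) / exp (- \<bar>\<theta> * Im B\<bar>) * (\<rho> powr (Re B) / \<rho> * E)"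
        using e1 rp by (intro mult_right_mono) (auto simp: E_def)
      also have "\<dots> = norm lead / (c1 * exp (- \<bar>\<theta> * Im B\<bar>)) / \<rho>"
        unfolding nlead E_def[symmetric] using c1 by simp
      finally have "R \<le> norm lead / (c1 * exp (- \<bar>\<theta> * Im B\<bar>)) / \<rho>" .
      then have "(K1 + K2) * R \<le> (K1 + K2) * (norm lead / (c1 * exp (- \<bar>\<theta> * Im B\<bar>)) / \<rho>)"
        using K1 K2 by (intro mult_left_mono) auto
      then show ?thesis by simp
    qed
    have "norm (barnes_sum b L - lead) \<le> norm (barnes_sum b L - k0 * (s1 + \<gamma> * s2)) + norm (\<gamma> / Y * lead)"
      using norm_triangle_ineq[of "barnes_sum b L - k0 * (s1 + \<gamma> * s2)" "\<gamma> / Y * lead"] unfolding main by simp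
    also have "norm (barnes_sum b L - k0 * (s1 + \<gamma> * s2)) \<le> 2 * pi * norm (barnes_sum b L - k0 * (s1 + \<gamma> * s2))"
      using pi_gt3 mult_right_mono[of 1 "2 * pi" "norm (barnes_sum b L - k0 * (s1 + \<gamma> * s2))"] by simp
    also note diff
    also note RK
    also have "norm (\<gamma> / Y * lead) \<le> norm \<gamma> / \<rho> * norm lead"
    proof -
      have "\<rho> \<le> real n * \<rho>" using n rp by simp
      then have "norm \<gamma> / (real n * \<rho>) \<le> norm \<gamma> / \<rho>" using rp by (intro divide_left_mono) (auto simp: n)
      then show ?thesis unfolding norm_mult norm_divide nY by (intro mult_right_mono) auto
    qed
    finally have "norm (barnes_sum b L - lead) \<le>
        (K1 + K2) / (c1 * exp (- \<bar>\<theta> * Im B\<bar>)) / \<rho> * norm lead + norm \<gamma> / \<rho> * norm lead" by simp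
    also have "\<dots> = ((K1 + K2) / (c1 * exp (- \<bar>\<theta> * Im B\<bar>)) + norm \<gamma>) / \<rho> * norm lead"
      by (simp only: add_divide_distrib distrib_right)
    also have "\<dots> \<le> C / \<rho> * norm lead"
      unfolding C_def using rp by (intro mult_right_mono divide_right_mono) auto
    finally show "norm (barnes_sum b (of_nat n * (of_real (ln \<rho>) + \<i> * of_real \<theta>)) - barnes_lead n B (of_real (ln \<rho>) + \<i> * of_real \<theta>))
       \<le> C / \<rho> * norm (barnes_lead n B (of_real (ln \<rho>) + \<i> * of_real \<theta>))"
      unfolding lead_def L_def l_def .
  qed
qed

text \<open>Complex conjugation reduces negative angles \<open>\<theta>\<close> to positive ones.\<close>

lemma cnj_barnes_sum:
  fixes b :: "'n::finite \<Rightarrow> complex"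
  assumes b: "\<And>a a'. a' \<noteq> a \<Longrightarrow> b a' - b a \<notin> \<int>"
  shows "barnes_sum (\<lambda>a. cnj (b a)) (cnj L) = cnj (barnes_sum b L)"
proof -
  have "suminf (barnes_residue UNIV 1 (cnj L) (\<lambda>a. cnj (b a)) a) = cnj (suminf (barnes_residue UNIV 1 L b a))" for a
  proof -
    have "barnes_residue UNIV 1 (cnj L) (\<lambda>a. cnj (b a)) a = (\<lambda>r. cnj (barnes_residue UNIV 1 L b a r))"
      by (rule ext) (simp add: barnes_residue_def exp_cnj cnj_Gamma)
    moreover have "summable (barnes_residue UNIV 1 L b a)" by (rule summable_barnes_residue) (use b in auto)
    ultimately show ?thesis using bounded_linear.suminf[OF bounded_linear_cnj, of "barnes_residue UNIV 1 L b a"] by simp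
  qed
  then show ?thesis by (simp add: barnes_sum_def)
qed

theorem barnes_sum_asymptotics:
  fixes b :: "'n::finite \<Rightarrow> complex"
  assumes b: "\<And>a a'. a' \<noteq> a \<Longrightarrow> b a' - b a \<notin> \<int>"
    and th: "\<bar>\<theta>\<bar> < pi"
  defines "n \<equiv> CARD('n)" and "B \<equiv> (\<Sum>a\<in>UNIV. b a) - of_nat CARD('n) / 2 + 1/2"
  obtains C \<rho>0 :: real where "C > 0" "\<rho>0 \<ge> 1"
    "\<And>\<rho>. \<rho> \<ge> \<rho>0 \<Longrightarrow> norm (barnes_sum b (of_nat n * (of_real (ln \<rho>) + \<i> * of_real \<theta>)) - barnes_lead n B (of_real (ln \<rho>) + \<i> * of_real \<theta>))
       \<le> C / \<rho> * norm (barnes_lead n B (of_real (ln \<rho>) + \<i> * of_real \<theta>))"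
proof (cases "\<theta> \<ge> 0")
  case True
  have "\<theta> < pi" using th by simp
  from barnes_sum_asymptotics_upper[of b \<theta>, OF b True this] that show thesis
    unfolding n_def B_def by blast
next
  case False
  define b' where "b' = (\<lambda>a. cnj (b a))"
  have b': "b' a' - b' a \<notin> \<int>" if "a' \<noteq> a" for a a'
  proof
    assume "b' a' - b' a \<in> \<int>"
    then obtain j where "b' a' - b' a = of_int j" by (elim Ints_cases)
    then have "cnj (b' a' - b' a) = cnj (of_int j)" by (simp only:)
    then have "b a' - b a = of_int j" by (simp add: b'_def)
    then show False using b[OF that] by simp
  qed
  define B' where "B' = (\<Sum>a\<in>UNIV. b' a) - of_nat CARD('n) / 2 + 1/2"
  have B': "B' = cnj B" by (simp add: B'_def B_def b'_def)
  obtain C \<rho>0 where C: "C > 0" "\<rho>0 \<ge> 1"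
    "\<And>\<rho>. \<rho> \<ge> \<rho>0 \<Longrightarrow> norm (barnes_sum b' (of_nat n * (of_real (ln \<rho>) + \<i> * of_real (- \<theta>))) - barnes_lead n B' (of_real (ln \<rho>) + \<i> * of_real (- \<theta>)))
       \<le> C / \<rho> * norm (barnes_lead n B' (of_real (ln \<rho>) + \<i> * of_real (- \<theta>)))"
  proof -
    have "0 \<le> - \<theta>" "- \<theta> < pi" using th False by auto
    from barnes_sum_asymptotics_upper[of b' "- \<theta>", OF b' this] that show thesis
      unfolding n_def B'_def by blast
  qed
  show thesis
  proof (rule that[OF C(1,2)])
    fix \<rho> assume r: "\<rho> \<ge> \<rho>0"
    define l where "l = of_real (ln \<rho>) + \<i> * of_real \<theta>"
    have cl: "of_real (ln \<rho>) + \<i> * of_real (- \<theta>) = cnj l" by (simp add: l_def)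
    have 1: "barnes_sum b' (of_nat n * cnj l) = cnj (barnes_sum b (of_nat n * l))"
      using cnj_barnes_sum[where b = b and L = "of_nat n * l", OF b] by (simp add: b'_def)
    have 2: "barnes_lead n B' (cnj l) = cnj (barnes_lead n B l)"
      by (simp add: barnes_lead_def B' exp_cnj)
    have "norm (cnj (barnes_sum b (of_nat n * l) - barnes_lead n B l)) \<le> C / \<rho> * norm (cnj (barnes_lead n B l))"
      using C(3)[OF r] unfolding cl 1 2 by simp
    then show "norm (barnes_sum b (of_nat n * (of_real (ln \<rho>) + \<i> * of_real \<theta>)) - barnes_lead n B (of_real (ln \<rho>) + \<i> * of_real \<theta>))
       \<le> C / \<rho> * norm (barnes_lead n B (of_real (ln \<rho>) + \<i> * of_real \<theta>))"
      unfolding l_def[symmetric] complex_mod_cnj .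
  qed
qed

section \<open>The linear relation among the solutions\<close>

lemma laurent_eval_minus_one_power:
  assumes "\<And>a. Z a \<noteq> 0"
  shows "laurent_eval ((- 1) ^ i) Z = (- 1) ^ i"
proof -
  have "laurent_eval (- 1 + 1) Z = laurent_eval (- 1) Z + laurent_eval 1 Z" by (rule laurent_eval_add)
  then have m: "laurent_eval (- 1) Z = - 1" by (simp add: laurent_eval_zero laurent_eval_one eq_neg_iff_add_eq_0)
  show ?thesis
  proof (induction i)
    case (Suc i)
    show ?case unfolding power_Suc laurent_eval_mult[OF assms] m Suc ..
  qed (simp add: laurent_eval_one)
qed

lemma laurent_eval_esym:
  assumes "\<And>a. Z a \<noteq> 0"
  shows "laurent_eval (esym i) Z = (\<Sum>A | card A = i. \<Prod>a\<in>A. Z a)"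
proof -
  have single: "laurent_monom Z (Poly_Mapping.single a 1) = Z a" for a
  proof -
    have "(\<Prod>b\<in>UNIV. Z b powi Poly_Mapping.lookup (Poly_Mapping.single a 1) b) = (\<Prod>b\<in>UNIV. if b = a then Z b else 1)"
      by (intro prod.cong refl) (simp add: lookup_single when_def)
    then show ?thesis by (simp add: laurent_monom_def)
  qed
  have "laurent_monom Z (\<Sum>a\<in>A. Poly_Mapping.single a 1) = (\<Prod>a\<in>A. Z a)" for A :: "'a set"
    by (induction A rule: infinite_finite_induct)
      (simp_all add: laurent_monom_0 laurent_monom_add[OF assms] single)
  then show ?thesis by (simp add: esym_def laurent_eval_sum laurent_eval_single)
qed

definition signed_esym :: "complex ^ 'n::finite \<Rightarrow> nat \<Rightarrow> complex" where
  "signed_esym z i = laurent_eval ((- 1) ^ i * esym i) (Zacute z)"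

lemma Zacute_nonzero [simp]: "Zacute z a \<noteq> 0"
  by (simp add: Zacute_def)

lemma signed_esym_eq: "signed_esym z i = (- 1) ^ i * (\<Sum>A | card A = i. \<Prod>a\<in>A. Zacute z a)"
  by (simp add: signed_esym_def laurent_eval_mult laurent_eval_minus_one_power laurent_eval_esym)

lemma signed_esym_0 [simp]: "signed_esym z 0 = 1"
proof -
  have "{A :: 'a set. card A = 0} = {{}}" by auto
  then show ?thesis by (simp add: signed_esym_eq)
qed

lemma signed_esym_top: "signed_esym (z :: complex ^ 'n::finite) CARD('n) = (- 1) ^ CARD('n) * exp (2 * of_real pi * \<i> * (\<Sum>a\<in>UNIV. z $ a))"
proof -
  have "{A :: 'n set. card A = CARD('n)} = {UNIV}" using card_subset_eq[of "UNIV :: 'n set"] by auto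
  then show ?thesis by (simp add: signed_esym_eq Zacute_def exp_sum sum_distrib_left)
qed

lemma signed_esym_generating:
  fixes z :: "complex ^ 'n::finite"
  shows "(\<Sum>i=0..CARD('n). signed_esym z i * w ^ i) = (\<Prod>a\<in>UNIV. 1 - w * Zacute z a)"
proof -
  have "(\<Prod>a\<in>UNIV. 1 - w * Zacute z a) = (\<Prod>a\<in>UNIV. - (w * Zacute z a) + 1)" by simp
  also have "\<dots> = (\<Sum>A\<in>Pow UNIV. (\<Prod>a\<in>A. - (w * Zacute z a)) * (\<Prod>a\<in>UNIV-A. 1))"
    by (rule prod_add) simp
  also have "\<dots> = (\<Sum>A\<in>UNIV. (- w) ^ card A * (\<Prod>a\<in>A. Zacute z a))"
  proof (simp, intro sum.cong refl)
    fix A :: "'n set"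
    have "(\<Prod>a\<in>A. - (w * Zacute z a)) = (\<Prod>a\<in>A. (- w) * Zacute z a)" by simp
    also have "\<dots> = (- w) ^ card A * (\<Prod>a\<in>A. Zacute z a)" unfolding prod.distrib by simp
    finally show "(\<Prod>a\<in>A. - (w * Zacute z a)) = (- w) ^ card A * (\<Prod>a\<in>A. Zacute z a)" .
  qed
  also have "\<dots> = (\<Sum>i\<in>{0..CARD('n)}. \<Sum>A\<in>{A. A \<in> UNIV \<and> card A = i}. (- w) ^ card A * (\<Prod>a\<in>A. Zacute z a))"
    by (rule sum.group[symmetric]) (auto simp: card_mono)
  also have "\<dots> = (\<Sum>i=0..CARD('n). signed_esym z i * w ^ i)"
  proof (rule sum.cong[OF refl])
    fix i
    have "(\<Sum>A\<in>{A. A \<in> UNIV \<and> card A = i}. (- w) ^ card A * (\<Prod>a\<in>A. Zacute z a)) =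
        (\<Sum>A | card A = i. ((- 1) ^ i * w ^ i) * (\<Prod>a\<in>A. Zacute z a))"
      by (intro sum.cong) (auto simp: power_minus[of w])
    also have "\<dots> = signed_esym z i * w ^ i"
      unfolding sum_distrib_left[symmetric] signed_esym_eq by (simp only: mult_ac)
    finally show "(\<Sum>A\<in>{A. A \<in> UNIV \<and> card A = i}. (- w) ^ card A * (\<Prod>a\<in>A. Zacute z a)) = signed_esym z i * w ^ i" .
  qed
  finally show ?thesis by simp
qed

text \<open>The contribution of \<open>z\<^sub>J\<close> to \<open>\<Psi>\<^bsup>M - i\<^esup>\<close> is \<open>Z\<^sub>J\<^bsup>-i\<^esup>\<close> times that to \<open>\<Psi>\<^sup>M\<close>, and
  \<open>\<Sum>\<^sub>i (-1)\<^sup>i s\<^sub>i Z\<^sub>J\<^bsup>-i\<^esup> = \<Prod>\<^sub>a (1 - Z\<^sub>a / Z\<^sub>J) = 0\<close>.\<close>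

lemma Psi_relation:
  fixes z :: "complex ^ 'n::finite"
  shows "(\<Sum>i=0..CARD('n). signed_esym z i *s Psi (M - int i) lp z) = 0"
proof (cases "z \<in> Ldom")
  case True
  define P where "P = (\<lambda>I J. Psi_comp J lp (restr_roots z I) z)"
  have Psi: "Psi (M - int i) lp z $ I = (\<Sum>J\<in>UNIV. exp (2 * of_real pi * \<i> * of_int (M - 1) * z $ J) * inverse (Zacute z J) ^ i * P I J)" for i I
  proof -
    have "exp (2 * of_real pi * \<i> * of_int (M - int i - 1) * z $ J) = exp (2 * of_real pi * \<i> * of_int (M - 1) * z $ J) * inverse (Zacute z J) ^ i" for J
    proof -
      have "inverse (Zacute z J) ^ i = exp (- (of_nat i * (2 * of_real pi * \<i> * z $ J)))"
        by (simp add: Zacute_def exp_of_nat_mult exp_minus power_inverse)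
      then show ?thesis by (simp add: exp_add[symmetric] algebra_simps)
    qed
    then show ?thesis using True by (simp add: Psi_def hfun_of_def P_def)
  qed
  show ?thesis
  proof (rule vec_eq_iff[THEN iffD2], rule allI)
    fix I
    have "(\<Sum>i=0..CARD('n). signed_esym z i *s Psi (M - int i) lp z) $ I =
       (\<Sum>i=0..CARD('n). \<Sum>J\<in>UNIV. exp (2 * of_real pi * \<i> * of_int (M - 1) * z $ J) * P I J * (signed_esym z i * inverse (Zacute z J) ^ i))"
      by (simp add: Psi sum_distrib_left mult_ac)
    also have "\<dots> = (\<Sum>J\<in>UNIV. exp (2 * of_real pi * \<i> * of_int (M - 1) * z $ J) * P I J * (\<Sum>i=0..CARD('n). signed_esym z i * inverse (Zacute z J) ^ i))"
      by (subst sum.swap) (simp add: sum_distrib_left)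
    also have "\<dots> = 0"
    proof (intro sum.neutral ballI)
      fix J :: 'n
      have "(\<Prod>a\<in>UNIV. 1 - inverse (Zacute z J) * Zacute z a) = 0"
        by (rule prod_zero[OF finite_class.finite_UNIV]) (rule bexI[of _ J], auto)
      then show "exp (2 * of_real pi * \<i> * of_int (M - 1) * z $ J) * P I J * (\<Sum>i=0..CARD('n). signed_esym z i * inverse (Zacute z J) ^ i) = 0"
        unfolding signed_esym_generating by simp
    qed
    finally show "(\<Sum>i=0..CARD('n). signed_esym z i *s Psi (M - int i) lp z) $ I = 0 $ I" by simp
  qed
qed (simp add: Psi_def hfun_of_def)

section \<open>The solutions as sums of residues\<close>

text \<open>Absorbing the weight \<open>W\<close> into the Gamma functions shifts every parameter except the \<open>I\<close>-th by one.\<close>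

definition shifted_params :: "complex ^ 'n::finite \<Rightarrow> 'n \<Rightarrow> 'n \<Rightarrow> complex" where
  "shifted_params z I a = (if a = I then z $ a else z $ a + 1)"

lemma shifted_params_generic:
  assumes "z \<in> Ldom" "a' \<noteq> a"
  shows "shifted_params z I a' - shifted_params z I a \<notin> \<int>"
proof
  assume int: "shifted_params z I a' - shifted_params z I a \<in> \<int>"
  have "z $ a' - z $ a = (shifted_params z I a' - shifted_params z I a) + (if a' = I then 0 else - 1) + (if a = I then 0 else 1)"
    by (simp add: shifted_params_def)
  also have "\<dots> \<in> \<int>" using int by (intro Ints_add) auto
  finally show False using assms by (auto simp: Ldom_def)
qed

lemma W_restr_roots: "W t (restr_roots z I) = (\<Prod>a\<in>UNIV - {I}. z $ a - t)"
  by (simp add: W_def restr_roots_def image_mset.compositionality o_def prod_unfold_prod_mset[symmetric])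

text \<open>Only the \<open>J\<close>-th Gamma function has a pole at \<open>z\<^sub>J + r\<close>.\<close>

lemma Psi_comp_residue:
  fixes z :: "complex ^ 'n::finite"
  assumes z: "z \<in> Ldom"
  shows "residue (\<lambda>t. Phi t lp z * W t (restr_roots z I)) (z $ J + of_nat r) =
     - (exp ((z $ J + of_nat r) * (of_real pi * \<i> * (2 - of_nat CARD('n)) + lp)) * ((- 1) ^ r / fact r) *
       (\<Prod>a\<in>UNIV - {I}. z $ a - (z $ J + of_nat r)) * (\<Prod>a\<in>UNIV - {J}. Gamma (z $ a - (z $ J + of_nat r))))"
proof -
  define g where "g = (\<lambda>t. exp (t * (of_real pi * \<i> * (2 - of_nat CARD('n)) + lp)) * (\<Prod>a\<in>UNIV - {I}. z $ a - t) * (\<Prod>a\<in>UNIV - {J}. Gamma (z $ a - t)))"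
  define s where "s = (\<Inter>a\<in>UNIV - {J}. {t. z $ a - t \<notin> \<int>\<^sub>\<le>\<^sub>0})"
  have F: "(\<lambda>t. Phi t lp z * W t (restr_roots z I)) = (\<lambda>t. g t * Gamma (- 1 * t + z $ J))"
  proof
    fix t
    have "(\<Prod>a\<in>UNIV. Gamma (z $ a - t)) = Gamma (z $ J - t) * (\<Prod>a\<in>UNIV - {J}. Gamma (z $ a - t))"
      by (rule prod.remove) auto
    then show "Phi t lp z * W t (restr_roots z I) = g t * Gamma (- 1 * t + z $ J)"
      by (simp add: Phi_def W_restr_roots g_def mult_ac)
  qed
  have op: "open s" unfolding s_def
  proof (intro open_INT ballI)
    fix a
    have "{t. z $ a - t \<notin> \<int>\<^sub>\<le>\<^sub>0} = (\<lambda>t. z $ a - t) -` (- \<int>\<^sub>\<le>\<^sub>0)" by auto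
    moreover have "open \<dots>" by (intro open_vimage open_Compl closed_nonpos_Ints continuous_intros)
    ultimately show "open {t. z $ a - t \<notin> \<int>\<^sub>\<le>\<^sub>0}" by simp
  qed simp
  have mem: "z $ J + of_nat r \<in> s" unfolding s_def
  proof (intro INT_I CollectI)
    fix a assume a: "a \<in> UNIV - {J}"
    show "z $ a - (z $ J + of_nat r) \<notin> \<int>\<^sub>\<le>\<^sub>0"
    proof
      assume "z $ a - (z $ J + of_nat r) \<in> \<int>\<^sub>\<le>\<^sub>0"
      then have "z $ a - (z $ J + of_nat r) + of_nat r \<in> \<int>" by (meson Ints_add Ints_of_nat nonpos_Ints_Int)
      then show False using z a by (auto simp: Ldom_def)
    qed
  qed
  have hol: "g holomorphic_on s" unfolding g_def s_def by (intro holomorphic_intros) auto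
  have "residue (\<lambda>t. Phi t lp z * W t (restr_roots z I)) (z $ J + of_nat r) = g (z $ J + of_nat r) * ((- 1) ^ r / (fact r * (- 1)))"
    unfolding F by (rule residue_mult_Gamma[OF op mem hol]) auto
  then show ?thesis by (simp add: g_def mult_ac)
qed

text \<open>For \<open>J \<noteq> I\<close> the factor \<open>z\<^sub>J - t\<close> of the weight cancels the residue at \<open>t = z\<^sub>J\<close>, and the residue at
  \<open>z\<^sub>J + r + 1\<close> is the \<open>r\<close>-th one for the parameter \<open>z\<^sub>J + 1\<close>.  The factor \<open>exp (2 \<pi> \<i> (M - 1) z\<^sub>J)\<close> of the
  definition of \<open>\<Psi>\<^sup>M\<close> is constant along the series because \<open>exp (2 \<pi> \<i> r) = 1\<close>; it is absorbed by the
  shift of \<open>log p\<close>.\<close>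

lemma Psi_eq_barnes_sum:
  fixes z :: "complex ^ 'n::finite"
  assumes z: "z \<in> Ldom"
  shows "Psi M lp z $ I = barnes_sum (shifted_params z I) (lp + of_real pi * \<i> * of_int (2 * M - int CARD('n)))"
proof -
  define b where "b = shifted_params z I"
  define L where "L = lp + of_real pi * \<i> * of_int (2 * M - int CARD('n))"
  define c where "c = (\<lambda>J r. exp (L * (z $ J + of_nat r)) * ((- 1) ^ r / fact r) *
       (\<Prod>a\<in>UNIV - {I}. z $ a - (z $ J + of_nat r)) * (\<Prod>a\<in>UNIV - {J}. Gamma (z $ a - (z $ J + of_nat r))))"
  have summ: "summable (barnes_residue UNIV 1 L b J)" for J
  proof (rule summable_barnes_residue)
    fix a a' :: 'n assume "a' \<noteq> a"
    then show "b a' - b a \<notin> \<int>" unfolding b_def by (rule shifted_params_generic[OF z])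
  qed auto
  have G1: "(z $ a - (z $ J + of_nat r)) * Gamma (z $ a - (z $ J + of_nat r)) = Gamma (z $ a + 1 - (z $ J + of_nat r))" if "a \<noteq> J" for a J r
  proof -
    have "z $ a - (z $ J + of_nat r) \<notin> \<int>\<^sub>\<le>\<^sub>0"
    proof
      assume "z $ a - (z $ J + of_nat r) \<in> \<int>\<^sub>\<le>\<^sub>0"
      then have "z $ a - (z $ J + of_nat r) + of_nat r \<in> \<int>" by (meson Ints_add Ints_of_nat nonpos_Ints_Int)
      then show False using z that by (auto simp: Ldom_def)
    qed
    from Gamma_plus1[OF this] show ?thesis by (simp add: algebra_simps)
  qed
  have cI: "c I r = barnes_residue UNIV 1 L b I r" for r
  proof -
    have "(\<Prod>a\<in>UNIV - {I}. z $ a - (z $ I + of_nat r)) * (\<Prod>a\<in>UNIV - {I}. Gamma (z $ a - (z $ I + of_nat r))) = (\<Prod>a\<in>UNIV - {I}. Gamma (b a - b I - of_nat r))"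
      unfolding prod.distrib[symmetric]
    proof (intro prod.cong refl)
      fix a assume a: "a \<in> UNIV - {I}"
      then have e: "b a - b I - of_nat r = z $ a + 1 - (z $ I + of_nat r)" by (simp add: b_def shifted_params_def)
      show "(z $ a - (z $ I + of_nat r)) * Gamma (z $ a - (z $ I + of_nat r)) = Gamma (b a - b I - of_nat r)"
        unfolding e using G1[of a I r] a by simp
    qed
    then show ?thesis by (simp add: c_def barnes_residue_def b_def shifted_params_def mult.assoc)
  qed
  have c0: "c J 0 = 0" if "J \<noteq> I" for J
  proof -
    have "(\<Prod>a\<in>UNIV - {I}. z $ a - (z $ J + of_nat 0)) = 0" using that by (intro prod_zero) auto
    then show ?thesis by (simp add: c_def)
  qed
  have cS: "c J (Suc r) = barnes_residue UNIV 1 L b J r" if J: "J \<noteq> I" for J r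
  proof -
    define t where "t = z $ J + of_nat (Suc r)"
    have p1: "(\<Prod>a\<in>UNIV - {I}. z $ a - t) = (z $ J - t) * (\<Prod>a\<in>UNIV - {I} - {J}. z $ a - t)"
      using J by (intro prod.remove) auto
    have p2: "(\<Prod>a\<in>UNIV - {J}. Gamma (z $ a - t)) = Gamma (z $ I - t) * (\<Prod>a\<in>UNIV - {J} - {I}. Gamma (z $ a - t))"
      using J by (intro prod.remove) auto
    have p3: "(\<Prod>a\<in>UNIV - {J}. Gamma (b a - b J - of_nat r)) = Gamma (b I - b J - of_nat r) * (\<Prod>a\<in>UNIV - {J} - {I}. Gamma (b a - b J - of_nat r))"
      using J by (intro prod.remove) auto
    have sets: "UNIV - {I} - {J} = UNIV - {J} - {I}" by auto
    have pI: "Gamma (b I - b J - of_nat r) = Gamma (z $ I - t)" using J by (simp add: b_def shifted_params_def t_def algebra_simps)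
    have pr: "(\<Prod>a\<in>UNIV - {J} - {I}. z $ a - t) * (\<Prod>a\<in>UNIV - {J} - {I}. Gamma (z $ a - t)) = (\<Prod>a\<in>UNIV - {J} - {I}. Gamma (b a - b J - of_nat r))"
      unfolding prod.distrib[symmetric]
    proof (intro prod.cong refl)
      fix a assume a: "a \<in> UNIV - {J} - {I}"
      have "b a - b J - of_nat r = z $ a + 1 - t" using a J by (simp add: b_def shifted_params_def t_def)
      then show "(z $ a - t) * Gamma (z $ a - t) = Gamma (b a - b J - of_nat r)"
        using G1[of a J "Suc r"] a by (simp only: t_def) auto
    qed
    have f: "((- 1) ^ Suc r / fact (Suc r)) * (z $ J - t) = (- 1) ^ r / (fact r :: complex)"
    proof -
      have "z $ J - t = - of_nat (Suc r)" by (simp add: t_def)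
      moreover have "(fact (Suc r) :: complex) = of_nat (Suc r) * fact r" by simp
      moreover have "of_nat (Suc r) \<noteq> (0 :: complex)" by (metis of_nat_eq_0_iff nat.distinct(1))
      ultimately show ?thesis by (simp del: of_nat_Suc fact_Suc)
    qed
    have e: "b J + of_nat r = t" using J by (simp add: b_def shifted_params_def t_def)
    have "c J (Suc r) = exp (L * t) * (((- 1) ^ Suc r / fact (Suc r)) * (z $ J - t)) * (Gamma (z $ I - t) *
        ((\<Prod>a\<in>UNIV - {J} - {I}. z $ a - t) * (\<Prod>a\<in>UNIV - {J} - {I}. Gamma (z $ a - t))))"
      unfolding c_def t_def[symmetric] p1 p2 sets by (simp only: mult_ac)
    also have "\<dots> = barnes_residue UNIV 1 L b J r"
      unfolding f pr pI[symmetric] p3[symmetric] barnes_residue_def e by simp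
    finally show ?thesis .
  qed
  have suminf_c: "suminf (c J) = suminf (barnes_residue UNIV 1 L b J)" for J
  proof (cases "J = I")
    case True
    then show ?thesis using cI by presburger
  next
    case False
    have "c J \<circ> Suc = barnes_residue UNIV 1 L b J" using cS[OF False] by auto
    then have eq: "(\<lambda>r. c J (Suc r)) = barnes_residue UNIV 1 L b J" by (simp add: o_def)
    then have "summable (\<lambda>r. c J (Suc r))" using summ by simp
    then have "summable (c J)" by (simp only: summable_Suc_iff)
    from suminf_split_head[OF this] show ?thesis using eq c0[OF False] by simp
  qed
  have "exp (2 * of_real pi * \<i> * of_int (M - 1) * z $ J) * Psi_comp J lp (restr_roots z I) z = suminf (c J)" for J
  proof -
    define R where "R = (\<lambda>r. exp ((z $ J + of_nat r) * (of_real pi * \<i> * (2 - of_nat CARD('n)) + lp)) * ((- 1) ^ r / fact r) *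
       (\<Prod>a\<in>UNIV - {I}. z $ a - (z $ J + of_nat r)) * (\<Prod>a\<in>UNIV - {J}. Gamma (z $ a - (z $ J + of_nat r))))"
    define E where "E = exp (2 * of_real pi * \<i> * of_int (M - 1) * z $ J)"
    have E0: "E \<noteq> 0" by (simp add: E_def)
    have ER: "c J r = E * R r" for r
    proof -
      have "E * exp ((z $ J + of_nat r) * (of_real pi * \<i> * (2 - of_nat CARD('n)) + lp)) = exp (L * (z $ J + of_nat r))"
      proof -
        have "exp (2 * of_real pi * \<i> * of_int ((M - 1) * int r)) = (1 :: complex)"
          using exp_integer_2pi[of "of_int ((M - 1) * int r)"] by (simp add: mult_ac)
        then have "E * exp ((z $ J + of_nat r) * (of_real pi * \<i> * (2 - of_nat CARD('n)) + lp)) =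
           E * exp ((z $ J + of_nat r) * (of_real pi * \<i> * (2 - of_nat CARD('n)) + lp)) * exp (2 * of_real pi * \<i> * of_int ((M - 1) * int r))" by simp
        also have "\<dots> = exp (L * (z $ J + of_nat r))"
          unfolding E_def exp_add[symmetric] by (rule arg_cong[of _ _ exp]) (simp add: L_def algebra_simps)
        finally show ?thesis .
      qed
      then show ?thesis unfolding c_def R_def by (simp add: mult.assoc[symmetric])
    qed
    have "Psi_comp J lp (restr_roots z I) z = - suminf (\<lambda>r. - R r)"
      unfolding Psi_comp_def R_def Psi_comp_residue[OF z] ..
    moreover have "summable (c J)"
    proof (cases "J = I")
      case True
      then have "c J = barnes_residue UNIV 1 L b I" using cI by auto
      then show ?thesis using summ by simp
    next
      case False
      have "(\<lambda>r. c J (Suc r)) = barnes_residue UNIV 1 L b J" using cS[OF False] by auto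
      then have "summable (\<lambda>r. c J (Suc r))" using summ by simp
      then show ?thesis by (simp only: summable_Suc_iff)
    qed
    then have sR: "summable R"
    proof -
      have "R = (\<lambda>r. inverse E * c J r)" unfolding ER using E0 by (simp add: mult.assoc[symmetric])
      then show ?thesis using \<open>summable (c J)\<close> by (simp add: summable_mult)
    qed
    ultimately have "Psi_comp J lp (restr_roots z I) z = suminf R" by (simp add: suminf_minus)
    moreover have "suminf (c J) = E * suminf R" unfolding ER using sR by (rule suminf_mult)
    ultimately show ?thesis by (simp add: E_def)
  qed
  then have "Psi M lp z $ I = (\<Sum>J\<in>UNIV. suminf (c J))" using z by (simp add: Psi_def hfun_of_def)
  then show ?thesis unfolding suminf_c barnes_sum_def L_def b_def .
qed

section \<open>Leading terms and the asymptotics of one solution\<close>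

text \<open>The argument of \<open>- \<omega>\<^sup>M s\<close>.  With \<open>M = m + n l\<close> it is the branch with integer \<open>l\<close> for the label \<open>m\<close>, so that
  a single integer records both.\<close>

definition branch_arg :: "nat \<Rightarrow> int \<Rightarrow> real \<Rightarrow> real" where
  "branch_arg n M \<phi> = 2 * pi * of_int M / real n - pi - 2 * pi * \<phi>"

text \<open>The leading term with the product of the \<open>y\<^sub>j - \<omega>\<^sup>M s\<close> replaced by \<open>(- \<omega>\<^sup>M s)\<^bsup>n-1\<^esup>\<close>, which only changes the
  exponent of the power.\<close>

definition lead :: "complex ^ 'n::finite \<Rightarrow> int \<Rightarrow> real \<Rightarrow> real \<Rightarrow> complex" where
  "lead z M \<phi> r = barnes_lead CARD('n) ((\<Sum>a\<in>UNIV. z $ a) + (of_nat CARD('n) - 1) / 2)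
     (of_real (ln r) + \<i> * of_real (branch_arg CARD('n) M \<phi>))"

lemma norm_lead:
  obtains C where "C > 0"
    "\<And>r. r > 0 \<Longrightarrow> norm (lead (z :: complex ^ 'n::finite) M \<phi> r) =
       C * r powr Re ((\<Sum>a\<in>UNIV. z $ a) + (of_nat CARD('n) - 1) / 2) * exp (- (real CARD('n) * r * cos (branch_arg CARD('n) M \<phi>)))"
proof -
  define n where "n = CARD('n)"
  have n: "n > 0" by (simp add: n_def)
  define B where "B = (\<Sum>a\<in>UNIV. z $ a) + (of_nat n - 1) / 2"
  define \<theta> where "\<theta> = branch_arg n M \<phi>"
  define c where "c = (2 * pi) powr ((real n - 1) / 2) / sqrt (real n)"
  have c: "c > 0" using n by (simp add: c_def)
  show thesis
  proof (rule that[of "c * exp (- (Im B * \<theta>))"])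
    show "c * exp (- (Im B * \<theta>)) > 0" using c by simp
    fix r :: real assume r: "r > 0"
    define l where "l = of_real (ln r) + \<i> * of_real \<theta>"
    have "norm (exp (B * l)) = exp (Re B * ln r - Im B * \<theta>)" by (simp add: norm_exp_eq_Re l_def)
    also have "\<dots> = r powr Re B * exp (- (Im B * \<theta>))" using r by (simp add: exp_diff powr_def exp_minus field_simps)
    finally have 1: "norm (exp (B * l)) = r powr Re B * exp (- (Im B * \<theta>))" .
    have "Re (exp l) = r * cos \<theta>" using r by (simp add: l_def Re_exp)
    then have 2: "norm (exp (- of_nat n * exp l)) = exp (- (real n * r * cos \<theta>))" by (simp add: norm_exp_eq_Re)
    show "norm (lead z M \<phi> r) = c * exp (- (Im B * \<theta>)) * r powr Re ((\<Sum>a\<in>UNIV. z $ a) + (of_nat CARD('n) - 1) / 2) *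
         exp (- (real CARD('n) * r * cos (branch_arg CARD('n) M \<phi>)))"
      unfolding lead_def n_def[symmetric] B_def[symmetric] \<theta>_def[symmetric] l_def[symmetric] barnes_lead_def norm_mult 1 2 norm_of_real c_def[symmetric]
      using c by simp
  qed
qed

text \<open>The same power of \<open>r\<close> occurs in all leading terms; the real part of \<open>- n exp l\<close> decides.\<close>

lemma lead_dominates:
  fixes z :: "complex ^ 'n::finite"
  assumes "cos (branch_arg CARD('n) M' \<phi>) > cos (branch_arg CARD('n) M \<phi>)"
  shows "lead z M' \<phi> \<in> O[at_top](\<lambda>r. lead z M \<phi> r / of_real r)"
proof -
  define n where "n = CARD('n)"
  have n: "real n > 0" by (simp add: n_def)
  define B where "B = Re ((\<Sum>a\<in>UNIV. z $ a) + (of_nat n - 1) / 2)"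
  define \<delta> where "\<delta> = real n * (cos (branch_arg n M' \<phi>) - cos (branch_arg n M \<phi>))"
  have \<delta>: "\<delta> > 0" unfolding \<delta>_def using assms n by (simp add: n_def)
  obtain C where C: "C > 0" "\<And>r. r > 0 \<Longrightarrow> norm (lead z M \<phi> r) = C * r powr B * exp (- (real n * r * cos (branch_arg n M \<phi>)))"
    unfolding n_def B_def using norm_lead[of z M \<phi>] by metis
  obtain C' where C': "C' > 0" "\<And>r. r > 0 \<Longrightarrow> norm (lead z M' \<phi> r) = C' * r powr B * exp (- (real n * r * cos (branch_arg n M' \<phi>)))"
    unfolding n_def B_def using norm_lead[of z M' \<phi>] by metis
  have "((\<lambda>r::real. r * exp (- \<delta> * r)) \<longlongrightarrow> 0) at_top" using \<delta> by real_asymp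
  then have "\<forall>\<^sub>F r in at_top. r * exp (- \<delta> * r) < 1" by (rule order_tendstoD) simp
  then have "\<forall>\<^sub>F r in at_top. norm (lead z M' \<phi> r) \<le> (C' / C) * norm (lead z M \<phi> r / of_real r)"
    using eventually_gt_at_top[of 0]
  proof eventually_elim
    case (elim r)
    have e: "exp (- (real n * r * cos (branch_arg n M' \<phi>))) = exp (- \<delta> * r) * exp (- (real n * r * cos (branch_arg n M \<phi>)))"
      unfolding exp_add[symmetric] \<delta>_def by (simp add: algebra_simps)
    have d: "exp (- \<delta> * r) \<le> 1 / r" using elim by (simp add: field_simps)
    define X where "X = exp (- (real n * r * cos (branch_arg n M \<phi>)))"
    have X: "X > 0" by (simp add: X_def)
    have "norm (lead z M' \<phi> r) = C' * r powr B * X * exp (- \<delta> * r)"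
      unfolding C'(2)[OF elim(2)] e X_def by simp
    also have "\<dots> \<le> C' * r powr B * X * (1 / r)"
      using d C'(1) X by (intro mult_left_mono) auto
    also have "\<dots> = (C' / C) * ((C * r powr B * X) / r)" using C(1) by simp
    also have "(C * r powr B * X) / r = norm (lead z M \<phi> r / of_real r)"
      using elim by (simp add: norm_divide C(2) X_def)
    finally show ?case .
  qed
  then show ?thesis by (rule bigoI)
qed

lemma lead_over_r: "(\<lambda>r. lead z M \<phi> r / of_real r) \<in> O[at_top](lead z M \<phi>)"
proof (rule bigoI[of _ 1])
  show "\<forall>\<^sub>F r in at_top. norm (lead z M \<phi> r / of_real r) \<le> 1 * norm (lead z M \<phi> r)"
    using eventually_ge_at_top[of 1]
  proof eventually_elim
    case (elim r)
    have "norm (lead z M \<phi> r) / r \<le> norm (lead z M \<phi> r) / 1" using elim by (intro divide_left_mono) auto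
    then show ?case using elim by (simp add: norm_divide)
  qed
qed

text \<open>Inside the sector the Mellin--Barnes asymptotics apply directly.\<close>

lemma Psi_asymptotics:
  fixes z :: "complex ^ 'n::finite"
  assumes z: "z \<in> Ldom" and th: "\<bar>branch_arg CARD('n) M \<phi>\<bar> < pi"
  shows "(\<lambda>r. Psi M (log_p CARD('n) r \<phi>) z $ I - lead z M \<phi> r) \<in> O[at_top](\<lambda>r. lead z M \<phi> r / of_real r)"
proof -
  define n where "n = CARD('n)"
  have n: "n > 0" by (simp add: n_def)
  define b where "b = shifted_params z I"
  have gen: "b a' - b a \<notin> \<int>" if "a' \<noteq> a" for a a' unfolding b_def by (rule shifted_params_generic[OF z that])
  have sb: "(\<Sum>a\<in>UNIV. b a) - of_nat CARD('n) / 2 + 1/2 = (\<Sum>a\<in>UNIV. z $ a) + (of_nat CARD('n) - 1) / 2"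
  proof -
    have "(\<Sum>a\<in>UNIV. b a) = b I + (\<Sum>a\<in>UNIV - {I}. b a)" by (rule sum.remove) auto
    also have "(\<Sum>a\<in>UNIV - {I}. b a) = (\<Sum>a\<in>UNIV - {I}. z $ a + 1)" by (intro sum.cong) (auto simp: b_def shifted_params_def)
    also have "\<dots> = (\<Sum>a\<in>UNIV - {I}. z $ a) + (of_nat CARD('n) - 1)"
      unfolding sum.distrib by (simp add: card_Diff_singleton of_nat_diff Suc_le_eq)
    also have "b I + \<dots> = (z $ I + (\<Sum>a\<in>UNIV - {I}. z $ a)) + (of_nat CARD('n) - 1)" by (simp add: b_def shifted_params_def)
    also have "z $ I + (\<Sum>a\<in>UNIV - {I}. z $ a) = (\<Sum>a\<in>UNIV. z $ a)" by (rule sum.remove[symmetric]) auto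
    finally have eq: "(\<Sum>a\<in>UNIV. b a) = (\<Sum>a\<in>UNIV. z $ a) + (of_nat CARD('n) - 1)" .
    show ?thesis unfolding eq by (simp add: field_simps)
  qed
  obtain C \<rho>0 where C: "C > 0" "\<rho>0 \<ge> 1"
    "\<And>\<rho>. \<rho> \<ge> \<rho>0 \<Longrightarrow> norm (barnes_sum b (of_nat CARD('n) * (of_real (ln \<rho>) + \<i> * of_real (branch_arg CARD('n) M \<phi>))) - lead z M \<phi> \<rho>)
       \<le> C / \<rho> * norm (lead z M \<phi> \<rho>)"
    using barnes_sum_asymptotics[where b = b and \<theta> = "branch_arg CARD('n) M \<phi>", OF gen th] unfolding sb lead_def[symmetric] by blast
  have "\<forall>\<^sub>F r in at_top. norm (Psi M (log_p CARD('n) r \<phi>) z $ I - lead z M \<phi> r) \<le> C * norm (lead z M \<phi> r / of_real r)"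
    using eventually_ge_at_top[of \<rho>0] eventually_ge_at_top[of 1]
  proof eventually_elim
    case (elim r)
    have "log_p CARD('n) r \<phi> + of_real pi * \<i> * of_int (2 * M - int CARD('n)) = of_nat CARD('n) * (of_real (ln r) + \<i> * of_real (branch_arg CARD('n) M \<phi>))"
      using n by (simp add: log_p_def branch_arg_def n_def[symmetric] field_simps)
    then have "Psi M (log_p CARD('n) r \<phi>) z $ I = barnes_sum b (of_nat CARD('n) * (of_real (ln r) + \<i> * of_real (branch_arg CARD('n) M \<phi>)))"
      unfolding Psi_eq_barnes_sum[OF z] b_def by simp
    then show ?case using C(3)[OF elim(1)] elim by (simp add: norm_divide)
  qed
  then show ?thesis by (rule bigoI)
qed

lemma Psi_bigo_lead:
  fixes z :: "complex ^ 'n::finite"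
  assumes z: "z \<in> Ldom" and th: "\<bar>branch_arg CARD('n) M \<phi>\<bar> < pi"
  shows "(\<lambda>r. Psi M (log_p CARD('n) r \<phi>) z $ I) \<in> O[at_top](lead z M \<phi>)"
proof -
  have "(\<lambda>r. (Psi M (log_p CARD('n) r \<phi>) z $ I - lead z M \<phi> r) + lead z M \<phi> r) \<in> O[at_top](lead z M \<phi>)"
    by (intro sum_in_bigo landau_o.big_trans[OF Psi_asymptotics[OF z th] lead_over_r] landau_o.big_refl)
  then show ?thesis by simp
qed

text \<open>The exponential is a single-valued function of \<open>s\<close>; only the power depends on the branch, and its
  exponent contains \<open>\<Sum>\<^sub>a z\<^sub>a\<close>, whence the factor \<open>\<plusminus> s\<^sub>n\<close>.\<close>

lemma lead_monodromy:
  fixes z :: "complex ^ 'n::finite"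
  shows "- signed_esym z CARD('n) * lead z (M - int CARD('n)) \<phi> r = lead z M \<phi> r"
proof -
  define n where "n = CARD('n)"
  have n: "n > 0" by (simp add: n_def)
  define S where "S = (\<Sum>a\<in>UNIV. z $ a)"
  define B where "B = S + (of_nat n - 1) / 2"
  define l where "l = of_real (ln r) + \<i> * of_real (branch_arg n M \<phi>)"
  have arg: "branch_arg n (M - int n) \<phi> = branch_arg n M \<phi> - 2 * pi"
    using n by (simp add: branch_arg_def field_simps)
  have l': "of_real (ln r) + \<i> * of_real (branch_arg n (M - int n) \<phi>) = l - 2 * of_real pi * \<i>"
    unfolding arg l_def by (simp add: algebra_simps)
  have e: "exp (l - 2 * of_real pi * \<i>) = exp l"
    by (simp add: exp_diff)
  have "exp (2 * of_real pi * \<i> * S) * exp (B * (l - 2 * of_real pi * \<i>)) = exp (B * l) * exp (- (of_real pi * \<i> * (of_nat n - 1)))"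
    unfolding exp_add[symmetric] B_def by (rule arg_cong[of _ _ exp]) (simp add: field_simps)
  moreover have "exp (- (of_real pi * \<i> * (of_nat n - 1))) = - ((- 1 :: complex) ^ n)"
  proof -
    obtain k where k: "n = Suc k" using n by (cases n) auto
    have "exp (- (of_real pi * \<i> * (of_nat n - 1))) = exp (of_nat k * (- (of_real pi * \<i>)))" by (simp add: k algebra_simps)
    also have "\<dots> = exp (- (of_real pi * \<i>)) ^ k" by (rule exp_of_nat_mult)
    also have "exp (- (of_real pi * \<i>)) = (- 1 :: complex)" by (simp add: exp_minus)
    finally show ?thesis by (simp add: k)
  qed
  ultimately have x: "exp (2 * of_real pi * \<i> * S) * exp (B * (l - 2 * of_real pi * \<i>)) = - ((- 1) ^ n * exp (B * l))" by simp
  have top: "signed_esym z n = (- 1) ^ n * exp (2 * of_real pi * \<i> * S)"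
    unfolding n_def S_def by (rule signed_esym_top)
  have sq: "(- 1 :: complex) ^ n * (- 1) ^ n = 1" by (simp add: power_add[symmetric] mult_2[symmetric])
  have "- signed_esym z CARD('n) * lead z (M - int CARD('n)) \<phi> r =
      - ((- 1) ^ n) * of_real ((2 * pi) powr ((real n - 1) / 2) / sqrt (real n)) * (exp (2 * of_real pi * \<i> * S) * exp (B * (l - 2 * of_real pi * \<i>))) * exp (- of_nat n * exp l)"
    unfolding lead_def barnes_lead_def n_def[symmetric] top l' e S_def[symmetric] B_def[symmetric] by (simp add: mult_ac)
  also have "\<dots> = ((- 1) ^ n * (- 1) ^ n) * of_real ((2 * pi) powr ((real n - 1) / 2) / sqrt (real n)) * exp (B * l) * exp (- of_nat n * exp l)"
    unfolding x by (simp add: mult_ac)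
  also have "\<dots> = lead z M \<phi> r"
    unfolding sq lead_def barnes_lead_def n_def[symmetric] l_def[symmetric] S_def[symmetric] B_def[symmetric] by simp
  finally show ?thesis .
qed

text \<open>With \<open>e = - \<omega>\<^sup>M s\<close> the product is \<open>e\<^bsup>n-1\<^esup> \<Prod>\<^sub>a (1 + z\<^sub>a / e)\<close>.\<close>

lemma leading_term_lead:
  fixes z :: "complex ^ 'n::finite"
  shows "(\<lambda>r. leading_term m l r \<phi> (restr_roots z I) z - lead z (int m + int CARD('n) * l) \<phi> r)
     \<in> O[at_top](\<lambda>r. lead z (int m + int CARD('n) * l) \<phi> r / of_real r)"
proof -
  define n where "n = CARD('n)"
  have n: "n > 0" by (simp add: n_def)
  define M where "M = int m + int n * l"
  define \<theta> where "\<theta> = branch_arg n M \<phi>"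
  define e where "e = (\<lambda>r::real. of_real r * exp (\<i> * of_real \<theta>))"
  define P where "P = (\<lambda>r::real. \<Prod>a\<in>UNIV - {I}. 1 + z $ a / e r)"
  have th: "2 * pi * real m / real n - pi - 2 * pi * \<phi> + 2 * pi * of_int l = \<theta>"
    using n by (simp add: \<theta>_def branch_arg_def M_def field_simps)
  have ne: "norm (e r) = r" if "r > 0" for r using that by (simp add: e_def norm_mult)
  have eq: "leading_term m l r \<phi> (restr_roots z I) z = lead z M \<phi> r * P r" if r: "r > 0" for r
  proof -
    define L where "L = of_real (ln r) + \<i> * of_real \<theta>"
    have eL: "exp L = e r" using r by (simp add: L_def e_def exp_add exp_of_real)
    have ws: "omega n ^ m * s_of r \<phi> = - e r"
    proof -
      have "omega n ^ m = exp (of_nat m * (2 * of_real pi * \<i> / of_nat n))" unfolding omega_def by (rule exp_of_nat_mult[symmetric])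
      then have "omega n ^ m * s_of r \<phi> = of_real r * exp (of_nat m * (2 * of_real pi * \<i> / of_nat n) + (- 2 * of_real pi * \<i> * of_real \<phi>))"
        unfolding s_of_def exp_add by (simp only: mult_ac)
      also have "of_nat m * (2 * of_real pi * \<i> / of_nat n) + (- 2 * of_real pi * \<i> * of_real \<phi>) = \<i> * of_real \<theta> + of_real pi * \<i> - of_int l * (2 * of_real pi * \<i>)"
        unfolding th[symmetric] by (simp add: field_simps)
      also have "exp \<dots> = exp (\<i> * of_real \<theta>) * exp (of_real pi * \<i>) / exp (of_int l * (2 * of_real pi * \<i>))"
        by (simp only: exp_add exp_diff)
      also have "exp (of_int l * (2 * of_real pi * \<i>)) = (1 :: complex)" using exp_integer_2pi[of "of_int l"] by (simp add: mult_ac)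
      also have "exp (of_real pi * \<i>) = (- 1 :: complex)" by simp
      finally show ?thesis by (simp add: e_def)
    qed
    have br: "branch_power n m l r \<phi> x = exp (x * L)" for x
      unfolding branch_power_def th L_def ..
    have e0: "e r \<noteq> 0" using ne[OF r] r by auto
    have Pr: "(\<Prod>y\<in>#restr_roots z I. y - (- e r)) = e r ^ (n - 1) * P r"
    proof -
      have "(\<Prod>y\<in>#restr_roots z I. y - (- e r)) = (\<Prod>a\<in>UNIV - {I}. z $ a + e r)"
        using W_restr_roots[of "- e r" z I] by (simp add: W_def)
      also have "\<dots> = (\<Prod>a\<in>UNIV - {I}. e r * (1 + z $ a / e r))" using e0 by (intro prod.cong) (auto simp: field_simps)
      also have "\<dots> = e r ^ card (UNIV - {I}) * P r" unfolding prod.distrib P_def by simp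
      finally show ?thesis by (simp add: n_def card_Diff_singleton)
    qed
    have pw: "exp ((\<Sum>a\<in>UNIV. z $ a) * L + (1 - of_nat n) / 2 * L) * e r ^ (n - 1) = exp (((\<Sum>a\<in>UNIV. z $ a) + (of_nat n - 1) / 2) * L)"
    proof -
      have n1: "(of_nat (n - 1) :: complex) = of_nat n - 1" using n by (simp add: of_nat_diff)
      have er: "e r ^ (n - 1) = exp ((of_nat n - 1) * L)" unfolding eL[symmetric] n1[symmetric] by (rule exp_of_nat_mult[symmetric])
      show ?thesis unfolding er exp_add[symmetric] by (rule arg_cong[of _ _ exp]) (simp add: field_simps)
    qed
    have pw': "exp (((\<Sum>a\<in>UNIV. z $ a) + (1 - of_nat n) / 2) * L) * e r ^ (n - 1) = exp (((\<Sum>a\<in>UNIV. z $ a) + (of_nat n - 1) / 2) * L)"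
      using pw by (simp add: distrib_right)
    have "leading_term m l r \<phi> (restr_roots z I) z = of_real ((2 * pi) powr ((real n - 1) / 2) / sqrt (real n)) * exp (of_nat n * (- e r)) *
        exp (((\<Sum>a\<in>UNIV. z $ a) + (1 - of_nat n) / 2) * L) * (e r ^ (n - 1) * P r)"
      unfolding leading_term_def Let_def n_def[symmetric] ws br Pr ..
    also have "\<dots> = of_real ((2 * pi) powr ((real n - 1) / 2) / sqrt (real n)) * (exp (((\<Sum>a\<in>UNIV. z $ a) + (1 - of_nat n) / 2) * L) * e r ^ (n - 1)) * exp (of_nat n * (- e r)) * P r"
      by (simp only: mult_ac)
    also have "\<dots> = lead z M \<phi> r * P r"
      unfolding pw' lead_def barnes_lead_def n_def[symmetric] \<theta>_def[symmetric] L_def[symmetric] eL by simp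
    finally show ?thesis .
  qed
  have inv: "(\<lambda>r. 1 / e r) \<in> O[at_top](\<lambda>r. 1 / complex_of_real r)"
  proof (rule bigoI[of _ 1])
    show "\<forall>\<^sub>F r in at_top. norm (1 / e r) \<le> 1 * norm (1 / complex_of_real r)"
      using eventually_gt_at_top[of 0] by eventually_elim (simp add: norm_divide ne)
  qed
  have inv1: "(\<lambda>r::real. 1 / complex_of_real r) \<in> O[at_top](\<lambda>r. 1 :: complex)"
  proof (rule bigoI[of _ 1])
    show "\<forall>\<^sub>F r::real in at_top. norm (1 / complex_of_real r) \<le> 1 * norm (1 :: complex)"
      using eventually_ge_at_top[of 1] by eventually_elim (simp add: norm_divide)
  qed
  have "(\<lambda>r. (\<Prod>a\<in>A. 1 + z $ a / e r) - 1) \<in> O[at_top](\<lambda>r. 1 / complex_of_real r)" if "finite A" for A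
    using that
  proof (induction A rule: finite_induct)
    case (insert a A)
    define Q where "Q = (\<lambda>r. (\<Prod>a\<in>A. 1 + z $ a / e r) - 1)"
    have Q: "Q \<in> O[at_top](\<lambda>r. 1 / complex_of_real r)" using insert by (simp add: Q_def)
    have za: "(\<lambda>r. z $ a * (1 / e r)) \<in> O[at_top](\<lambda>r. 1 / complex_of_real r)" by (rule bigo_cmult[OF inv])
    have "(\<lambda>r. z $ a * (1 / e r) * Q r) \<in> O[at_top](\<lambda>r. 1 / complex_of_real r * 1)"
      by (intro landau_o.big.mult za landau_o.big_trans[OF Q inv1])
    then have zaQ: "(\<lambda>r. z $ a * (1 / e r) * Q r) \<in> O[at_top](\<lambda>r. 1 / complex_of_real r)" by simp
    have "(\<lambda>r. Q r + z $ a * (1 / e r) + z $ a * (1 / e r) * Q r) \<in> O[at_top](\<lambda>r. 1 / complex_of_real r)"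
      by (rule sum_in_bigo(1)[OF sum_in_bigo(1)[OF Q za] zaQ])
    moreover have "(\<lambda>r. Q r + z $ a * (1 / e r) + z $ a * (1 / e r) * Q r) = (\<lambda>r. (\<Prod>a\<in>insert a A. 1 + z $ a / e r) - 1)"
      using insert by (simp add: Q_def algebra_simps)
    ultimately show ?case by simp
  qed simp
  then have "(\<lambda>r. P r - 1) \<in> O[at_top](\<lambda>r. 1 / complex_of_real r)" by (simp add: P_def)
  then have "(\<lambda>r. lead z M \<phi> r * (P r - 1)) \<in> O[at_top](\<lambda>r. lead z M \<phi> r * (1 / complex_of_real r))"
    by (intro landau_o.big.mult landau_o.big_refl)
  then have main: "(\<lambda>r. lead z M \<phi> r * (P r - 1)) \<in> O[at_top](\<lambda>r. lead z M \<phi> r / of_real r)" by simp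
  have ev: "\<forall>\<^sub>F r in at_top. lead z M \<phi> r * (P r - 1) = leading_term m l r \<phi> (restr_roots z I) z - lead z M \<phi> r"
    using eventually_gt_at_top[of 0] by eventually_elim (simp add: eq algebra_simps)
  show ?thesis
    using main unfolding landau_o.big.in_cong[OF ev] by (simp add: M_def n_def)
qed

section \<open>Asymptotics of alternating partial sums\<close>

lemma lead_nonzero:
  fixes z :: "complex ^ 'n::finite"
  shows "lead z M \<phi> r \<noteq> 0"
proof -
  have "(2 * pi) powr ((real CARD('n) - 1) / 2) / sqrt (real CARD('n)) \<noteq> 0" by simp
  then show ?thesis unfolding lead_def barnes_lead_def by (simp del: of_real_divide)
qed

text \<open>Errors relative to \<open>lead\<close> and relative to \<open>leading_term\<close> are interchangeable, since these differ by
  a factor \<open>1 + O(1 / r)\<close>.\<close>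

lemma stokes_asymptoticsI:
  fixes f :: "'n::finite hfun"
  assumes f: "\<And>I. (\<lambda>r. f (log_p CARD('n) r \<phi>) z $ I - lead z (int m + int CARD('n) * l) \<phi> r)
      \<in> O[at_top](\<lambda>r. lead z (int m + int CARD('n) * l) \<phi> r / of_real r)"
  shows "stokes_asymptotics f m l \<phi> z"
proof -
  define L where "L = lead z (int m + int CARD('n) * l) \<phi>"
  define T where "T = (\<lambda>I r. leading_term m l r \<phi> (restr_roots z I) z)"
  define F where "F = (\<lambda>I r. f (log_p CARD('n) r \<phi>) z $ I)"
  have L0: "L r \<noteq> 0" for r unfolding L_def by (rule lead_nonzero)
  have TL: "(\<lambda>r. T I r - L r) \<in> O[at_top](\<lambda>r. L r / of_real r)" for I
    unfolding T_def L_def by (rule leading_term_lead)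
  have FL: "(\<lambda>r. F I r - L r) \<in> O[at_top](\<lambda>r. L r / of_real r)" for I
    unfolding F_def L_def by (rule f)
  have FT: "(\<lambda>r. F I r - T I r) \<in> O[at_top](\<lambda>r. L r / of_real r)" for I
  proof -
    have "(\<lambda>r. (F I r - L r) - (T I r - L r)) \<in> O[at_top](\<lambda>r. L r / of_real r)"
      by (rule sum_in_bigo(2)[OF FL TL])
    then show ?thesis by simp
  qed
  have half: "\<forall>\<^sub>F r in at_top. norm (L r) \<le> 2 * norm (T I r)" for I
  proof -
    obtain C where C: "C > 0" "\<forall>\<^sub>F r in at_top. norm (T I r - L r) \<le> C * norm (L r / of_real r)"
      using landau_o.bigE[OF TL[of I]] by blast
    show ?thesis using C(2) eventually_ge_at_top[of "2 * C"]
    proof eventually_elim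
      case (elim r)
      then have r: "r > 0" using C(1) by linarith
      have "C * norm (L r / of_real r) = (C / r) * norm (L r)" using r by (simp add: norm_divide)
      also have "\<dots> \<le> (1 / 2) * norm (L r)"
        using elim(2) r by (intro mult_right_mono) (auto simp: field_simps)
      finally have "norm (T I r - L r) \<le> (1 / 2) * norm (L r)" using elim(1) by linarith
      moreover have "norm (L r) \<le> norm (T I r) + norm (T I r - L r)" by (metis norm_triangle_sub norm_minus_commute)
      ultimately show ?case by linarith
    qed
  qed
  have ev: "\<forall>\<^sub>F r in at_top. \<forall>I. T I r \<noteq> 0"
  proof (rule eventually_all_finite)
    fix I show "\<forall>\<^sub>F r in at_top. T I r \<noteq> 0" using half[of I] by eventually_elim (use L0 in fastforce)
  qed
  define E where "E = (\<lambda>r. (\<chi> I. (F I r - T I r) / T I r))"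
  show ?thesis unfolding stokes_asymptotics_def
  proof (intro exI[of _ E] conjI allI)
    fix I
    obtain C where C: "C > 0" "\<forall>\<^sub>F r in at_top. norm (F I r - T I r) \<le> C * norm (L r / of_real r)"
      using landau_o.bigE[OF FT[of I]] by blast
    have "\<forall>\<^sub>F r in at_top. norm (E r $ I) \<le> (2 * C) * norm (1 / s_of r \<phi>)"
      using C(2) half[of I] eventually_gt_at_top[of 0]
    proof eventually_elim
      case (elim r)
      have T0: "norm (T I r) > 0" using elim(2) L0[of r] by (metis norm_le_zero_iff mult_zero_right zero_less_norm_iff norm_zero)
      have s: "norm (s_of r \<phi>) = r" using elim by (simp add: s_of_def norm_mult norm_exp_eq_Re)
      have "norm (F I r - T I r) \<le> (C / r) * norm (L r)" using elim(1,3) by (simp add: norm_divide)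
      also have "\<dots> \<le> (C / r) * (2 * norm (T I r))" using elim(2,3) C(1) by (intro mult_left_mono) auto
      finally have "norm (F I r - T I r) / norm (T I r) \<le> 2 * C / r" using T0 elim(3) by (simp add: field_simps)
      then show ?case by (simp add: E_def norm_divide s)
    qed
    then show "(\<lambda>r. E r $ I) \<in> O[at_top](\<lambda>r. 1 / s_of r \<phi>)" by (rule bigoI)
  next
    show "\<forall>\<^sub>F r in at_top. \<forall>I. f (log_p CARD('n) r \<phi>) z $ I = leading_term m l r \<phi> (restr_roots z I) z * (1 + E r $ I)"
      using ev
    proof eventually_elim
      case (elim r)
      show ?case
      proof
        fix I
        have "F I r = T I r * (1 + E r $ I)" using elim by (simp add: E_def field_simps)
        then show "f (log_p CARD('n) r \<phi>) z $ I = leading_term m l r \<phi> (restr_roots z I) z * (1 + E r $ I)"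
          by (simp add: F_def T_def)
      qed
    qed
  qed
qed

text \<open>The argument in units of \<open>\<pi> / n\<close>: the asymptotics of a single solution hold for \<open>|x| < n\<close>, and passing
  from \<open>M\<close> to \<open>M - 1\<close> lowers \<open>x\<close> by two.\<close>

definition branch_pos :: "nat \<Rightarrow> int \<Rightarrow> real \<Rightarrow> real" where
  "branch_pos n M \<phi> = 2 * of_int M - real n - 2 * real n * \<phi>"

lemma branch_arg_pos: "n > 0 \<Longrightarrow> branch_arg n M \<phi> = pi * branch_pos n M \<phi> / real n"
  by (simp add: branch_arg_def branch_pos_def field_simps)

lemma branch_pos_diff: "branch_pos n (M - int i) \<phi> = branch_pos n M \<phi> - 2 * real i"
  by (simp add: branch_pos_def)

lemma cos_less_of_abs_less:
  fixes x y n :: real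
  assumes "\<bar>y\<bar> < \<bar>x\<bar>" "\<bar>x\<bar> \<le> n"
  shows "cos (pi * x / n) < cos (pi * y / n)"
proof -
  have n: "n > 0" using assms by linarith
  have "cos (\<bar>pi * x / n\<bar>) < cos (\<bar>pi * y / n\<bar>)"
  proof (rule cos_monotone_0_pi)
    show "\<bar>pi * y / n\<bar> < \<bar>pi * x / n\<bar>" using assms n by (simp add: abs_mult divide_strict_right_mono)
    show "\<bar>pi * x / n\<bar> \<le> pi" using assms n by (simp add: abs_mult field_simps)
  qed simp
  then show ?thesis unfolding cos_abs_real .
qed

lemma Psi_abs_pos:
  fixes z :: "complex ^ 'n::finite"
  assumes z: "z \<in> Ldom" and x: "\<bar>branch_pos CARD('n) M \<phi>\<bar> < real CARD('n)"
  shows "(\<lambda>r. Psi M (log_p CARD('n) r \<phi>) z $ I - lead z M \<phi> r) \<in> O[at_top](\<lambda>r. lead z M \<phi> r / of_real r)"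
    and "(\<lambda>r. Psi M (log_p CARD('n) r \<phi>) z $ I) \<in> O[at_top](lead z M \<phi>)"
proof -
  have "\<bar>branch_arg CARD('n) M \<phi>\<bar> < pi"
    using x by (simp add: branch_arg_pos abs_mult field_simps)
  then show "(\<lambda>r. Psi M (log_p CARD('n) r \<phi>) z $ I - lead z M \<phi> r) \<in> O[at_top](\<lambda>r. lead z M \<phi> r / of_real r)"
    "(\<lambda>r. Psi M (log_p CARD('n) r \<phi>) z $ I) \<in> O[at_top](lead z M \<phi>)"
    by (rule Psi_asymptotics[OF z], rule Psi_bigo_lead[OF z])
qed

text \<open>On \<open>[-n, n]\<close> the cosine of \<open>\<pi> x / n\<close> decreases with \<open>|x|\<close>, so the position of larger modulus wins.\<close>

lemma Psi_sum_dominated: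
  fixes z :: "complex ^ 'n::finite"
  assumes z: "z \<in> Ldom" and x: "\<bar>branch_pos CARD('n) M0 \<phi>\<bar> \<le> real CARD('n)"
    and S: "\<And>i. i \<in> S \<Longrightarrow> \<bar>branch_pos CARD('n) (M - int i) \<phi>\<bar> < \<bar>branch_pos CARD('n) M0 \<phi>\<bar>"
  shows "(\<lambda>r. \<Sum>i\<in>S. c i * Psi (M - int i) (log_p CARD('n) r \<phi>) z $ I) \<in> O[at_top](\<lambda>r. lead z M0 \<phi> r / of_real r)"
proof (rule big_sum_in_bigo)
  fix i assume i: "i \<in> S"
  have "(\<lambda>r. Psi (M - int i) (log_p CARD('n) r \<phi>) z $ I) \<in> O[at_top](lead z (M - int i) \<phi>)"
    using S[OF i] x by (intro Psi_abs_pos(2)[OF z]) linarith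
  also have "lead z (M - int i) \<phi> \<in> O[at_top](\<lambda>r. lead z M0 \<phi> r / of_real r)"
    using cos_less_of_abs_less[OF S[OF i] x] by (intro lead_dominates) (simp add: branch_arg_pos)
  finally show "(\<lambda>r. c i * Psi (M - int i) (log_p CARD('n) r \<phi>) z $ I) \<in> O[at_top](\<lambda>r. lead z M0 \<phi> r / of_real r)"
    by (rule bigo_cmult)
qed

text \<open>For \<open>x < n\<close> the first term leads: the positions \<open>x - 2 i\<close> with \<open>1 \<le> i \<le> d\<close> have modulus less than
  \<open>x\<close>.  For \<open>x > n\<close> the first term is out of reach of the Mellin--Barnes estimate, and the relation
  replaces the sum by the terms with \<open>d < i \<le> n\<close>; there the last position \<open>x - 2 n\<close> has the largest
  modulus, and its leading term is the desired one by monodromy.  At \<open>x = n\<close> the first term and the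
  last one have the same size.\<close>

lemma partial_sum_asymptotics:
  fixes z :: "complex ^ 'n::finite"
  assumes z: "z \<in> Ldom" and d: "d < CARD('n)"
    and lo: "- real CARD('n) < branch_pos CARD('n) M \<phi>" "d = 0 \<or> real d < branch_pos CARD('n) M \<phi>"
    and hi: "branch_pos CARD('n) M \<phi> < real d + real CARD('n) + 1"
    and ne: "branch_pos CARD('n) M \<phi> \<noteq> real CARD('n)"
  shows "(\<lambda>r. (\<Sum>i=0..d. signed_esym z i *s Psi (M - int i) (log_p CARD('n) r \<phi>) z) $ I - lead z M \<phi> r)
     \<in> O[at_top](\<lambda>r. lead z M \<phi> r / of_real r)"
proof -
  define X where "X = branch_pos CARD('n) M \<phi>"
  define t where "t = (\<lambda>i r. signed_esym z i * Psi (M - int i) (log_p CARD('n) r \<phi>) z $ I)"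
  have part: "(\<Sum>i=0..d. signed_esym z i *s Psi (M - int i) (log_p CARD('n) r \<phi>) z) $ I = (\<Sum>i=0..d. t i r)" for r
    by (simp add: t_def)
  show ?thesis
  proof (cases "X < real CARD('n)")
    case True
    have small: "(\<lambda>r. \<Sum>i=1..d. t i r) \<in> O[at_top](\<lambda>r. lead z M \<phi> r / of_real r)"
      unfolding t_def
    proof (rule Psi_sum_dominated[OF z])
      show "\<bar>branch_pos CARD('n) M \<phi>\<bar> \<le> real CARD('n)" using True lo unfolding X_def by linarith
      fix i assume i: "i \<in> {1..d}"
      then have "real d < X" "1 \<le> real i" "real i \<le> real d" using lo(2) unfolding X_def by auto
      then show "\<bar>branch_pos CARD('n) (M - int i) \<phi>\<bar> < \<bar>branch_pos CARD('n) M \<phi>\<bar>"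
        unfolding branch_pos_diff X_def[symmetric] by linarith
    qed
    have "\<bar>branch_pos CARD('n) M \<phi>\<bar> < real CARD('n)" using True lo unfolding X_def by linarith
    then have "(\<lambda>r. (Psi M (log_p CARD('n) r \<phi>) z $ I - lead z M \<phi> r) + (\<Sum>i=1..d. t i r)) \<in> O[at_top](\<lambda>r. lead z M \<phi> r / of_real r)"
      by (intro sum_in_bigo(1) small Psi_abs_pos(1)[OF z])
    moreover have "(\<Sum>i=0..d. t i r) = Psi M (log_p CARD('n) r \<phi>) z $ I + (\<Sum>i=1..d. t i r)" for r
    proof -
      have "(\<Sum>i=0..d. t i r) = t 0 r + (\<Sum>i=Suc 0..d. t i r)" by (rule sum.atLeast_Suc_atMost) simp
      then show ?thesis by (simp add: t_def)
    qed
    ultimately show ?thesis unfolding part by (simp add: algebra_simps)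
  next
    case False
    define n where "n = CARD('n)"
    have Xn: "X > real n" using False ne unfolding X_def n_def by linarith
    have hi': "X < real d + real n + 1" using hi unfolding X_def n_def .
    have dn: "d < n" using d by (simp add: n_def)
    define M0 where "M0 = M - int n"
    have X0: "branch_pos n M0 \<phi> = X - 2 * real n" unfolding M0_def branch_pos_diff X_def n_def ..
    have dn': "real d + 1 \<le> real n" using dn by linarith
    have X0': "\<bar>X - 2 * real n\<bar> = 2 * real n - X" "2 * real n - X < real n" using Xn hi' dn' by linarith+
    have lM: "lead z M \<phi> r = - signed_esym z n * lead z M0 \<phi> r" for r
      unfolding M0_def n_def by (rule lead_monodromy[symmetric])
    have nz: "signed_esym z n \<noteq> 0" by (simp add: signed_esym_top n_def)
    have small: "(\<lambda>r. \<Sum>i\<in>{Suc d..<n}. t i r) \<in> O[at_top](\<lambda>r. lead z M0 \<phi> r / of_real r)"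
      unfolding t_def
    proof (rule Psi_sum_dominated[OF z])
      show "\<bar>branch_pos CARD('n) M0 \<phi>\<bar> \<le> real CARD('n)" using X0' X0 unfolding n_def by linarith
      fix i assume i: "i \<in> {Suc d..<n}"
      then have "real d + 1 \<le> real i" "real i + 1 \<le> real n" by auto
      then show "\<bar>branch_pos CARD('n) (M - int i) \<phi>\<bar> < \<bar>branch_pos CARD('n) M0 \<phi>\<bar>"
        unfolding X0[unfolded n_def] branch_pos_diff X_def[symmetric] using X0' hi' unfolding n_def by linarith
    qed
    have tn: "t n = (\<lambda>r. signed_esym z n * Psi M0 (log_p CARD('n) r \<phi>) z $ I)" by (simp add: t_def M0_def)
    have "(\<lambda>r. Psi M0 (log_p CARD('n) r \<phi>) z $ I - lead z M0 \<phi> r) \<in> O[at_top](\<lambda>r. lead z M0 \<phi> r / of_real r)"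
      using X0' X0 unfolding n_def by (intro Psi_abs_pos(1)[OF z]) linarith
    then have "(\<lambda>r. signed_esym z n * (Psi M0 (log_p CARD('n) r \<phi>) z $ I - lead z M0 \<phi> r)) \<in> O[at_top](\<lambda>r. lead z M0 \<phi> r / of_real r)"
      by (rule bigo_cmult)
    from sum_in_bigo(1)[OF this small]
    have "(\<lambda>r. signed_esym z n * (Psi M0 (log_p CARD('n) r \<phi>) z $ I - lead z M0 \<phi> r) + (\<Sum>i\<in>{Suc d..<n}. t i r))
       \<in> O[at_top](\<lambda>r. lead z M0 \<phi> r / of_real r)" .
    then have "(\<lambda>r. - 1 * (signed_esym z n * (Psi M0 (log_p CARD('n) r \<phi>) z $ I - lead z M0 \<phi> r) + (\<Sum>i\<in>{Suc d..<n}. t i r)))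
       \<in> O[at_top](\<lambda>r. lead z M0 \<phi> r / of_real r)" by (rule bigo_cmult)
    moreover have "- 1 * (signed_esym z n * (Psi M0 (log_p CARD('n) r \<phi>) z $ I - lead z M0 \<phi> r) + (\<Sum>i\<in>{Suc d..<n}. t i r))
        = (\<Sum>i=0..d. t i r) - lead z M \<phi> r" for r
    proof -
      have "(\<Sum>i=0..CARD('n). signed_esym z i *s Psi (M - int i) (log_p CARD('n) r \<phi>) z) $ I = 0"
        unfolding Psi_relation by simp
      then have "(\<Sum>i=0..n. t i r) = 0" by (simp add: t_def n_def)
      moreover have "{0..n} = {0..d} \<union> ({Suc d..<n} \<union> {n})" using dn by auto
      then have "(\<Sum>i=0..n. t i r) = (\<Sum>i\<in>{0..d} \<union> ({Suc d..<n} \<union> {n}). t i r)" by simp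
      then have "(\<Sum>i=0..n. t i r) = (\<Sum>i=0..d. t i r) + ((\<Sum>i\<in>{Suc d..<n}. t i r) + t n r)"
        using dn by (subst (asm) sum.union_disjoint, simp, simp, force, subst (asm) sum.union_disjoint) auto
      ultimately show ?thesis unfolding lM tn by (simp add: algebra_simps add_eq_0_iff)
    qed
    ultimately have "(\<lambda>r. (\<Sum>i=0..d. t i r) - lead z M \<phi> r) \<in> O[at_top](\<lambda>r. lead z M0 \<phi> r / of_real r)" by simp
    also have "(\<lambda>r. lead z M0 \<phi> r / of_real r) \<in> O[at_top](\<lambda>r. lead z M \<phi> r / of_real r)"
    proof -
      have "(\<lambda>r. - inverse (signed_esym z n) * (lead z M \<phi> r / of_real r)) \<in> O[at_top](\<lambda>r. lead z M \<phi> r / of_real r)"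
        by (rule bigo_cmult) (rule landau_o.big_refl)
      then show ?thesis unfolding lM using nz by (simp add: field_simps)
    qed
    finally show ?thesis unfolding part .
  qed
qed

section \<open>Linear independence from growth\<close>

text \<open>In a vanishing combination the term of fastest growth among those with nonzero coefficient would
  be of smaller order than itself.\<close>

lemma growth_independence:
  fixes f :: "'i \<Rightarrow> real \<Rightarrow> complex" and \<kappa> :: "'i \<Rightarrow> real"
  assumes fin: "finite S" and inj: "inj_on \<kappa> S"
    and nz: "\<And>i. i \<in> S \<Longrightarrow> \<exists>\<^sub>F r in at_top. f i r \<noteq> 0"
    and small: "\<And>i j. i \<in> S \<Longrightarrow> j \<in> S \<Longrightarrow> \<kappa> i < \<kappa> j \<Longrightarrow> f i \<in> o[at_top](f j)"
    and zero: "\<And>r. (\<Sum>i\<in>S. c i * f i r) = 0"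
  shows "\<forall>i\<in>S. c i = 0"
proof (rule ccontr)
  define S' where "S' = {i\<in>S. c i \<noteq> 0}"
  assume "\<not> (\<forall>i\<in>S. c i = 0)"
  then have "S' \<noteq> {}" by (auto simp: S'_def)
  have fS': "finite S'" using fin by (simp add: S'_def)
  obtain j where j: "j \<in> S'" "\<And>i. i \<in> S' \<Longrightarrow> \<kappa> i \<le> \<kappa> j"
  proof -
    have "Max (\<kappa> ` S') \<in> \<kappa> ` S'" using fS' \<open>S' \<noteq> {}\<close> by simp
    then obtain j where "j \<in> S'" "\<kappa> j = Max (\<kappa> ` S')" by auto
    then show ?thesis using fS' by (intro that[of j]) auto
  qed
  have jS: "j \<in> S" "c j \<noteq> 0" using j by (auto simp: S'_def)
  have "(\<lambda>r. \<Sum>i\<in>S' - {j}. (- c i / c j) * f i r) \<in> o[at_top](f j)"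
  proof (rule big_sum_in_smallo)
    fix i assume i: "i \<in> S' - {j}"
    then have "\<kappa> i \<noteq> \<kappa> j" using inj jS by (auto simp: S'_def inj_on_def)
    then have "\<kappa> i < \<kappa> j" using j(2)[of i] i by auto
    then have "f i \<in> o[at_top](f j)" using small[of i j] i jS by (auto simp: S'_def)
    moreover have "(\<lambda>r. (- c i / c j) * f i r) \<in> O[at_top](f i)" by (rule bigo_cmult) simp
    ultimately show "(\<lambda>r. (- c i / c j) * f i r) \<in> o[at_top](f j)" by (rule landau_o.big_small_trans[rotated])
  qed
  moreover have "(\<Sum>i\<in>S' - {j}. (- c i / c j) * f i r) = f j r" for r
  proof -
    have "(\<Sum>i\<in>S. c i * f i r) = (\<Sum>i\<in>S'. c i * f i r)" unfolding S'_def by (rule sum.mono_neutral_right) (use fin in auto)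
    also have "\<dots> = c j * f j r + (\<Sum>i\<in>S' - {j}. c i * f i r)" by (rule sum.remove[OF fS' j(1)])
    finally have "(\<Sum>i\<in>S' - {j}. c i * f i r) = - (c j * f j r)" using zero[of r] by (simp add: eq_neg_iff_add_eq_0 add.commute)
    then have "(- 1 / c j) * (\<Sum>i\<in>S' - {j}. c i * f i r) = f j r" using jS by simp
    then show ?thesis unfolding sum_distrib_left by (simp add: mult.assoc[symmetric])
  qed
  ultimately have "f j \<in> o[at_top](f j)" by simp
  then have "\<forall>\<^sub>F r in at_top. f j r = 0" unfolding landau_o.small_refl_iff .
  then show False using nz[OF jS(1)] by (simp add: frequently_def)
qed

text \<open>Powers of a real number outside the finitely many roots of the differences of exponent vectors,
  read as polynomials.\<close>

lemma generic_weights: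
  fixes K :: "('n::finite \<Rightarrow>\<^sub>0 int) set"
  assumes "finite K"
  obtains e :: "'n \<Rightarrow> real" where "inj e" "inj_on (\<lambda>\<alpha>. \<Sum>a\<in>UNIV. of_int (Poly_Mapping.lookup \<alpha> a) * e a) K"
proof -
  obtain f :: "'n \<Rightarrow> nat" where f: "inj f" using finite_imp_inj_to_nat_seg[OF finite_class.finite_UNIV[where 'a = 'n]] by auto
  define p where "p = (\<lambda>\<gamma> :: 'n \<Rightarrow>\<^sub>0 int. \<Sum>a\<in>UNIV. monom (real_of_int (Poly_Mapping.lookup \<gamma> a)) (f a))"
  have p0: "p \<gamma> \<noteq> 0" if "\<gamma> \<noteq> 0" for \<gamma>
  proof
    assume "p \<gamma> = 0"
    have "Poly_Mapping.lookup \<gamma> a = 0" for a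
    proof -
      have "coeff (p \<gamma>) (f a) = (\<Sum>b\<in>UNIV. if b = a then real_of_int (Poly_Mapping.lookup \<gamma> b) else 0)"
        unfolding p_def coeff_sum by (intro sum.cong refl) (use f in \<open>auto simp: inj_def\<close>)
      then show ?thesis using \<open>p \<gamma> = 0\<close> by simp
    qed
    then show False using that by (simp add: poly_mapping_eqI)
  qed
  define R where "R = (\<Union>(\<alpha>, \<beta>)\<in>K \<times> K \<inter> {(\<alpha>, \<beta>). \<alpha> \<noteq> \<beta>}. {x. poly (p (\<alpha> - \<beta>)) x = 0})"
  have "finite R" unfolding R_def using assms p0 by (intro finite_UN_I) (auto simp: poly_roots_finite)
  then have "infinite ({1<..} - R)" by (intro Diff_infinite_finite) (auto simp: infinite_Ioi)
  then have "{1<..} - R \<noteq> {}" by (metis finite.emptyI)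
  then obtain x where x: "x > 1" "x \<notin> R" by auto
  show thesis
  proof (rule that[of "\<lambda>a. x ^ f a"])
    show "inj (\<lambda>a. x ^ f a)" using x f by (auto simp: inj_def)
    show "inj_on (\<lambda>\<alpha>. \<Sum>a\<in>UNIV. of_int (Poly_Mapping.lookup \<alpha> a) * x ^ f a) K"
    proof (rule inj_onI, rule ccontr)
      fix \<alpha> \<beta> assume h: "\<alpha> \<in> K" "\<beta> \<in> K" "(\<Sum>a\<in>UNIV. of_int (Poly_Mapping.lookup \<alpha> a) * x ^ f a) = (\<Sum>a\<in>UNIV. of_int (Poly_Mapping.lookup \<beta> a) * x ^ f a)" "\<alpha> \<noteq> \<beta>"
      have "poly (p (\<alpha> - \<beta>)) x = 0"
        using h(3) by (simp add: p_def poly_sum poly_monom lookup_minus left_diff_distrib sum_subtractf)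
      then have "x \<in> R" unfolding R_def using h by (intro UN_I[of "(\<alpha>, \<beta>)"]) auto
      then show False using x by blast
    qed
  qed
qed

text \<open>At points \<open>z\<close> with purely imaginary coordinates \<open>Z\<^sub>a = exp (t e\<^sub>a)\<close> is positive, and for generic weights
  \<open>e\<close> different monomials grow at different rates in \<open>t\<close>.  Differences of distinct imaginary numbers are
  not integers, so these points lie in the domain.\<close>

lemma laurent_eq_0_if_vanishes_on_Ldom:
  fixes Q :: "'n::finite laurent"
  assumes "\<And>z. z \<in> Ldom \<Longrightarrow> laurent_eval Q (Zacute z) = 0"
  shows "Q = 0"
proof -
  define K where "K = Poly_Mapping.keys Q"
  have fK: "finite K" by (simp add: K_def)
  obtain e :: "'n \<Rightarrow> real" where e: "inj e" "inj_on (\<lambda>\<alpha>. \<Sum>a\<in>UNIV. of_int (Poly_Mapping.lookup \<alpha> a) * e a) K"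
    by (rule generic_weights[OF fK])
  define \<kappa> where "\<kappa> = (\<lambda>\<alpha>. \<Sum>a\<in>UNIV. of_int (Poly_Mapping.lookup \<alpha> a) * e a)"
  have k: "inj_on \<kappa> K" using e(2) unfolding \<kappa>_def .
  have ev: "(\<Sum>\<alpha>\<in>K. Poly_Mapping.lookup Q \<alpha> * of_real (exp (t * \<kappa> \<alpha>))) = 0" if t: "t \<noteq> 0" for t :: real
  proof -
    define z :: "complex ^ 'n" where "z = (\<chi> a. - \<i> * of_real (t * e a / (2 * pi)))"
    have "z \<in> Ldom" unfolding Ldom_def
    proof (intro CollectI allI impI notI)
      fix a b :: 'n assume ab: "a \<noteq> b" "z $ a - z $ b \<in> \<int>"
      then obtain m where m: "z $ a - z $ b = of_int m" by (auto elim: Ints_cases)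
      have "Im (z $ a - z $ b) = 0" unfolding m by simp
      then have "e a = e b" using t by (auto simp: z_def)
      then show False using e(1) ab by (auto simp: inj_def)
    qed
    have Z: "Zacute z a = of_real (exp (t * e a))" for a
      by (simp add: Zacute_def z_def exp_of_real[symmetric])
    have "laurent_monom (Zacute z) \<alpha> = of_real (exp (t * \<kappa> \<alpha>))" for \<alpha>
    proof -
      have "laurent_monom (Zacute z) \<alpha> = of_real (\<Prod>a\<in>UNIV. exp (t * e a) powi Poly_Mapping.lookup \<alpha> a)"
        unfolding laurent_monom_def Z by (simp add: of_real_power_int)
      also have "(\<Prod>a\<in>UNIV. exp (t * e a) powi Poly_Mapping.lookup \<alpha> a) = (\<Prod>a\<in>UNIV. exp (t * (of_int (Poly_Mapping.lookup \<alpha> a) * e a)))"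
        by (simp add: exp_power_int mult_ac)
      also have "\<dots> = exp (t * \<kappa> \<alpha>)" by (simp add: exp_sum \<kappa>_def sum_distrib_left)
      finally show ?thesis .
    qed
    then show ?thesis using assms[OF \<open>z \<in> Ldom\<close>] unfolding laurent_eval_def K_def by simp
  qed
  have "\<forall>\<alpha>\<in>K. Poly_Mapping.lookup Q \<alpha> = 0"
  proof (rule growth_independence[OF fK k])
    fix \<alpha> \<beta> assume "\<kappa> \<alpha> < \<kappa> \<beta>"
    then have pos: "\<kappa> \<beta> - \<kappa> \<alpha> > 0" by simp
    show "(\<lambda>t. complex_of_real (exp ((\<bar>t\<bar> + 1) * \<kappa> \<alpha>))) \<in> o[at_top](\<lambda>t. complex_of_real (exp ((\<bar>t\<bar> + 1) * \<kappa> \<beta>)))"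
    proof (rule smalloI_tendsto)
      have "((\<lambda>t. exp (- (\<kappa> \<beta> - \<kappa> \<alpha>) * (t + 1))) \<longlongrightarrow> 0) at_top" using pos by real_asymp
      then have "((\<lambda>t. complex_of_real (exp (- (\<kappa> \<beta> - \<kappa> \<alpha>) * (t + 1)))) \<longlongrightarrow> complex_of_real 0) at_top" by (rule tendsto_of_real)
      moreover have "\<forall>\<^sub>F t in at_top. complex_of_real (exp (- (\<kappa> \<beta> - \<kappa> \<alpha>) * (t + 1))) = complex_of_real (exp ((\<bar>t\<bar> + 1) * \<kappa> \<alpha>)) / complex_of_real (exp ((\<bar>t\<bar> + 1) * \<kappa> \<beta>))"
        using eventually_ge_at_top[of 0]
      proof eventually_elim
        case (elim t)
        have "exp (- (\<kappa> \<beta> - \<kappa> \<alpha>) * (t + 1)) = exp ((\<bar>t\<bar> + 1) * \<kappa> \<alpha>) / exp ((\<bar>t\<bar> + 1) * \<kappa> \<beta>)"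
          unfolding exp_diff[symmetric] using elim by (simp add: algebra_simps)
        then show ?case by (metis of_real_divide)
      qed
      ultimately show "((\<lambda>t. complex_of_real (exp ((\<bar>t\<bar> + 1) * \<kappa> \<alpha>)) / complex_of_real (exp ((\<bar>t\<bar> + 1) * \<kappa> \<beta>))) \<longlongrightarrow> 0) at_top"
        by (subst (asm) tendsto_cong) auto
    qed simp
  next
    fix t :: real
    show "(\<Sum>\<alpha>\<in>K. Poly_Mapping.lookup Q \<alpha> * complex_of_real (exp ((\<bar>t\<bar> + 1) * \<kappa> \<alpha>))) = 0"
      by (rule ev) linarith
  qed simp
  then show ?thesis by (intro poly_mapping_eqI) (auto simp: K_def in_keys_iff)
qed

section \<open>Generators of the module of solutions\<close>

lemma esym_0: "esym 0 = (1 :: 'n::finite laurent)"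
proof -
  have "{A :: 'n set. card A = 0} = {{}}" by auto
  then show ?thesis by (simp add: esym_def)
qed

lemma lscale_sum_apply: "(\<Sum>i\<in>A. lscale (q i) (f i)) lp z = (\<Sum>i\<in>A. laurent_eval (q i) (Zacute z) *s f i lp z)"
  by (induction A rule: infinite_finite_induct) (simp_all add: lscale_def)

lemma Psi_module_relation:
  "(\<Sum>i=0..CARD('n). lscale ((- 1) ^ i * esym i) (Psi (M - int i))) = (0 :: 'n::finite hfun)"
proof (intro ext)
  fix lp and z :: "complex ^ 'n"
  show "(\<Sum>i=0..CARD('n). lscale ((- 1) ^ i * esym i) (Psi (M - int i))) lp z = (0 :: 'n hfun) lp z"
    unfolding lscale_sum_apply signed_esym_def[symmetric] Psi_relation by simp
qed

lemma vsum_apply: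
  assumes "d < \<mu>"
  shows "vsum k \<mu> (\<mu> - d) lp z = (\<Sum>i=0..d. signed_esym z i *s Psi (k + int \<mu> - int i) lp (z :: complex ^ 'n::finite))"
proof -
  have "\<mu> - (\<mu> - d) = d" using assms by simp
  then have "vsum k \<mu> (\<mu> - d) lp z = (\<Sum>i=0..d. signed_esym z i *s vv k (\<mu> - i) lp z)"
    unfolding vsum_def lscale_sum_apply signed_esym_def by simp
  also have "\<dots> = (\<Sum>i=0..d. signed_esym z i *s Psi (k + int \<mu> - int i) lp z)"
    by (intro sum.cong refl) (use assms in \<open>auto simp: vv_def of_nat_diff algebra_simps\<close>)
  finally show ?thesis .
qed

definition window :: "int \<Rightarrow> 'n::finite hfun set" where
  "window k = laurent.span (vv k ` {1..CARD('n)})"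

text \<open>The relation among \<open>n + 1\<close> consecutive solutions can be solved for the first as well as for the last one,
  since \<open>1\<close> and the monomial \<open>s\<^sub>n\<close> are units.\<close>

lemma window_step: "window k = (window (k + 1) :: 'n::finite hfun set)"
proof -
  define n where "n = CARD('n)"
  have n: "n > 0" by (simp add: n_def)
  define q where "q = (\<lambda>i. (- 1) ^ i * esym i :: 'n laurent)"
  have q0: "q 0 = 1" by (simp add: q_def esym_0)
  define M where "M = k + int n + 1"
  define P where "P = (\<lambda>i. Psi (M - int i) :: 'n hfun)"
  have rel: "(\<Sum>i\<in>{0..n}. lscale (q i) (P i)) = 0"
    using Psi_module_relation[of M, where 'n = 'n] by (simp add: q_def P_def n_def)
  have lo: "P i \<in> window k" if "1 \<le> i" "i \<le> n" for i
  proof -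
    have "P i = vv k (n + 1 - i)" using that by (simp add: P_def vv_def M_def of_nat_diff algebra_simps)
    moreover have "n + 1 - i \<in> {1..CARD('n)}" using that by (auto simp: n_def)
    ultimately show ?thesis unfolding window_def by (auto intro!: laurent.span_base)
  qed
  have hi: "P i \<in> window (k + 1)" if "i < n" for i
  proof -
    have "P i = vv (k + 1) (n - i)" using that by (simp add: P_def vv_def M_def of_nat_diff algebra_simps)
    then show ?thesis unfolding window_def using that by (auto simp: n_def intro!: laurent.span_base)
  qed
  have top: "P 0 \<in> window k"
  proof -
    have "{0..n} = insert 0 {1..n}" by auto
    then have "lscale (q 0) (P 0) + (\<Sum>i\<in>{1..n}. lscale (q i) (P i)) = 0" using rel by simp
    then have e: "P 0 = - (\<Sum>i\<in>{1..n}. lscale (q i) (P i))" by (simp add: q0 eq_neg_iff_add_eq_0)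
    show ?thesis unfolding e window_def
      by (intro laurent.span_neg laurent.span_sum laurent.span_scale) (use lo in \<open>auto simp: window_def\<close>)
  qed
  have bot: "P n \<in> window (k + 1)"
  proof -
    have "{A :: 'n set. card A = n} = {UNIV}" using card_subset_eq[of "UNIV :: 'n set"] by (auto simp: n_def)
    then have qn: "q n = (- 1) ^ n * Poly_Mapping.single (\<Sum>a\<in>UNIV. Poly_Mapping.single a 1) 1" by (simp add: q_def esym_def)
    define u :: "'n laurent" where "u = (- 1) ^ n * Poly_Mapping.single (- (\<Sum>a\<in>UNIV. Poly_Mapping.single a 1)) 1"
    have "u * q n = ((- 1) ^ n * (- 1) ^ n) * (Poly_Mapping.single (- (\<Sum>a\<in>UNIV. Poly_Mapping.single a 1)) 1 * Poly_Mapping.single (\<Sum>a\<in>UNIV. Poly_Mapping.single a 1) 1)"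
      unfolding qn u_def by (simp only: mult_ac)
    also have "\<dots> = 1" by (simp add: mult_single power_add[symmetric] mult_2[symmetric])
    finally have u: "u * q n = 1" .
    have "{0..n} = insert n {0..<n}" by auto
    then have "lscale (q n) (P n) + (\<Sum>i\<in>{0..<n}. lscale (q i) (P i)) = 0" using rel by simp
    then have e: "lscale (q n) (P n) = - (\<Sum>i\<in>{0..<n}. lscale (q i) (P i))" by (simp add: eq_neg_iff_add_eq_0)
    have "P n = lscale u (lscale (q n) (P n))" by (simp add: u)
    also have "\<dots> \<in> window (k + 1)" unfolding e window_def
      by (intro laurent.span_neg laurent.span_sum laurent.span_scale) (use hi in \<open>auto simp: window_def\<close>)
    finally show ?thesis .
  qed
  show ?thesis
  proof
    show "window k \<subseteq> (window (k + 1) :: 'n hfun set)"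
      unfolding window_def[of k]
    proof (rule laurent.span_minimal)
      show "vv k ` {1..CARD('n)} \<subseteq> (window (k + 1) :: 'n hfun set)"
      proof
        fix x :: "'n hfun" assume "x \<in> vv k ` {1..CARD('n)}"
        then obtain m where m: "m \<in> {1..n}" "x = vv k m" by (auto simp: n_def)
        then have "x = P (n + 1 - m)" by (auto simp: P_def vv_def M_def of_nat_diff algebra_simps)
        then show "x \<in> window (k + 1)" using m hi[of "n + 1 - m"] bot by (cases "m = 1") auto
      qed
    qed (simp add: window_def)
    show "window (k + 1) \<subseteq> (window k :: 'n hfun set)"
      unfolding window_def[of "k + 1"]
    proof (rule laurent.span_minimal)
      show "vv (k + 1) ` {1..CARD('n)} \<subseteq> (window k :: 'n hfun set)"
      proof
        fix x :: "'n hfun" assume "x \<in> vv (k + 1) ` {1..CARD('n)}"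
        then obtain m where m: "m \<in> {1..n}" "x = vv (k + 1) m" by (auto simp: n_def)
        then have "x = P (n - m)" by (auto simp: P_def vv_def M_def of_nat_diff algebra_simps)
        then show "x \<in> window k" using m lo[of "n - m"] top by (cases "m = n") auto
      qed
    qed (simp add: window_def)
  qed
qed

lemma window_eq_Smod: "window k = (Smod :: 'n::finite hfun set)"
proof -
  have "window k = (window 0 :: 'n hfun set)"
  proof (induction k rule: int_induct[of _ 0])
    case (step1 i)
    then show ?case using window_step[of i, where 'n = 'n] by simp
  next
    case (step2 i)
    then show ?case using window_step[of "i - 1", where 'n = 'n] by simp
  qed simp
  moreover have "window 0 = (Smod :: 'n hfun set)"
  proof
    show "window 0 \<subseteq> (Smod :: 'n hfun set)" unfolding window_def
    proof (rule laurent.span_minimal)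
      show "laurent.subspace (Smod :: 'n hfun set)"
      proof (rule laurent.subspaceI)
        show "(0 :: 'n hfun) \<in> Smod" unfolding Smod_def
          by (rule CollectI, rule exI[of _ "\<lambda>_. 0"]) simp
      next
        fix x y :: "'n hfun" assume "x \<in> Smod" "y \<in> Smod"
        then obtain Q Q' where "x = (\<Sum>m=1..CARD('n). lscale (Q m) (Psi (int m)))" "y = (\<Sum>m=1..CARD('n). lscale (Q' m) (Psi (int m)))"
          by (auto simp: Smod_def)
        then have "x + y = (\<Sum>m=1..CARD('n). lscale (Q m + Q' m) (Psi (int m)))"
          by (simp add: laurent.scale_left_distrib sum.distrib)
        then show "x + y \<in> Smod" unfolding Smod_def by (intro CollectI exI[of _ "\<lambda>m. Q m + Q' m"]) simp
      next
        fix c and x :: "'n hfun" assume "x \<in> Smod"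
        then obtain Q where "x = (\<Sum>m=1..CARD('n). lscale (Q m) (Psi (int m)))" by (auto simp: Smod_def)
        then have "lscale c x = (\<Sum>m=1..CARD('n). lscale (c * Q m) (Psi (int m)))"
          by (simp add: laurent.scale_sum_right)
        then show "lscale c x \<in> Smod" unfolding Smod_def by (intro CollectI exI[of _ "\<lambda>m. c * Q m"]) simp
      qed
      show "vv 0 ` {1..CARD('n)} \<subseteq> (Smod :: 'n hfun set)"
      proof
        fix x :: "'n hfun" assume "x \<in> vv 0 ` {1..CARD('n)}"
        then obtain j where j: "j \<in> {1..CARD('n)}" "x = Psi (int j)" by (auto simp: vv_def)
        have "(\<Sum>m=1..CARD('n). lscale (if m = j then 1 else 0) (Psi (int m))) = (\<Sum>m=1..CARD('n). if m = j then Psi (int m) else (0 :: 'n hfun))"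
          by (intro sum.cong refl) simp
        also have "\<dots> = x" using j by simp
        finally show "x \<in> Smod" unfolding Smod_def by (intro CollectI exI[of _ "\<lambda>m. if m = j then 1 else 0"]) simp
      qed
    qed
    show "Smod \<subseteq> (window 0 :: 'n hfun set)"
    proof
      fix x :: "'n hfun" assume "x \<in> Smod"
      then obtain Q where x: "x = (\<Sum>m=1..CARD('n). lscale (Q m) (Psi (int m)))" by (auto simp: Smod_def)
      have "(Psi (int m) :: 'n hfun) \<in> window 0" if "m \<in> {1..CARD('n)}" for m
        unfolding window_def by (rule laurent.span_base) (use that in \<open>auto simp: vv_def\<close>)
      then show "x \<in> window 0" unfolding x window_def by (intro laurent.span_sum laurent.span_scale)
    qed
  qed
  ultimately show ?thesis by simp
qed

text \<open>The transition matrix to \<open>\<Psi>\<^bsup>k+1\<^esup>, \<dots>, \<Psi>\<^bsup>k+n\<^esup>\<close> is unitriangular.\<close>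

lemma triangular_span:
  assumes d: "\<And>\<mu>. \<mu> \<in> {1..CARD('n)} \<Longrightarrow> d \<mu> < \<mu>"
  shows "laurent.span ((\<lambda>\<mu>. vsum k \<mu> (\<mu> - d \<mu>)) ` {1..CARD('n)}) = (Smod :: 'n::finite hfun set)"
proof -
  define B where "B = (\<lambda>\<mu>. vsum k \<mu> (\<mu> - d \<mu>) :: 'n hfun)"
  have B: "B \<mu> = vv k \<mu> + (\<Sum>i=1..d \<mu>. lscale ((- 1) ^ i * esym i) (vv k (\<mu> - i)))" if "\<mu> \<in> {1..CARD('n)}" for \<mu>
  proof -
    have "\<mu> - (\<mu> - d \<mu>) = d \<mu>" using d[OF that] by simp
    moreover have "{0..d \<mu>} = insert 0 {1..d \<mu>}" by auto
    ultimately show ?thesis by (simp add: B_def vsum_def esym_0)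
  qed
  have "laurent.span (B ` {1..CARD('n)}) = window k"
  proof
    show "laurent.span (B ` {1..CARD('n)}) \<subseteq> window k"
    proof (rule laurent.span_minimal)
      show "B ` {1..CARD('n)} \<subseteq> window k"
      proof
        fix x assume "x \<in> B ` {1..CARD('n)}"
        then obtain \<mu> where m: "\<mu> \<in> {1..CARD('n)}" "x = B \<mu>" by auto
        show "x \<in> window k" unfolding m(2) B[OF m(1)] window_def
        proof (intro laurent.span_add laurent.span_sum laurent.span_scale laurent.span_base imageI)
          fix i assume "i \<in> {1..d \<mu>}"
          then show "\<mu> - i \<in> {1..CARD('n)}" using m(1) d[OF m(1)] by auto
        qed (use m in auto)
      qed
    qed (simp add: window_def)
    show "window k \<subseteq> laurent.span (B ` {1..CARD('n)})" unfolding window_def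
    proof (rule laurent.span_minimal)
      have "vv k \<mu> \<in> laurent.span (B ` {1..CARD('n)})" if "\<mu> \<in> {1..CARD('n)}" for \<mu>
        using that
      proof (induction \<mu> rule: less_induct)
        case (less \<mu>)
        have e: "vv k \<mu> = B \<mu> - (\<Sum>i=1..d \<mu>. lscale ((- 1) ^ i * esym i) (vv k (\<mu> - i)))" using B[OF less.prems] by simp
        show ?case unfolding e
        proof (intro laurent.span_diff laurent.span_sum laurent.span_scale)
          show "B \<mu> \<in> laurent.span (B ` {1..CARD('n)})" using less.prems by (auto intro: laurent.span_base)
          fix i assume "i \<in> {1..d \<mu>}"
          then show "vv k (\<mu> - i) \<in> laurent.span (B ` {1..CARD('n)})" using d[OF less.prems] less.prems by (intro less.IH) auto
        qed
      qed
      then show "vv k ` {1..CARD('n)} \<subseteq> laurent.span (B ` {1..CARD('n)})" by auto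
    qed simp
  qed
  then show ?thesis unfolding window_eq_Smod B_def .
qed

section \<open>Stokes bases\<close>

text \<open>The number of terms that correct \<open>v\<^sub>\<mu>\<close>; truncated subtraction leaves the first half of the \<open>v\<^sub>\<mu>\<close>
  uncorrected.  The parameter is \<open>c = 2\<close> for \<open>Q'\<^sub>k\<close> and \<open>c = 1\<close> for \<open>Q''\<^sub>k\<close>.\<close>

definition depth :: "nat \<Rightarrow> nat \<Rightarrow> nat \<Rightarrow> nat" where
  "depth n c \<mu> = 2 * \<mu> - (n + c)"

lemma depth_less: "\<mu> \<in> {1..n} \<Longrightarrow> c \<ge> 1 \<Longrightarrow> depth n c \<mu> < \<mu>"
  by (auto simp: depth_def)

text \<open>In terms of positions the assumption on \<open>\<phi>\<close> reads \<open>2 \<mu> - n - c < x < 2 \<mu> - c + 1\<close>, and with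
  \<open>d = depth n c \<mu>\<close> this lies in the interval from \<open>d\<close> (from \<open>- n\<close>, if \<open>d = 0\<close>) to \<open>d + n + 1\<close>.\<close>

lemma vsum_asymptotics:
  fixes z :: "complex ^ 'n::finite"
  assumes z: "z \<in> Ldom" and \<mu>: "\<mu> \<in> {1..CARD('n)}" and c: "c \<in> {1, 2}"
    and lo: "2 * of_int k + real c - 1 - real CARD('n) < 2 * real CARD('n) * \<phi>"
    and hi: "2 * real CARD('n) * \<phi> < 2 * of_int k + real c"
    and nr: "\<not> resonant CARD('n) \<phi>"
  shows "(\<lambda>r. vsum k \<mu> (\<mu> - depth CARD('n) c \<mu>) (log_p CARD('n) r \<phi>) z $ I - lead z (k + int \<mu>) \<phi> r)
     \<in> O[at_top](\<lambda>r. lead z (k + int \<mu>) \<phi> r / of_real r)"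
proof -
  define n where "n = CARD('n)"
  define d where "d = depth n c \<mu>"
  define X where "X = branch_pos n (k + int \<mu>) \<phi>"
  have X: "X = 2 * of_int k + 2 * real \<mu> - real n - 2 * real n * \<phi>" by (simp add: X_def branch_pos_def)
  have mu: "1 \<le> \<mu>" "\<mu> \<le> n" using \<mu> by (auto simp: n_def)
  have n: "real n > 0" using mu by simp
  have dmu: "d < \<mu>" unfolding d_def by (rule depth_less) (use \<mu> c in \<open>auto simp: n_def\<close>)
  have c12: "1 \<le> real c" "real c \<le> 2" using c by auto
  have lo': "2 * of_int k + real c - 1 - real n < 2 * real n * \<phi>" using lo by (simp add: n_def)
  have hi': "2 * real n * \<phi> < 2 * of_int k + real c" using hi by (simp add: n_def)
  have dge: "real d \<ge> 2 * real \<mu> - real n - real c" by (simp add: d_def depth_def)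
  have vs: "vsum k \<mu> (\<mu> - d) (log_p CARD('n) r \<phi>) z = (\<Sum>i=0..d. signed_esym z i *s Psi (k + int \<mu> - int i) (log_p CARD('n) r \<phi>) z)" for r
    by (rule vsum_apply[OF dmu])
  show ?thesis unfolding d_def[unfolded n_def, symmetric] vs
  proof (rule partial_sum_asymptotics[OF z]; unfold n_def[symmetric] X_def[symmetric])
    show "d < n" using dmu mu by simp
    show "- real n < X" unfolding X using hi' c12 mu by linarith
    show "d = 0 \<or> real d < X"
    proof (cases "n + c \<le> 2 * \<mu>")
      case True
      then have "real d = 2 * real \<mu> - real n - real c" by (simp add: d_def depth_def of_nat_diff)
      then show ?thesis unfolding X using hi' by linarith
    qed (simp add: d_def depth_def)
    show "X < real d + real n + 1" unfolding X using lo' dge by linarith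
    show "X \<noteq> real n"
    proof
      assume "X = real n"
      then have "\<phi> = of_int (k + int \<mu> - int n) / real n" using n unfolding X by (simp add: field_simps)
      then show False using nr unfolding resonant_def n_def by blast
    qed
  qed
qed

text \<open>Equality of two cosines would put the sum or the difference of the arguments into \<open>2 \<pi> \<int>\<close>.  The
  differences are \<open>2 \<pi> (\<mu> - \<nu>) / n\<close>, and for a sum \<open>2 n a\<close> would be an integer.\<close>

lemma cos_branch_arg_inj:
  assumes n: "n > 0" and a: "2 * real n * a \<notin> \<int>"
  shows "inj_on (\<lambda>\<mu>. - cos (branch_arg n (k + int \<mu>) a)) {1..n}"
proof (rule inj_onI, rule ccontr)
  fix \<mu> \<nu> assume m: "\<mu> \<in> {1..n}" "\<nu> \<in> {1..n}" "\<mu> \<noteq> \<nu>"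
    and e: "- cos (branch_arg n (k + int \<mu>) a) = - cos (branch_arg n (k + int \<nu>) a)"
  define x where "x = branch_arg n (k + int \<mu>) a"
  define y where "y = branch_arg n (k + int \<nu>) a"
  have xy: "x = pi * (2 * (of_int k + real \<mu>) - real n - 2 * real n * a) / real n" "y = pi * (2 * (of_int k + real \<nu>) - real n - 2 * real n * a) / real n"
    using n by (simp_all add: x_def y_def branch_arg_pos branch_pos_def)
  have "2 * sin ((x + y) / 2) * sin ((y - x) / 2) = 0" using e cos_diff_cos[of x y] by (simp add: x_def y_def)
  then have "sin ((x + y) / 2) = 0 \<or> sin ((y - x) / 2) = 0" by simp
  then show False
  proof
    assume "sin ((x + y) / 2) = 0"
    then obtain i :: int where "(x + y) / 2 = of_int i * pi" unfolding sin_zero_iff_int2 by blast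
    moreover have "(x + y) / 2 = pi * ((2 * of_int k + real \<mu> + real \<nu> - real n - 2 * real n * a) / real n)" unfolding xy using n by (simp add: field_simps)
    ultimately have "pi * ((2 * of_int k + real \<mu> + real \<nu> - real n - 2 * real n * a) / real n) = pi * of_int i" by (simp add: mult.commute)
    then have "(2 * of_int k + real \<mu> + real \<nu> - real n - 2 * real n * a) / real n = of_int i" by (simp only: mult_cancel_left pi_neq_zero simp_thms)
    then have "2 * real n * a = of_int (2 * k + int \<mu> + int \<nu> - int n - i * int n)" using n by (simp add: field_simps)
    then show False using a by (metis Ints_of_int)
  next
    assume "sin ((y - x) / 2) = 0"
    then obtain i :: int where "(y - x) / 2 = of_int i * pi" unfolding sin_zero_iff_int2 by blast
    moreover have "(y - x) / 2 = pi * ((real \<nu> - real \<mu>) / real n)" unfolding xy using n by (simp add: field_simps)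
    ultimately have "pi * ((real \<nu> - real \<mu>) / real n) = pi * of_int i" by (simp add: mult.commute)
    then have "(real \<nu> - real \<mu>) / real n = of_int i" by (simp only: mult_cancel_left pi_neq_zero simp_thms)
    then have "real \<nu> - real \<mu> = of_int (i * int n)" using n by (simp add: field_simps)
    then have "int \<nu> - int \<mu> = i * int n" by linarith
    moreover have "\<bar>int \<nu> - int \<mu>\<bar> < int n" "int \<nu> - int \<mu> \<noteq> 0" using m by auto
    ultimately show False using zdvd_not_zless by (metis abs_of_nonneg dvd_triv_right zdvd_imp_le abs_ge_zero dvd_abs_iff linorder_not_less zero_less_abs_iff)
  qed
qed

text \<open>At \<open>\<phi> = a\<close> the members of the family have pairwise different orders of growth, at every \<open>z\<close> of the
  domain.\<close>

lemma vsum_family_independent: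
  fixes q :: "nat \<Rightarrow> 'n::finite laurent"
  assumes c: "c \<in> {1, 2}"
    and lo: "2 * of_int k + real c - 1 < 2 * real CARD('n) * a"
    and hi: "2 * real CARD('n) * a < 2 * of_int k + real c"
    and zero: "(\<Sum>\<mu>=1..CARD('n). lscale (q \<mu>) (vsum k \<mu> (\<mu> - depth CARD('n) c \<mu>))) = 0"
    and \<mu>: "\<mu> \<in> {1..CARD('n)}"
  shows "q \<mu> = 0"
proof (rule laurent_eq_0_if_vanishes_on_Ldom)
  fix z :: "complex ^ 'n" assume z: "z \<in> Ldom"
  define n where "n = CARD('n)"
  have n: "n > 0" by (simp add: n_def)
  \<comment> \<open>One component suffices; any will do.\<close>
  define I where "I = (undefined :: 'n)"
  define f where "f = (\<lambda>\<nu> r. vsum k \<nu> (\<nu> - depth CARD('n) c \<nu>) (log_p CARD('n) r a) z $ I)"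
  define L where "L = (\<lambda>\<nu>. lead z (k + int \<nu>) a)"
  have na: "2 * real n * a \<notin> \<int>"
  proof
    assume "2 * real n * a \<in> \<int>"
    then obtain i :: int where i: "2 * real n * a = of_int i" by (auto elim: Ints_cases)
    have "of_int (2 * k + int c - 1) < (of_int i :: real)" "(of_int i :: real) < of_int (2 * k + int c)"
      using lo hi unfolding n_def[symmetric] i by simp_all
    then show False unfolding of_int_less_iff by linarith
  qed
  have nr: "\<not> resonant CARD('n) a"
  proof
    assume "resonant CARD('n) a"
    then obtain j :: int where "a = of_int j / real n" by (auto simp: resonant_def n_def)
    then have "2 * real n * a = of_int (2 * j)" using n by simp
    then show False using na by (metis Ints_of_int)
  qed
  have fL: "(\<lambda>r. f \<nu> r - L \<nu> r) \<in> O[at_top](\<lambda>r. L \<nu> r / of_real r)" if "\<nu> \<in> {1..n}" for \<nu>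
    unfolding f_def L_def by (rule vsum_asymptotics[OF z _ c _ hi nr]) (use that lo in \<open>auto simp: n_def\<close>)
  have inv: "(\<lambda>r::real. 1 / complex_of_real r) \<in> o[at_top](\<lambda>r. 1)"
  proof (rule smalloI_tendsto)
    have "((\<lambda>r::real. 1 / r) \<longlongrightarrow> 0) at_top" by real_asymp
    then have "((\<lambda>r::real. complex_of_real (1 / r)) \<longlongrightarrow> complex_of_real 0) at_top" by (rule tendsto_of_real)
    then show "((\<lambda>r::real. 1 / complex_of_real r / 1) \<longlongrightarrow> 0) at_top" by simp
  qed simp
  have Ls: "(\<lambda>r. L \<nu> r / of_real r) \<in> o[at_top](L \<nu>)" for \<nu>
  proof -
    have "(\<lambda>r. L \<nu> r * (1 / complex_of_real r)) \<in> o[at_top](\<lambda>r. L \<nu> r * 1)"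
      by (rule landau_o.big_small_mult[OF landau_o.big_refl inv])
    then show ?thesis by simp
  qed
  have eqv: "f \<nu> \<in> O[at_top](L \<nu>) \<and> L \<nu> \<in> O[at_top](f \<nu>)" if "\<nu> \<in> {1..n}" for \<nu>
  proof -
    have "(\<lambda>r. f \<nu> r - L \<nu> r) \<in> o[at_top](L \<nu>)" by (rule landau_o.big_small_trans[OF fL[OF that] Ls])
    then have "\<forall>\<^sub>F r in at_top. norm (f \<nu> r - L \<nu> r) \<le> 1 / 2 * norm (L \<nu> r)"
      by (rule landau_o.smallD) simp
    then have b: "\<forall>\<^sub>F r in at_top. norm (f \<nu> r) \<le> 2 * norm (L \<nu> r) \<and> norm (L \<nu> r) \<le> 2 * norm (f \<nu> r)"
    proof eventually_elim
      case (elim r)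
      have "norm (L \<nu> r) \<le> norm (f \<nu> r) + norm (f \<nu> r - L \<nu> r)" "norm (f \<nu> r) \<le> norm (L \<nu> r) + norm (f \<nu> r - L \<nu> r)"
        by (metis norm_triangle_sub norm_minus_commute, metis norm_triangle_sub)
      then show ?case using elim norm_ge_zero[of "L \<nu> r"] by linarith
    qed
    have "f \<nu> \<in> O[at_top](L \<nu>)" by (rule bigoI[of _ 2]) (use b in \<open>eventually_elim, simp\<close>)
    moreover have "L \<nu> \<in> O[at_top](f \<nu>)" by (rule bigoI[of _ 2]) (use b in \<open>eventually_elim, simp\<close>)
    ultimately show ?thesis by simp
  qed
  have "\<forall>\<nu>\<in>{1..n}. laurent_eval (q \<nu>) (Zacute z) = 0"
  proof (rule growth_independence)
    show "inj_on (\<lambda>\<nu>. - cos (branch_arg n (k + int \<nu>) a)) {1..n}" by (rule cos_branch_arg_inj[OF n na])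
    fix \<nu> assume nu: "\<nu> \<in> {1..n}"
    show "\<exists>\<^sub>F r in at_top. f \<nu> r \<noteq> 0"
    proof -
      have "L \<nu> \<in> O[at_top](f \<nu>)" using eqv[OF nu] by simp
      then obtain C where "\<forall>\<^sub>F r in at_top. norm (L \<nu> r) \<le> C * norm (f \<nu> r)" using landau_o.bigE by blast
      then have "\<forall>\<^sub>F r in at_top. f \<nu> r \<noteq> 0"
        by eventually_elim (metis L_def lead_nonzero mult_zero_right norm_le_zero_iff norm_zero)
      then show ?thesis by (rule eventually_frequently[rotated]) simp
    qed
    fix \<nu>' assume nu': "\<nu>' \<in> {1..n}" and lt: "- cos (branch_arg n (k + int \<nu>) a) < - cos (branch_arg n (k + int \<nu>') a)"
    have "L \<nu> \<in> O[at_top](\<lambda>r. L \<nu>' r / of_real r)" unfolding L_def by (rule lead_dominates) (use lt in \<open>simp add: n_def\<close>)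
    from landau_o.big_small_trans[OF this Ls] have "L \<nu> \<in> o[at_top](L \<nu>')" .
    moreover have "f \<nu> \<in> O[at_top](L \<nu>)" using eqv[OF nu] by simp
    moreover have "L \<nu>' \<in> O[at_top](f \<nu>')" using eqv[OF nu'] by simp
    ultimately show "f \<nu> \<in> o[at_top](f \<nu>')" by (meson landau_o.big_small_trans landau_o.small_big_trans)
  next
    fix r
    have "(\<Sum>\<mu>=1..CARD('n). lscale (q \<mu>) (vsum k \<mu> (\<mu> - depth CARD('n) c \<mu>))) (log_p CARD('n) r a) z $ I = 0"
      unfolding zero by simp
    then show "(\<Sum>\<nu>\<in>{1..n}. laurent_eval (q \<nu>) (Zacute z) * f \<nu> r) = 0"
      unfolding lscale_sum_apply by (simp add: f_def n_def)
  qed simp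
  then show "laurent_eval (q \<mu>) (Zacute z) = 0" using \<mu> by (simp add: n_def)
qed

lemma ordered_basis_of_family:
  fixes F B :: "nat \<Rightarrow> 'n::finite hfun"
  assumes \<pi>: "bij_betw \<pi> {1..CARD('n)} {1..CARD('n)}"
    and B: "\<And>\<mu>. \<mu> \<in> {1..CARD('n)} \<Longrightarrow> B (\<pi> \<mu>) = F \<mu>"
    and indep: "\<And>q \<mu>. (\<Sum>\<mu>=1..CARD('n). lscale (q \<mu>) (F \<mu>)) = 0 \<Longrightarrow> \<mu> \<in> {1..CARD('n)} \<Longrightarrow> q \<mu> = 0"
    and span: "laurent.span (F ` {1..CARD('n)}) = Smod"
  shows "ordered_basis B"
proof -
  define S where "S = {1..CARD('n)}"
  have im: "B ` S = F ` S"
  proof -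
    have "B ` S = B ` \<pi> ` S" using \<pi> by (simp add: bij_betw_def S_def)
    also have "\<dots> = F ` S" unfolding image_image by (rule image_cong) (use B in \<open>auto simp: S_def\<close>)
    finally show ?thesis .
  qed
  have injF: "inj_on F S"
  proof (rule inj_onI, rule ccontr)
    fix \<mu> \<nu> assume h: "\<mu> \<in> S" "\<nu> \<in> S" "F \<mu> = F \<nu>" "\<mu> \<noteq> \<nu>"
    define q where "q = (\<lambda>i. if i = \<mu> then 1 else if i = \<nu> then - 1 else 0 :: 'n laurent)"
    have "(\<Sum>i\<in>S. lscale (q i) (F i)) = (\<Sum>i\<in>{\<mu>, \<nu>}. lscale (q i) (F i))"
      by (rule sum.mono_neutral_right) (use h in \<open>auto simp: q_def S_def\<close>)
    also have "\<dots> = 0" using h by (simp add: q_def)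
    finally have "q \<mu> = 0" using h by (intro indep) (auto simp: S_def)
    then show False by (simp add: q_def)
  qed
  have "inj_on B S"
  proof (rule inj_onI)
    fix i j assume ij: "i \<in> S" "j \<in> S" "B i = B j"
    have surj: "\<pi> ` S = S" using \<pi> by (simp add: bij_betw_def S_def)
    obtain \<mu> \<nu> where m: "\<mu> \<in> S" "\<nu> \<in> S" "i = \<pi> \<mu>" "j = \<pi> \<nu>" using ij surj by (metis imageE)
    have "F \<mu> = F \<nu>" using ij(3) B m by (simp add: S_def)
    then show "i = j" using inj_onD[OF injF _ m(1,2)] m(3,4) by simp
  qed
  moreover have "laurent.independent (B ` S)"
  proof
    assume "laurent.dependent (B ` S)"
    then obtain u where u: "\<exists>v\<in>F ` S. u v \<noteq> 0" "(\<Sum>v\<in>F ` S. lscale (u v) v) = 0"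
      unfolding im by (subst (asm) laurent.dependent_finite) (auto simp: S_def)
    have "(\<Sum>i\<in>S. lscale (u (F i)) (F i)) = 0" using u(2) by (simp add: sum.reindex[OF injF])
    then have "u (F i) = 0" if "i \<in> S" for i using indep[of "\<lambda>i. u (F i)"] that by (simp add: S_def)
    then show False using u(1) by auto
  qed
  ultimately show ?thesis unfolding ordered_basis_def S_def[symmetric] im using span by (simp add: S_def)
qed

text \<open>By the smallness of \<open>\<epsilon>\<close> the interval ends on the right at or before the point \<open>(2 k + c) / (2 n)\<close>, which
  is the first multiple of \<open>1 / (2 n)\<close> after \<open>a\<close>, and similarly on the left.  The label \<open>m\<close> belongs to the
  unique \<open>\<mu>\<close> with \<open>k + \<mu> = m + n l\<close>.\<close>

lemma stokes_basis_of_family: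
  fixes B :: "nat \<Rightarrow> 'n::finite hfun" and k :: int
  assumes c: "c \<in> {1, 2}"
    and lo: "2 * of_int k + real c - 1 < 2 * real CARD('n) * a"
    and hi: "2 * real CARD('n) * a < 2 * of_int k + real c"
    and e: "\<epsilon> > 0" "sufficiently_small CARD('n) a \<epsilon>"
    and \<pi>: "bij_betw \<pi> {1..CARD('n)} {1..CARD('n)}"
    and B: "\<And>\<mu>. \<mu> \<in> {1..CARD('n)} \<Longrightarrow> B (\<pi> \<mu>) = vsum k \<mu> (\<mu> - depth CARD('n) c \<mu>)"
  shows "stokes_basis (a - 1/2 - \<epsilon>) (a + \<epsilon>) B"
proof -
  define n where "n = CARD('n)"
  have n: "n > 0" by (simp add: n_def)
  have n': "2 * real n > 0" using n by simp
  define S where "S = {1..n}"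
  define \<mu> where "\<mu> = (\<lambda>m. nat ((int m - k - 1) mod int n) + 1)"
  define l where "l = (\<lambda>m. (k + int (\<mu> m) - int m) div int n)"
  have mu: "\<mu> m \<in> S" for m
  proof -
    have "0 \<le> (int m - k - 1) mod int n" "(int m - k - 1) mod int n < int n" using n by simp_all
    then show ?thesis unfolding \<mu>_def S_def by auto
  qed
  have lm: "int m + int n * l m = k + int (\<mu> m)" for m
  proof -
    have "int (\<mu> m) = (int m - k - 1) mod int n + 1" using n by (simp add: \<mu>_def)
    then have "k + int (\<mu> m) - int m = (int m - k - 1) mod int n - (int m - k - 1)" by simp
    also have "\<dots> = int n * (- ((int m - k - 1) div int n))"
      using mult_div_mod_eq[of "int n" "int m - k - 1"] unfolding mult_minus_right by linarith
    finally have dv: "int n dvd k + int (\<mu> m) - int m" by simp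
    then have "int n * l m = k + int (\<mu> m) - int m" unfolding l_def by simp
    then show ?thesis by simp
  qed
  have inj: "inj_on \<mu> S"
  proof (rule inj_onI, rule ccontr)
    fix i j assume ij: "i \<in> S" "j \<in> S" "\<mu> i = \<mu> j" "i \<noteq> j"
    have "int i - int j = int n * (l j - l i)" using lm[of i] lm[of j] ij(3) by (simp add: algebra_simps)
    then have "int n dvd int i - int j" by simp
    moreover have "\<bar>int i - int j\<bar> < int n" "int i - int j \<noteq> 0" using ij by (auto simp: S_def)
    ultimately show False by (metis abs_of_nat dvd_imp_le_int linorder_not_less)
  qed
  have bij\<mu>: "bij_betw \<mu> S S"
    by (rule bij_betw_imageI[OF inj]) (rule endo_inj_surj[OF _ _ inj], use mu in \<open>auto simp: S_def\<close>)
  have bij: "bij_betw (\<lambda>m. \<pi> (\<mu> m)) S S"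
    using bij_betw_trans[OF bij\<mu>, of \<pi> S] \<pi> by (simp add: o_def S_def n_def)
  have right: "2 * real n * (a + \<epsilon>) \<le> 2 * of_int k + real c"
  proof (rule ccontr)
    assume h: "\<not> ?thesis"
    define x where "x = of_int (2 * k + int c) / (2 * real n)"
    have "x * (2 * real n) = 2 * of_int k + real c" using n by (simp add: x_def)
    then have "a * (2 * real n) < x * (2 * real n)" "x * (2 * real n) < (a + \<epsilon>) * (2 * real n)"
      using hi h unfolding n_def[symmetric] by (simp_all add: mult.commute[of _ "2 * real n"])
    then have "x \<in> {a<..<a + \<epsilon>}" using n' by (simp add: mult_less_cancel_right)
    then show False using e(2) unfolding sufficiently_small_def x_def n_def[symmetric] by blast
  qed
  have left: "2 * of_int k + real c - 1 - real n \<le> 2 * real n * (a - 1/2 - \<epsilon>)"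
  proof (rule ccontr)
    assume h: "\<not> ?thesis"
    define x where "x = of_int (2 * k + int c - 1 - int n) / (2 * real n)"
    have x: "x * (2 * real n) = 2 * of_int k + real c - 1 - real n" using n by (simp add: x_def)
    have "(a - 1/2) * (2 * real n) = 2 * real n * a - real n" by (simp add: algebra_simps)
    then have "x * (2 * real n) < (a - 1/2) * (2 * real n)" using lo unfolding x n_def[symmetric] by linarith
    moreover have "(a - 1/2 - \<epsilon>) * (2 * real n) < x * (2 * real n)" using h unfolding x by (simp add: mult.commute)
    ultimately have "x \<in> {a - 1/2 - \<epsilon><..<a - 1/2}" using n' by (simp add: mult_less_cancel_right)
    then show False using e(2) unfolding sufficiently_small_def x_def n_def[symmetric] by blast
  qed
  have "ordered_basis B"
  proof (rule ordered_basis_of_family[OF \<pi>, where F = "\<lambda>\<mu>. vsum k \<mu> (\<mu> - depth CARD('n) c \<mu>)"])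
    show "laurent.span ((\<lambda>\<mu>. vsum k \<mu> (\<mu> - depth CARD('n) c \<mu>)) ` {1..CARD('n)}) = (Smod :: 'n hfun set)"
      by (rule triangular_span) (use c in \<open>auto intro: depth_less\<close>)
    show "B (\<pi> \<mu>) = vsum k \<mu> (\<mu> - depth CARD('n) c \<mu>)" if "\<mu> \<in> {1..CARD('n)}" for \<mu> by (rule B[OF that])
    fix q :: "nat \<Rightarrow> 'n laurent" and \<mu>
    assume "(\<Sum>\<mu>=1..CARD('n). lscale (q \<mu>) (vsum k \<mu> (\<mu> - depth CARD('n) c \<mu>))) = 0" "\<mu> \<in> {1..CARD('n)}"
    then show "q \<mu> = 0" by (rule vsum_family_independent[OF c lo hi])
  qed
  moreover have "stokes_asymptotics (B (\<pi> (\<mu> m))) m (l m) \<phi> z"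
    if phi: "\<phi> \<in> {a - 1/2 - \<epsilon><..<a + \<epsilon>}" and nr: "\<not> resonant CARD('n) \<phi>" and z: "z \<in> Ldom" for m \<phi> z
  proof (rule stokes_asymptoticsI)
    fix I
    have h1: "2 * real n * (a - 1/2 - \<epsilon>) < 2 * real n * \<phi>" using phi n' by (intro mult_strict_left_mono) auto
    have h2: "2 * real n * \<phi> < 2 * real n * (a + \<epsilon>)" using phi n' by (intro mult_strict_left_mono) auto
    have mS: "\<mu> m \<in> {1..CARD('n)}" using mu[of m] by (simp add: S_def n_def)
    show "(\<lambda>r. B (\<pi> (\<mu> m)) (log_p CARD('n) r \<phi>) z $ I - lead z (int m + int CARD('n) * l m) \<phi> r)
      \<in> O[at_top](\<lambda>r. lead z (int m + int CARD('n) * l m) \<phi> r / of_real r)"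
      unfolding n_def[symmetric] lm unfolding n_def B[OF mS]
    proof (rule vsum_asymptotics[OF z mS c _ _ nr])
      show "2 * of_int k + real c - 1 - real CARD('n) < 2 * real CARD('n) * \<phi>" using left h1 unfolding n_def[symmetric] by linarith
      show "2 * real CARD('n) * \<phi> < 2 * of_int k + real c" using right h2 unfolding n_def[symmetric] by linarith
    qed
  qed
  ultimately show ?thesis unfolding stokes_basis_def
    using bij by (intro conjI exI[of _ "\<lambda>m. \<pi> (\<mu> m)"] exI[of _ l]) (auto simp: S_def n_def)
qed

lemma vsum_self: "vsum k m m = (vv k m :: 'n::finite hfun)"
  by (simp add: vsum_def esym_0)

text \<open>The position of \<open>v\<^sub>\<mu>\<close>, or of its corrected form, in \<open>Q'\<^sub>k\<close>.\<close>

definition Q1_pos :: "nat \<Rightarrow> nat \<Rightarrow> nat" where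
  "Q1_pos n \<mu> = (if 2 * \<mu> \<le> n + 1 then 2 * \<mu> - 1 else 2 * (n + 1 - \<mu>))"

text \<open>The position of \<open>v\<^sub>\<mu>\<close>, or of its corrected form, in \<open>Q''\<^sub>k\<close>.\<close>

definition Q2_pos :: "nat \<Rightarrow> nat \<Rightarrow> nat" where
  "Q2_pos n \<mu> = (if 2 * \<mu> \<le> n then 2 * \<mu> else 2 * (n + 1 - \<mu>) - 1)"

lemma bij_Q1_pos: "bij_betw (Q1_pos n) {1..n} {1..n}"
proof -
  have inj: "inj_on (Q1_pos n) {1..n}"
    by (rule inj_onI) (auto simp: Q1_pos_def split: if_splits; presburger)
  then show ?thesis
    by (rule bij_betw_imageI) (rule endo_inj_surj[OF _ _ inj], auto simp: Q1_pos_def split: if_splits)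
qed

lemma bij_Q2_pos: "bij_betw (Q2_pos n) {1..n} {1..n}"
proof -
  have inj: "inj_on (Q2_pos n) {1..n}"
    by (rule inj_onI) (auto simp: Q2_pos_def split: if_splits; presburger)
  then show ?thesis
    by (rule bij_betw_imageI) (rule endo_inj_surj[OF _ _ inj], auto simp: Q2_pos_def split: if_splits)
qed

lemma Q1_at_pos:
  assumes "\<mu> \<in> {1..CARD('n)}"
  shows "Q1 k (Q1_pos CARD('n) \<mu>) = (vsum k \<mu> (\<mu> - depth CARD('n) 2 \<mu>) :: 'n::finite hfun)"
proof -
  define n where "n = CARD('n)"
  define h where "h = n div 2"
  have mu: "1 \<le> \<mu>" "\<mu> \<le> n" using assms by (auto simp: n_def)
  have nh: "n = (if odd n then 2 * h + 1 else 2 * h)" by (auto simp: h_def)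
  show ?thesis
  proof (cases "2 * \<mu> \<le> n + 1")
    case True
    then have p: "Q1_pos n \<mu> = 2 * \<mu> - 1" "depth n 2 \<mu> = 0" by (simp_all add: Q1_pos_def depth_def)
    have o: "odd (2 * \<mu> - 1)" "(2 * \<mu> - 1 + 1) div 2 = \<mu>" using mu by auto
    show ?thesis unfolding n_def[symmetric] p Q1_def Let_def using o by (simp add: vsum_self)
  next
    case False
    then have p: "Q1_pos n \<mu> = 2 * (n + 1 - \<mu>)" by (simp add: Q1_pos_def)
    have d: "\<mu> - depth n 2 \<mu> = n + 2 - \<mu>" using False mu by (simp add: depth_def)
    show ?thesis
    proof (cases "\<not> odd n \<and> \<mu> = h + 1")
      case True
      then have "depth n 2 \<mu> = 0" "2 * (n + 1 - \<mu>) = 2 * h" using nh by (auto simp: depth_def)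
      then show ?thesis using True unfolding n_def[symmetric] p Q1_def Let_def h_def[symmetric] by (simp add: vsum_self)
    next
      case False
      have ne: "odd n \<or> 2 * (n + 1 - \<mu>) \<noteq> 2 * h" using False nh mu by auto
      have i: "2 * h + 2 - (n + 1 - \<mu>) = \<mu>" if "odd n" using nh mu that by auto
      have i': "2 * h + 1 - (n + 1 - \<mu>) = \<mu>" if "even n" using nh mu that by auto
      have l: "n + 1 - \<mu> + 1 = n + 2 - \<mu>" using mu by simp
      show ?thesis unfolding n_def[symmetric] p d Q1_def Let_def h_def[symmetric]
        using ne i i' l by auto
    qed
  qed
qed

lemma Q2_at_pos:
  assumes "\<mu> \<in> {1..CARD('n)}"
  shows "Q2 k (Q2_pos CARD('n) \<mu>) = (vsum k \<mu> (\<mu> - depth CARD('n) 1 \<mu>) :: 'n::finite hfun)"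
proof -
  define n where "n = CARD('n)"
  define h where "h = n div 2"
  have mu: "1 \<le> \<mu>" "\<mu> \<le> n" using assms by (auto simp: n_def)
  have nh: "n = (if odd n then 2 * h + 1 else 2 * h)" by (auto simp: h_def)
  show ?thesis
  proof (cases "2 * \<mu> \<le> n")
    case True
    then have p: "Q2_pos n \<mu> = 2 * \<mu>" "depth n 1 \<mu> = 0" by (simp_all add: Q2_pos_def depth_def)
    show ?thesis unfolding n_def[symmetric] p Q2_def Let_def by (simp add: vsum_self)
  next
    case False
    then have p: "Q2_pos n \<mu> = 2 * (n + 1 - \<mu>) - 1" by (simp add: Q2_pos_def)
    have d: "\<mu> - depth n 1 \<mu> = n + 1 - \<mu>" using False mu by (simp add: depth_def)
    have o: "odd (2 * (n + 1 - \<mu>) - 1)" "(2 * (n + 1 - \<mu>) - 1 + 1) div 2 = n + 1 - \<mu>" using mu by auto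
    show ?thesis
    proof (cases "odd n \<and> \<mu> = h + 1")
      case True
      then have "depth n 1 \<mu> = 0" "2 * (n + 1 - \<mu>) - 1 = 2 * h + 1" using nh by (auto simp: depth_def)
      then show ?thesis using True unfolding n_def[symmetric] p Q2_def Let_def h_def[symmetric] by (simp add: vsum_self)
    next
      case False
      have ne: "even n \<or> 2 * (n + 1 - \<mu>) - 1 \<noteq> 2 * h + 1" using False nh mu by auto
      have i: "2 * h + 2 - (n + 1 - \<mu>) = \<mu>" if "odd n" using nh mu that by auto
      have i': "2 * h + 1 - (n + 1 - \<mu>) = \<mu>" if "even n" using nh mu that by auto
      show ?thesis unfolding n_def[symmetric] p d Q2_def Let_def h_def[symmetric] o(2)
        using ne i i' o(1) by auto
    qed
  qed
qed

theorem theorem7p1: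
  fixes k :: int
  assumes "CARD('n::finite) \<ge> 2"
  shows
    "(\<forall>a::real. (2 * of_int k + 1) / (2 * real CARD('n)) < a \<and> a < (of_int k + 1) / real CARD('n) \<longrightarrow>
        (\<forall>\<epsilon>>0. sufficiently_small CARD('n) a \<epsilon> \<longrightarrow>
           stokes_basis (a - 1/2 - \<epsilon>) (a + \<epsilon>) (Q1 k :: nat \<Rightarrow> 'n hfun))) \<and>
     (\<forall>a::real. of_int k / real CARD('n) < a \<and> a < (2 * of_int k + 1) / (2 * real CARD('n)) \<longrightarrow>
        (\<forall>\<epsilon>>0. sufficiently_small CARD('n) a \<epsilon> \<longrightarrow>
           stokes_basis (a - 1/2 - \<epsilon>) (a + \<epsilon>) (Q2 k :: nat \<Rightarrow> 'n hfun)))"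
proof (intro conjI allI impI; elim conjE)
  fix a \<epsilon> :: real
  assume a: "(2 * of_int k + 1) / (2 * real CARD('n)) < a" "a < (of_int k + 1) / real CARD('n)"
    and e: "0 < \<epsilon>" "sufficiently_small CARD('n) a \<epsilon>"
  show "stokes_basis (a - 1/2 - \<epsilon>) (a + \<epsilon>) (Q1 k :: nat \<Rightarrow> 'n hfun)"
    by (rule stokes_basis_of_family[OF _ _ _ e bij_Q1_pos Q1_at_pos]) (use a in \<open>simp_all add: field_simps\<close>)
next
  fix a \<epsilon> :: real
  assume a: "of_int k / real CARD('n) < a" "a < (2 * of_int k + 1) / (2 * real CARD('n))"
    and e: "0 < \<epsilon>" "sufficiently_small CARD('n) a \<epsilon>"
  show "stokes_basis (a - 1/2 - \<epsilon>) (a + \<epsilon>) (Q2 k :: nat \<Rightarrow> 'n hfun)"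
    by (rule stokes_basis_of_family[OF _ _ _ e bij_Q2_pos Q2_at_pos]) (use a in \<open>simp_all add: field_simps\<close>)
qed

end
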